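(* Let $T[1..n]$ be any text over an integer alphabet $\Sigma$ (terminated by the end-marker $\$$), and let $e$ be the size of the CDAWG of $T$. Given a self-index version of the CDAWG of $T$ (without access to the text $T$), the run-length encoded BWT of $T$, which has $r \le e$ runs, can be constructed in $O(e)$ worst-case time using $O(e)$ words of working space.
   Context: $T=T[1..n]$ is a text over an integer alphabet $\Sigma$ with total order $\le_\Sigma$, whose last symbol $T[n]=\$$ occurs nowhere else in $T$ and is smaller than every other symbol. $T_p=T[p..n]$ denotes the $p$-th suffix. The suffix array $SA[1..n]$ lists the starting positions of the suffixes of $T$ in increasing lexicographic order. The BWT of $T$ is the string $BWT[1..n]$ with $BWT[k]=T[n]$ if $SA[k]=1$ and $BWT[k]=T[SA[k]-1]$ otherwise; the run-length BWT (RLBWT) is the run-length encoding of $BWT$, and $r$ denotes its number of runs (maximal equal-symbol blocks). The CDAWG (compact directed acyclic word graph) $G$ of $T$ is the edge-labeled DAG obtained from the suffix tree of $T$ by merging all isomorphic subtrees; it has a source (root) and a sink, each edge is labeled by a nonempty string, and the root-to-sink paths spell exactly the $n$ suffixes of $T$, bijectively. Its size $e$ is the number of its edges plus the number of its suffix links. The self-index version of the CDAWG is a representation of $G$ in $O(e)$ words from which the edge labels can be recovered without storing or accessing $T$ (as in Belazzougui–Cunial 2017 and Takagi et al. 2017). Word-RAM model. *)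

theory Defs
  imports Complex_Main "HOL-Library.Sublist" "HOL-Library.List_Lexorder"
begin

section \<open>Texts, suffix array, BWT\<close>

text \<open>Symbols are natural numbers (an integer alphabet with its usual order). Positions are
  0-based, so the suffix with 1-based number \<open>p + 1\<close> is \<open>drop p T\<close>.
  List comparison is lexicographic.\<close>

type_synonym str = "nat list"

definition terminated :: "str \<Rightarrow> bool" where
  "terminated T \<longleftrightarrow> T \<noteq> [] \<and> (\<forall>a \<in> set (butlast T). last T < a)"

definition suffix_array :: "str \<Rightarrow> nat list" where
  "suffix_array T = sort_key (\<lambda>p. drop p T) [0..<length T]"

definition bwt :: "str \<Rightarrow> str" where
  "bwt T = map (\<lambda>p. if p = 0 then last T else T ! (p - 1)) (suffix_array T)"

fun run_length_encode :: "'a list \<Rightarrow> ('a \<times> nat) list" where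
  "run_length_encode [] = []"
| "run_length_encode (x # xs) =
    (case run_length_encode xs of
       [] \<Rightarrow> [(x, 1)]
     | (y, k) # rs \<Rightarrow> if x = y then (y, Suc k) # rs else (x, 1) # (y, k) # rs)"

definition rlbwt :: "str \<Rightarrow> (nat \<times> nat) list" where
  "rlbwt T = run_length_encode (bwt T)"

definition bwt_runs :: "str \<Rightarrow> nat" where
  "bwt_runs T = length (rlbwt T)"


section \<open>Suffix tree\<close>

text \<open>A node of the suffix tree is identified with the string spelled from the root to it.
  The root is \<open>[]\<close>, the leaves are the nonempty suffixes of \<open>T\<close>, and the remaining nodes are the
  branching factors of \<open>T\<close>.\<close>

definition st_nodes :: "str \<Rightarrow> str set" where
  "st_nodes T = {[]} \<union> {x. x \<noteq> [] \<and> suffix x T}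
     \<union> {x. \<exists>a b. a \<noteq> b \<and> sublist (x @ [a]) T \<and> sublist (x @ [b]) T}"

definition st_edges :: "str \<Rightarrow> (str \<times> str \<times> str) set" where
  "st_edges T = {(x, l, y). x \<in> st_nodes T \<and> y \<in> st_nodes T \<and> l \<noteq> [] \<and> y = x @ l \<and>
     \<not> (\<exists>z \<in> st_nodes T. strict_prefix x z \<and> strict_prefix z y)}"

definition st_subtree :: "str \<Rightarrow> str \<Rightarrow> str set" where
  "st_subtree T x = {y \<in> st_nodes T. prefix x y}"

definition st_iso :: "str \<Rightarrow> (str \<times> str) set" where
  "st_iso T = {(x, y). x \<in> st_nodes T \<and> y \<in> st_nodes T \<and>
     (\<exists>f. bij_betw f (st_subtree T x) (st_subtree T y) \<and> f x = y \<and>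
        (\<forall>u \<in> st_subtree T x. \<forall>v \<in> st_subtree T x. \<forall>l.
           (u, l, v) \<in> st_edges T \<longleftrightarrow> (f u, l, f v) \<in> st_edges T))}"


section \<open>CDAWG\<close>

text \<open>A node of the CDAWG is a class of suffix tree nodes with isomorphic subtrees.\<close>

definition cdawg_nodes :: "str \<Rightarrow> str set set" where
  "cdawg_nodes T = st_nodes T // st_iso T"

definition cdawg_edges :: "str \<Rightarrow> (str set \<times> str \<times> str set) set" where
  "cdawg_edges T = {(U, l, V). U \<in> cdawg_nodes T \<and> V \<in> cdawg_nodes T \<and>
     (\<exists>u \<in> U. \<exists>v \<in> V. (u, l, v) \<in> st_edges T)}"

definition cdawg_root :: "str \<Rightarrow> str set" where
  "cdawg_root T = st_iso T `` {[]}"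

definition cdawg_sink :: "str \<Rightarrow> str set" where
  "cdawg_sink T = st_iso T `` {T}"

text \<open>The suffix links \<open>a # x \<rightarrow> x\<close> of the suffix tree, without those that become loops
  when isomorphic subtrees are merged. Every node but the root has exactly one: it leads to the
  node of the longest suffix of the strings in \<open>U\<close> that is not itself in \<open>U\<close>.\<close>

definition cdawg_suffix_links :: "str \<Rightarrow> (str set \<times> str set) set" where
  "cdawg_suffix_links T = {(U, V). U \<in> cdawg_nodes T \<and> V \<in> cdawg_nodes T \<and> U \<noteq> V \<and>
     (\<exists>a x. a # x \<in> U \<and> x \<in> V)}"

definition cdawg_size :: "str \<Rightarrow> nat" where
  "cdawg_size T = card (cdawg_edges T) + card (cdawg_suffix_links T)"

text \<open>The length of the longest string spelled by a path from the root to \<open>U\<close>.\<close>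

definition node_length :: "str set \<Rightarrow> nat" where
  "node_length U = Max (length ` U)"


section \<open>Self-index version of the CDAWG\<close>

text \<open>The text-free representation of Belazzougui and Cunial, as a sequence of words.
  \<^item> \<open>ns\<close> is an arbitrary numbering of the nodes; \<open>rt\<close> and \<open>sk\<close> are the numbers of the root
    and the sink; \<open>sl\<close> holds the suffix links (the root points to itself).
  \<^item> \<open>es\<close> lists the edges grouped by source, the edges leaving a node in lexicographic order.
    Of a label only the first symbol and the length are stored.
  \<^item> \<open>ins\<close> lists the indices (in \<open>es\<close>) of the edges grouped by target, the edges entering a node
    by decreasing length of the longest string spelled by a path from the root that ends with
    that edge.
  \<^item> The groups of node \<open>k\<close> in \<open>es\<close> and \<open>ins\<close> are delimited by the entries \<open>k\<close> and \<open>k + 1\<close>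
    of two offset tables.

  The lists of entering edges are the productions of a grammar that replaces the text. Let \<open>F v\<close>
  consist of the first symbols of the strings in the class \<open>v\<close>, from the longest string to the
  shortest. Then \<open>F v\<close> is the concatenation, over the edges entering \<open>v\<close> in the stored order, of
  \<open>F u\<close> for the source \<open>u\<close> of the edge, or of the first symbol of the edge if \<open>u\<close> is the root.
  The longest string of \<open>v\<close> is \<open>F v\<close> followed by the longest string of the suffix link target of
  \<open>v\<close>, and the label of an edge entering \<open>v\<close> is a suffix of the longest string of \<open>v\<close>, of the
  stored length.\<close>

definition cdawg_self_index :: "str \<Rightarrow> nat list \<Rightarrow> bool" where
  "cdawg_self_index T xs \<longleftrightarrow> (\<exists>ns rt sk sl es ins.
     distinct ns \<and> set ns = cdawg_nodes T \<and>
     rt < length ns \<and> ns ! rt = cdawg_root T \<and>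
     sk < length ns \<and> ns ! sk = cdawg_sink T \<and>
     length sl = length ns \<and>
     (\<forall>i < length ns. if i = rt then sl ! i = i
        else sl ! i < length ns \<and> (ns ! i, ns ! (sl ! i)) \<in> cdawg_suffix_links T) \<and>
     distinct es \<and>
     set es = {(i, l, j). i < length ns \<and> j < length ns \<and> (ns ! i, l, ns ! j) \<in> cdawg_edges T} \<and>
     sorted_wrt (\<lambda>(i, l, j) (i', l', j'). i < i' \<or> i = i' \<and> hd l < hd l') es \<and>
     distinct ins \<and> set ins = {..<length es} \<and>
     sorted_wrt (\<lambda>f g. case (es ! f, es ! g) of ((i, l, j), (i', l', j')) \<Rightarrow>
        j < j' \<or>
        j = j' \<and> node_length (ns ! i) + length l > node_length (ns ! i') + length l') ins \<and>
     xs = [length ns, length es, rt, sk] @ sl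
        @ map (\<lambda>k. length (filter (\<lambda>(i, l, j). i < k) es)) [0..<Suc (length ns)]
        @ map (\<lambda>k. length (filter (\<lambda>(i, l, j). j < k) es)) [0..<Suc (length ns)]
        @ concat (map (\<lambda>(i, l, j). [i, hd l, length l, j]) es)
        @ ins)"


section \<open>Word RAM\<close>

text \<open>Words are the natural numbers below \<open>2 ^ w\<close>. A program is a fixed finite list of
  instructions over finitely many registers, independent of the input and of \<open>w\<close>. The memory is
  a finite array of words; an access outside of it is an error. Each instruction takes one unit
  of time.\<close>

datatype binop = Add | Sub | Mul | Div | Mod | And | Or | Xor | Shl | Shr

datatype instr =
    Const nat nat            \<comment> \<open>register, constant\<close>
  | Op binop nat nat nat     \<comment> \<open>destination and operand registers\<close>
  | Load nat nat             \<comment> \<open>destination register, register holding the address\<close>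
  | Store nat nat            \<comment> \<open>register holding the address, source register\<close>
  | Jump nat
  | Jump_eq nat nat nat      \<comment> \<open>compared registers, jump target\<close>
  | Jump_less nat nat nat    \<comment> \<open>compared registers, jump target\<close>
  | Halt

fun eval_op :: "nat \<Rightarrow> binop \<Rightarrow> nat \<Rightarrow> nat \<Rightarrow> nat" where
  "eval_op w Add x y = (x + y) mod 2 ^ w"
| "eval_op w Sub x y = (x + 2 ^ w - y) mod 2 ^ w"
| "eval_op w Mul x y = (x * y) mod 2 ^ w"
| "eval_op w Div x y = x div y"
| "eval_op w Mod x y = x mod y"
| "eval_op w And x y = Bit_Operations.and x y"
| "eval_op w Or x y = Bit_Operations.or x y"
| "eval_op w Xor x y = Bit_Operations.xor x y"
| "eval_op w Shl x y = push_bit y x mod 2 ^ w"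
| "eval_op w Shr x y = drop_bit y x"

text \<open>Program counter, registers, memory.\<close>

type_synonym state = "nat \<times> (nat \<Rightarrow> nat) \<times> nat list"

fun step :: "nat \<Rightarrow> instr list \<Rightarrow> state \<Rightarrow> state option" where
  "step w P (pc, R, M) =
    (if pc < length P then
       (case P ! pc of
          Const d k \<Rightarrow> Some (Suc pc, R(d := k mod 2 ^ w), M)
        | Op f d a b \<Rightarrow> Some (Suc pc, R(d := eval_op w f (R a) (R b)), M)
        | Load d a \<Rightarrow>
            if R a < length M then Some (Suc pc, R(d := M ! R a), M) else None
        | Store a s \<Rightarrow>
            if R a < length M then Some (Suc pc, R, M[R a := R s]) else None
        | Jump l \<Rightarrow> Some (l, R, M)
        | Jump_eq a b l \<Rightarrow> Some (if R a = R b then l else Suc pc, R, M)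
        | Jump_less a b l \<Rightarrow> Some (if R a < R b then l else Suc pc, R, M)
        | Halt \<Rightarrow> None)
     else None)"

primrec steps :: "nat \<Rightarrow> instr list \<Rightarrow> nat \<Rightarrow> state \<Rightarrow> state option" where
  "steps w P 0 s = Some s"
| "steps w P (Suc t) s = Option.bind (step w P s) (steps w P t)"

definition halts_in :: "nat \<Rightarrow> instr list \<Rightarrow> nat \<Rightarrow> nat list \<Rightarrow> (nat \<Rightarrow> nat) \<Rightarrow> nat list \<Rightarrow> bool" where
  "halts_in w P t M R' M' \<longleftrightarrow>
     (\<exists>pc. steps w P t (0, \<lambda>_. 0, M) = Some (pc, R', M') \<and> pc < length P \<and> P ! pc = Halt)"

text \<open>On halting, register 0 holds the address and register 1 the number of the pairs.\<close>

definition outputs_pairs :: "(nat \<Rightarrow> nat) \<Rightarrow> nat list \<Rightarrow> (nat \<times> nat) list \<Rightarrow> bool" where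
  "outputs_pairs R M ps \<longleftrightarrow> R 1 = length ps \<and>
     take (2 * length ps) (drop (R 0) M) = concat (map (\<lambda>(c, k). [c, k]) ps)"

text \<open>Started on the words \<open>xs\<close> followed by \<open>s\<close> words of working space with arbitrary contents,
  \<open>P\<close> outputs \<open>ps\<close> after at most \<open>t\<close> steps.\<close>

definition ram_computes ::
    "nat \<Rightarrow> instr list \<Rightarrow> nat list \<Rightarrow> (nat \<times> nat) list \<Rightarrow> nat \<Rightarrow> nat \<Rightarrow> bool" where
  "ram_computes w P xs ps t s \<longleftrightarrow>
     (\<forall>work. length work = s \<and> (\<forall>x \<in> set work. x < 2 ^ w) \<longrightarrow>
        (\<exists>t' \<le> t. \<exists>R' M'. halts_in w P t' (xs @ work) R' M' \<and> outputs_pairs R' M' ps))"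

text \<open>The word size must accommodate the length of the text, the input words and the addresses of
  the memory, which consists of the input and \<open>s\<close> words of working space.\<close>

definition word_size_ok :: "nat \<Rightarrow> str \<Rightarrow> nat list \<Rightarrow> nat \<Rightarrow> bool" where
  "word_size_ok w T xs s \<longleftrightarrow>
     length T < 2 ^ w \<and> (\<forall>x \<in> set xs. x < 2 ^ w) \<and> length xs + s \<le> 2 ^ w"

end

theory Submission imports Defs "HOL-Library.Countable" begin

text \<open>
  Two nodes of the suffix tree have isomorphic subtrees iff the same strings extend them to suffixes of \<open>T\<close>.
  Hence a CDAWG node consists of suffixes of its longest string \<open>x\<close> whose lengths form an interval, and every
  string of the node other than \<open>x\<close> is always preceded in \<open>T\<close> by the same symbol. The BWT of the suffixes
  below such a shorter string is therefore a single run.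

  Traverse the suffix tree in lexicographic order but descend only into longest strings, that is along the
  primary edges of the CDAWG, those that come first among the edges entering their target. Since each node has
  exactly one primary edge, this visits each edge of the CDAWG once. A secondary edge contributes one run. Its
  length is the number of paths from the target to the sink, which Kahn's algorithm computes for all nodes. Its
  symbol is the first symbol of the shortest string passing through the preceding edge into the same target,
  which is found by following the last edge into a node backwards. The primary edge into the sink stands for
  \<open>T\<close> itself and contributes the end-marker, which is the first symbol of the first edge of the root.
\<close>

section \<open>Right contexts\<close>

definition right_contexts :: "str \<Rightarrow> str \<Rightarrow> str set" where
  "right_contexts T x = {z. x @ z \<noteq> [] \<and> suffix (x @ z) T}"

locale terminated_text =
  fixes T :: str
  assumes terminated: "terminated T"
begin

abbreviation contexts :: "str \<Rightarrow> str set" where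
  "contexts \<equiv> right_contexts T"

lemma text_nonempty: "T \<noteq> []"
  using terminated by (simp add: terminated_def)

lemma last_symbol_le:
  assumes "a \<in> set T"
  shows "last T \<le> a"
proof -
  have "set T = insert (last T) (set (butlast T))"
    using arg_cong[OF append_butlast_last_id[OF text_nonempty], of set] by simp
  then show ?thesis
    using terminated assms by (auto simp: terminated_def intro: less_imp_le)
qed

lemma last_symbol_only_at_end:
  assumes "T = p @ last T # q"
  shows "q = []"
proof (rule ccontr)
  assume "q \<noteq> []"
  then have "last T \<in> set (butlast T)"
    by (subst (2) assms) (simp add: butlast_append)
  then show False
    using terminated by (auto simp: terminated_def)
qed

lemma suffix_not_extendable:
  assumes "s \<noteq> []" "suffix s T" "suffix (s @ z) T"
  shows "z = []"
proof -
  have "last s = last T"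
    using assms(1,2) by (metis last_appendR suffix_def)
  then have "s = butlast s @ [last T]"
    using assms(1) by (metis append_butlast_last_id)
  moreover obtain p where "T = p @ s @ z"
    using assms(3) by (auto simp: suffix_def)
  ultimately have "T = p @ (butlast s @ [last T]) @ z"
    by simp
  then have "T = (p @ butlast s) @ last T # z"
    by simp
  then show ?thesis
    by (rule last_symbol_only_at_end)
qed

lemma contexts_append_iff: "z' \<in> contexts (x @ z) \<longleftrightarrow> z @ z' \<in> contexts x"
  by (auto simp: right_contexts_def)

lemma contexts_append_cong: "contexts x = contexts y \<Longrightarrow> contexts (x @ z) = contexts (y @ z)"
  by (auto simp: contexts_append_iff)

lemma Nil_in_contexts_iff: "[] \<in> contexts x \<longleftrightarrow> x \<noteq> [] \<and> suffix x T"
  by (simp add: right_contexts_def)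

lemma contexts_of_leaf: "[] \<in> contexts x \<Longrightarrow> contexts x = {[]}"
  using suffix_not_extendable by (auto simp: right_contexts_def)

lemma contexts_text: "contexts T = {[]}"
  using text_nonempty by (intro contexts_of_leaf) (simp add: Nil_in_contexts_iff)

lemma contexts_eq_root_iff: "contexts x = contexts [] \<longleftrightarrow> x = []"
proof
  assume "contexts x = contexts []"
  moreover have "T \<in> contexts []"
    by (simp add: right_contexts_def text_nonempty)
  ultimately have "T \<in> contexts x"
    by simp
  then have "length (x @ T) \<le> length T"
    unfolding right_contexts_def by (intro suffix_length_le) simp
  then show "x = []"
    by simp
qed simp

lemma sublist_snoc_iff_contexts: "sublist (x @ [a]) T \<longleftrightarrow> (\<exists>z. a # z \<in> contexts x)"
  by (auto simp: right_contexts_def sublist_def suffix_def)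

lemma finite_contexts: "finite (contexts x)"
proof (rule finite_imageD)
  show "finite ((@) x ` contexts x)"
    by (rule finite_subset[of _ "set (suffixes T)"]) (auto simp: right_contexts_def)
qed (simp add: inj_on_def)


section \<open>Nodes and edges of the suffix tree\<close>

lemma st_nodes_iff:
  "x \<in> st_nodes T \<longleftrightarrow> x = [] \<or> [] \<in> contexts x \<or>
     (\<exists>a b y z. a \<noteq> b \<and> a # y \<in> contexts x \<and> b # z \<in> contexts x)"
  unfolding st_nodes_def sublist_snoc_iff_contexts Nil_in_contexts_iff by blast

lemma Nil_in_st_nodes: "[] \<in> st_nodes T"
  by (simp add: st_nodes_iff)

lemma text_in_st_nodes: "T \<in> st_nodes T"
  by (simp add: st_nodes_iff contexts_text)

lemma leaf_in_st_nodes: "z \<in> contexts x \<Longrightarrow> x @ z \<in> st_nodes T"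
  by (auto simp: st_nodes_iff Nil_in_contexts_iff right_contexts_def)

lemma st_nodes_cong: "contexts x = contexts y \<Longrightarrow> x \<in> st_nodes T \<longleftrightarrow> y \<in> st_nodes T"
  by (metis contexts_eq_root_iff st_nodes_iff)

lemma contexts_nonempty: "x \<in> st_nodes T \<Longrightarrow> contexts x \<noteq> {}"
  using text_nonempty by (auto simp: st_nodes_iff) (auto simp: right_contexts_def)

lemma finite_st_nodes: "finite (st_nodes T)"
proof (rule finite_subset)
  show "st_nodes T \<subseteq> set (sublists T)"
  proof
    fix x assume "x \<in> st_nodes T"
    then obtain z where "suffix (x @ z) T"
      using contexts_nonempty by (auto simp: right_contexts_def)
    then show "x \<in> set (sublists T)"
      by (auto simp: suffix_def sublist_def)
  qed
qed simp

lemma st_edges_iff: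
  "(x, l, y) \<in> st_edges T \<longleftrightarrow> x \<in> st_nodes T \<and> y = x @ l \<and> l \<noteq> [] \<and> x @ l \<in> st_nodes T \<and>
     (\<forall>m. m \<noteq> [] \<and> strict_prefix m l \<longrightarrow> x @ m \<notin> st_nodes T)"
proof -
  have "(\<exists>z \<in> st_nodes T. strict_prefix x z \<and> strict_prefix z (x @ l)) \<longleftrightarrow>
      (\<exists>m. m \<noteq> [] \<and> strict_prefix m l \<and> x @ m \<in> st_nodes T)" (is "?between \<longleftrightarrow> ?extension")
  proof
    assume ?between
    then obtain z where z: "z \<in> st_nodes T" "strict_prefix x z" "strict_prefix z (x @ l)"
      by blast
    then obtain m where "z = x @ m" "m \<noteq> []"
      by (auto simp: strict_prefix_def prefix_def)
    then show ?extension
      using z by (auto simp: strict_prefix_def)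
  next
    assume ?extension
    then obtain m where "m \<noteq> []" "strict_prefix m l" "x @ m \<in> st_nodes T"
      by blast
    then show ?between
      by (intro bexI[of _ "x @ m"]) (auto simp: strict_prefix_def)
  qed
  then show ?thesis
    unfolding st_edges_def by blast
qed

lemma st_edge_target: "(x, l, y) \<in> st_edges T \<Longrightarrow> y = x @ l"
  by (simp add: st_edges_iff)

lemma st_edges_cong:
  assumes "\<And>m. x @ m \<in> st_nodes T \<longleftrightarrow> y @ m \<in> st_nodes T"
  shows "(x, l, x @ l) \<in> st_edges T \<longleftrightarrow> (y, l, y @ l) \<in> st_edges T"
  using assms assms[of "[]"] by (simp add: st_edges_iff)

lemma st_edge_exists:
  assumes "x \<in> st_nodes T" "z \<in> contexts x" "z \<noteq> []"
  obtains l where "(x, l, x @ l) \<in> st_edges T" "prefix l z"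
proof -
  define reached where "reached m \<longleftrightarrow> m \<noteq> [] \<and> prefix m z \<and> x @ m \<in> st_nodes T" for m
  have "reached z"
    using assms leaf_in_st_nodes by (simp add: reached_def)
  then obtain l where l: "reached l" and shortest: "\<And>m. length m < length l \<Longrightarrow> \<not> reached m"
    using ex_has_least_nat[of reached z length] by (meson not_less)
  have "x @ m \<notin> st_nodes T" if "m \<noteq> []" "strict_prefix m l" for m
    using shortest[of m] that l prefix_length_less[of m l]
    by (auto simp: reached_def strict_prefix_def)
  then have "(x, l, x @ l) \<in> st_edges T"
    using l assms(1) by (auto simp: st_edges_iff reached_def)
  then show ?thesis
    using l that by (auto simp: reached_def)
qed

lemma branching_in_st_nodes:
  assumes "m @ a # y \<in> contexts x" "m @ b # z \<in> contexts x" "a \<noteq> b"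
  shows "x @ m \<in> st_nodes T"
  using assms by (auto simp: st_nodes_iff contexts_append_iff)

lemma st_edge_label_unique:
  assumes "(x, l, y) \<in> st_edges T" "(x, l', y') \<in> st_edges T" "hd l = hd l'"
  shows "l = l'"
proof (rule ccontr)
  assume "l \<noteq> l'"
  have nodes: "l \<noteq> []" "l' \<noteq> []" "x @ l \<in> st_nodes T" "x @ l' \<in> st_nodes T"
    using assms by (auto simp: st_edges_iff)
  have "\<not> strict_prefix l l'" "\<not> strict_prefix l' l"
    using assms nodes by (auto simp: st_edges_iff)
  then have "l \<parallel> l'"
    using \<open>l \<noteq> l'\<close> by (auto simp: strict_prefix_def parallel_def)
  then obtain m b bs c cs where m: "b \<noteq> c" "l = m @ b # bs" "l' = m @ c # cs"
    using parallel_decomp by blast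
  obtain u v where "u \<in> contexts (x @ l)" "v \<in> contexts (x @ l')"
    using nodes contexts_nonempty by blast
  then have "x @ m \<in> st_nodes T"
    using m by (intro branching_in_st_nodes[of m b "bs @ u" x c "cs @ v"])
      (auto simp: contexts_append_iff)
  moreover have "strict_prefix m l" "m \<noteq> []"
    using m assms(3) by (auto simp: strict_prefix_def)
  ultimately show False
    using assms(1) by (auto simp: st_edges_iff)
qed

lemma st_parent_exists:
  assumes "x \<in> st_nodes T" "x @ z \<in> st_nodes T" "z \<noteq> []"
  obtains z' l where "z = z' @ l" "(x @ z', l, x @ z) \<in> st_edges T"
proof -
  define passed where "passed m \<longleftrightarrow> strict_prefix m z \<and> x @ m \<in> st_nodes T" for m
  have "passed []"
    using assms by (simp add: passed_def strict_prefix_def)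
  moreover have "\<forall>m. passed m \<longrightarrow> length m < length z"
    by (auto simp: passed_def dest: prefix_length_less)
  ultimately obtain m where m: "passed m" and longest: "\<And>m'. passed m' \<Longrightarrow> length m' \<le> length m"
    using ex_has_greatest_nat[of passed "[]" length "length z"] by blast
  obtain l where l: "z = m @ l" "l \<noteq> []"
    using m by (auto simp: passed_def strict_prefix_def prefix_def)
  have "(x @ m) @ k \<notin> st_nodes T" if "k \<noteq> []" "strict_prefix k l" for k
    using longest[of "m @ k"] that l by (auto simp: passed_def strict_prefix_def)
  then have "(x @ m, l, x @ z) \<in> st_edges T"
    using m l assms by (auto simp: st_edges_iff passed_def)
  then show ?thesis
    using l that by blast
qed

lemma st_parent_unique:
  assumes "(x, l, y) \<in> st_edges T" "(x', l', y) \<in> st_edges T"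
  shows "x = x' \<and> l = l'"
proof -
  have not_below: "\<not> strict_prefix x x'"
    if "(x, l, y) \<in> st_edges T" "(x', l', y) \<in> st_edges T" for x l x' l'
    using that by (auto simp: st_edges_def strict_prefix_def)
  have "prefix x y" "prefix x' y"
    using st_edge_target assms by (blast intro: prefixI)+
  then have "prefix x x' \<or> prefix x' x"
    by (rule prefix_same_cases)
  then have "x = x'"
    using not_below[OF assms] not_below[OF assms(2,1)] by (auto simp: strict_prefix_def)
  then show ?thesis
    using assms by (auto simp: st_edges_iff)
qed

lemma leaf_iff_no_st_edge:
  assumes "x \<in> st_nodes T"
  shows "[] \<in> contexts x \<longleftrightarrow> (\<nexists>l. (x, l, x @ l) \<in> st_edges T)"
proof
  assume "[] \<in> contexts x"
  then have leaf: "contexts x = {[]}"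
    by (rule contexts_of_leaf)
  show "\<nexists>l. (x, l, x @ l) \<in> st_edges T"
  proof
    assume "\<exists>l. (x, l, x @ l) \<in> st_edges T"
    then obtain l where "l \<noteq> []" "x @ l \<in> st_nodes T"
      by (auto simp: st_edges_iff)
    then obtain z where "l @ z \<in> contexts x"
      using contexts_nonempty contexts_append_iff by blast
    then show False
      using leaf \<open>l \<noteq> []\<close> by simp
  qed
next
  assume "\<nexists>l. (x, l, x @ l) \<in> st_edges T"
  moreover obtain z where "z \<in> contexts x"
    using contexts_nonempty assms by blast
  ultimately show "[] \<in> contexts x"
    using st_edge_exists[OF assms] by metis
qed


section \<open>Isomorphic subtrees have the same right contexts\<close>

lemma st_isomorphism_append:
  assumes x: "x \<in> st_nodes T"
    and edges: "\<And>u l v. u \<in> st_subtree T x \<Longrightarrow> v \<in> st_subtree T x \<Longrightarrow>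
      (u, l, v) \<in> st_edges T \<Longrightarrow> (f u, l, f v) \<in> st_edges T"
    and "x @ z \<in> st_nodes T"
  shows "f (x @ z) = f x @ z"
  using assms(3)
proof (induction z rule: measure_induct_rule[of length])
  case (less z)
  show ?case
  proof (cases "z = []")
    case False
    obtain z' l where z: "z = z' @ l" and edge: "(x @ z', l, x @ z) \<in> st_edges T"
      using st_parent_exists[OF x less.prems False] .
    then have parent: "x @ z' \<in> st_nodes T" "l \<noteq> []"
      by (auto simp: st_edges_iff)
    then have "f (x @ z') = f x @ z'"
      using less.IH z by auto
    moreover have "(f (x @ z'), l, f (x @ z)) \<in> st_edges T"
      using edge parent less.prems by (intro edges) (auto simp: st_subtree_def)
    ultimately show ?thesis
      using z by (auto simp: st_edges_iff)
  qed simp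
qed

lemma st_iso_append_in_st_nodes_iff:
  assumes "(x, y) \<in> st_iso T"
  shows "x @ z \<in> st_nodes T \<longleftrightarrow> y @ z \<in> st_nodes T"
proof -
  from assms obtain f where "x \<in> st_nodes T" "f x = y"
    and bij: "bij_betw f (st_subtree T x) (st_subtree T y)"
    and edges: "\<And>u v l. u \<in> st_subtree T x \<Longrightarrow> v \<in> st_subtree T x \<Longrightarrow>
      (u, l, v) \<in> st_edges T \<longleftrightarrow> (f u, l, f v) \<in> st_edges T"
    unfolding st_iso_def by blast
  then have f_append: "f (x @ z) = y @ z" if "x @ z \<in> st_nodes T" for z
    using st_isomorphism_append[of x f z] that by auto
  show ?thesis
  proof
    assume "x @ z \<in> st_nodes T"
    moreover from this have "f (x @ z) \<in> st_subtree T y"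
      using bij_betwE[OF bij] by (auto simp: st_subtree_def)
    ultimately show "y @ z \<in> st_nodes T"
      using f_append by (auto simp: st_subtree_def)
  next
    assume "y @ z \<in> st_nodes T"
    then have "y @ z \<in> f ` st_subtree T x"
      using bij by (auto simp: st_subtree_def bij_betw_def)
    then obtain v where "f (x @ v) = y @ z" "x @ v \<in> st_nodes T"
      by (auto simp: st_subtree_def prefix_def)
    then show "x @ z \<in> st_nodes T"
      using f_append[of v] by auto
  qed
qed

lemma contexts_subset_if_same_nodes:
  assumes nodes: "\<And>z. x @ z \<in> st_nodes T \<longleftrightarrow> y @ z \<in> st_nodes T"
  shows "contexts x \<subseteq> contexts y"
proof
  fix z assume z: "z \<in> contexts x"
  have "(x @ z, l, (x @ z) @ l) \<in> st_edges T \<longleftrightarrow> (y @ z, l, (y @ z) @ l) \<in> st_edges T" for l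
    using nodes by (intro st_edges_cong) simp
  moreover have "x @ z \<in> st_nodes T" "y @ z \<in> st_nodes T"
    using leaf_in_st_nodes[OF z] nodes by auto
  moreover have "[] \<in> contexts (x @ z)"
    using z by (simp add: contexts_append_iff)
  ultimately have "[] \<in> contexts (y @ z)"
    by (simp add: leaf_iff_no_st_edge)
  then show "z \<in> contexts y"
    by (simp add: contexts_append_iff)
qed

lemma st_iso_if_contexts_eq:
  assumes "x \<in> st_nodes T" "y \<in> st_nodes T" "contexts x = contexts y"
  shows "(x, y) \<in> st_iso T"
proof -
  define f where "f u = y @ drop (length x) u" for u
  have nodes: "x @ z \<in> st_nodes T \<longleftrightarrow> y @ z \<in> st_nodes T" for z
    by (intro st_nodes_cong contexts_append_cong assms(3))
  have "bij_betw f (st_subtree T x) (st_subtree T y)"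
    by (rule bij_betw_byWitness[where f' = "\<lambda>u. x @ drop (length y) u"])
      (auto simp: st_subtree_def f_def prefix_def nodes)
  moreover have "(u, l, v) \<in> st_edges T \<longleftrightarrow> (f u, l, f v) \<in> st_edges T"
    if "u \<in> st_subtree T x" "v \<in> st_subtree T x" for u v l
    using that nodes by (auto simp: st_subtree_def f_def prefix_def st_edges_iff)
  ultimately show ?thesis
    using assms(1,2) unfolding st_iso_def by (auto intro!: exI[of _ f] simp: f_def)
qed

lemma st_iso_iff:
  "(x, y) \<in> st_iso T \<longleftrightarrow> x \<in> st_nodes T \<and> y \<in> st_nodes T \<and> contexts x = contexts y"
proof
  assume iso: "(x, y) \<in> st_iso T"
  note nodes = st_iso_append_in_st_nodes_iff[OF iso]
  have "contexts x = contexts y"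
    by (intro equalityI contexts_subset_if_same_nodes) (simp_all add: nodes)
  then show "x \<in> st_nodes T \<and> y \<in> st_nodes T \<and> contexts x = contexts y"
    using iso by (simp add: st_iso_def)
qed (simp add: st_iso_if_contexts_eq)

lemma equiv_st_iso: "equiv (st_nodes T) (st_iso T)"
  by (rule equivI) (auto simp: st_iso_iff refl_on_def sym_def trans_def)

end


section \<open>Nodes of the CDAWG\<close>

definition longest :: "str set \<Rightarrow> str" where
  "longest U = arg_max_on length U"

definition shortest :: "str set \<Rightarrow> str" where
  "shortest U = arg_min_on length U"

context terminated_text
begin

lemma st_iso_class_in_cdawg_nodes: "x \<in> st_nodes T \<Longrightarrow> st_iso T `` {x} \<in> cdawg_nodes T"
  unfolding cdawg_nodes_def by (rule quotientI)

lemma in_st_iso_class: "x \<in> st_nodes T \<Longrightarrow> x \<in> st_iso T `` {x}"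
  by (rule equiv_class_self[OF equiv_st_iso])

lemma cdawg_node_in_st_nodes: "U \<in> cdawg_nodes T \<Longrightarrow> x \<in> U \<Longrightarrow> x \<in> st_nodes T"
  using Union_quotient[OF equiv_st_iso] by (auto simp: cdawg_nodes_def)

lemma cdawg_node_nonempty: "U \<in> cdawg_nodes T \<Longrightarrow> U \<noteq> {}"
  using in_st_iso_class by (auto simp: cdawg_nodes_def elim: quotientE)

lemma finite_cdawg_node: "U \<in> cdawg_nodes T \<Longrightarrow> finite U"
  by (rule finite_subset[OF _ finite_st_nodes]) (auto intro: cdawg_node_in_st_nodes)

lemma finite_cdawg_nodes: "finite (cdawg_nodes T)"
  unfolding cdawg_nodes_def using finite_st_nodes equiv_type[OF equiv_st_iso] by (rule finite_quotient)

lemma in_cdawg_node_iff: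
  assumes "U \<in> cdawg_nodes T" "x \<in> U"
  shows "y \<in> U \<longleftrightarrow> contexts y = contexts x"
proof -
  obtain z where "U = st_iso T `` {z}"
    using assms(1) by (auto simp: cdawg_nodes_def elim: quotientE)
  then show ?thesis
    using assms(2) st_nodes_cong[of x y] by (auto simp: st_iso_iff)
qed

lemma cdawg_node_contexts_eq: "U \<in> cdawg_nodes T \<Longrightarrow> x \<in> U \<Longrightarrow> y \<in> U \<Longrightarrow> contexts x = contexts y"
  using in_cdawg_node_iff by blast

lemma cdawg_node_eqI:
  assumes "U \<in> cdawg_nodes T" "V \<in> cdawg_nodes T" "x \<in> U" "x \<in> V"
  shows "U = V"
  using assms by (simp add: set_eq_iff in_cdawg_node_iff[of _ x])

lemma cdawg_node_suffix:
  assumes "U \<in> cdawg_nodes T" "x \<in> U" "y \<in> U" "length x \<le> length y"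
  shows "suffix x y"
proof -
  obtain z where "z \<in> contexts x"
    using assms cdawg_node_in_st_nodes contexts_nonempty by blast
  then have "suffix (x @ z) T" "suffix (y @ z) T"
    using cdawg_node_contexts_eq[OF assms(1-3)] by (auto simp: right_contexts_def)
  then have "suffix (x @ z) (y @ z)"
    by (rule suffix_length_suffix) (simp add: assms(4))
  then show ?thesis
    by (auto simp: suffix_def)
qed

lemma cdawg_node_length_inj:
  assumes "U \<in> cdawg_nodes T" "x \<in> U" "y \<in> U" "length x = length y"
  shows "x = y"
  using cdawg_node_suffix[of U x y] cdawg_node_suffix[of U y x] assms
  by (simp add: suffix_order.antisym)

lemma cdawg_root_eq: "cdawg_root T = {[]}"
  by (auto simp: cdawg_root_def st_iso_iff Nil_in_st_nodes contexts_eq_root_iff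
      eq_commute[of "contexts []"])

lemma cdawg_root_in_cdawg_nodes: "cdawg_root T \<in> cdawg_nodes T"
  unfolding cdawg_root_def by (rule st_iso_class_in_cdawg_nodes[OF Nil_in_st_nodes])

lemma cdawg_node_between:
  assumes U: "U \<in> cdawg_nodes T" "x \<in> U" "y \<in> U" and "suffix x u" "suffix u y"
  shows "u \<in> U"
proof (cases "x = []")
  case True
  then have "U = {[]}"
    using cdawg_node_eqI[OF U(1) cdawg_root_in_cdawg_nodes] U(2) cdawg_root_eq by auto
  then show ?thesis
    using assms by (simp add: suffix_def)
next
  case False
  have "contexts y \<subseteq> contexts u" "contexts u \<subseteq> contexts x"
    using assms(4,5) False by (auto simp: right_contexts_def suffix_def)
  then show ?thesis
    using cdawg_node_contexts_eq[OF U] in_cdawg_node_iff[OF U(1,2)] by auto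
qed

lemma cdawg_sink_in_cdawg_nodes: "cdawg_sink T \<in> cdawg_nodes T"
  unfolding cdawg_sink_def by (rule st_iso_class_in_cdawg_nodes[OF text_in_st_nodes])

lemma text_in_cdawg_sink: "T \<in> cdawg_sink T"
  unfolding cdawg_sink_def by (rule in_st_iso_class[OF text_in_st_nodes])

lemma leaf_iff_cdawg_sink:
  assumes "U \<in> cdawg_nodes T" "x \<in> U"
  shows "[] \<in> contexts x \<longleftrightarrow> U = cdawg_sink T"
proof -
  have "[] \<in> contexts x \<longleftrightarrow> contexts x = contexts T"
    using contexts_of_leaf by (auto simp: contexts_text)
  also have "\<dots> \<longleftrightarrow> x \<in> cdawg_sink T"
    using in_cdawg_node_iff[OF cdawg_sink_in_cdawg_nodes text_in_cdawg_sink] by simp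
  also have "\<dots> \<longleftrightarrow> U = cdawg_sink T"
    using cdawg_node_eqI[OF assms(1) cdawg_sink_in_cdawg_nodes] assms(2) by auto
  finally show ?thesis .
qed

lemma shortest_in: "U \<in> cdawg_nodes T \<Longrightarrow> shortest U \<in> U"
  unfolding shortest_def by (intro arg_min_if_finite(1) finite_cdawg_node cdawg_node_nonempty)

lemma length_shortest_le: "U \<in> cdawg_nodes T \<Longrightarrow> x \<in> U \<Longrightarrow> length (shortest U) \<le> length x"
  unfolding shortest_def by (intro arg_min_least finite_cdawg_node cdawg_node_nonempty)

lemma longest_is_arg_max:
  assumes "U \<in> cdawg_nodes T"
  shows "is_arg_max length (\<lambda>x. x \<in> U) (longest U)"
proof -
  have "Max (length ` U) \<in> length ` U"
    using finite_cdawg_node[OF assms] cdawg_node_nonempty[OF assms] by (intro Max_in) auto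
  then obtain x where "x \<in> U" "length x = Max (length ` U)"
    by auto
  then have "is_arg_max length (\<lambda>x. x \<in> U) x"
    using finite_cdawg_node[OF assms] by (simp add: is_arg_max_linorder)
  then show ?thesis
    unfolding longest_def arg_max_on_def arg_max_def by (rule someI)
qed

lemma longest_in: "U \<in> cdawg_nodes T \<Longrightarrow> longest U \<in> U"
  using longest_is_arg_max by (simp add: is_arg_max_def)

lemma length_le_longest: "U \<in> cdawg_nodes T \<Longrightarrow> x \<in> U \<Longrightarrow> length x \<le> length (longest U)"
  using longest_is_arg_max by (simp add: is_arg_max_linorder)

lemma node_length_eq_length_longest: "U \<in> cdawg_nodes T \<Longrightarrow> node_length U = length (longest U)"
  unfolding node_length_def
  by (intro Max_eqI) (auto simp: finite_cdawg_node longest_in length_le_longest)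

lemma longest_cdawg_sink: "longest (cdawg_sink T) = T"
proof -
  have "[] \<in> contexts (longest (cdawg_sink T))"
    using leaf_iff_cdawg_sink longest_in cdawg_sink_in_cdawg_nodes by blast
  then have "length (longest (cdawg_sink T)) \<le> length T"
    by (simp add: Nil_in_contexts_iff suffix_length_le)
  then show ?thesis
    using cdawg_node_length_inj[OF cdawg_sink_in_cdawg_nodes longest_in text_in_cdawg_sink]
      length_le_longest[OF _ text_in_cdawg_sink] cdawg_sink_in_cdawg_nodes by simp
qed


section \<open>Edges of the CDAWG\<close>

lemma cdawg_edge_nodes:
  assumes "(U, l, V) \<in> cdawg_edges T"
  shows "U \<in> cdawg_nodes T" "V \<in> cdawg_nodes T" "l \<noteq> []"
  using assms by (auto simp: cdawg_edges_def st_edges_iff)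

lemma cdawg_edge_st_edge:
  assumes "(U, l, V) \<in> cdawg_edges T" "u \<in> U"
  shows "(u, l, u @ l) \<in> st_edges T" "u @ l \<in> V"
proof -
  from assms(1) obtain u' where u': "u' \<in> U" "u' @ l \<in> V" "(u', l, u' @ l) \<in> st_edges T"
    using st_edge_target by (fastforce simp: cdawg_edges_def)
  have eq: "contexts (u @ m) = contexts (u' @ m)" for m
    using cdawg_node_contexts_eq[OF _ assms(2) u'(1)] cdawg_edge_nodes[OF assms(1)]
    by (intro contexts_append_cong) simp
  show "(u, l, u @ l) \<in> st_edges T"
    using u'(3) st_edges_cong[of u u' l, OF st_nodes_cong[OF eq]] by simp
  show "u @ l \<in> V"
    using in_cdawg_node_iff[OF cdawg_edge_nodes(2)[OF assms(1)] u'(2)] eq by simp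
qed

lemma cdawg_edgeI:
  assumes "U \<in> cdawg_nodes T" "u \<in> U" "(u, l, u @ l) \<in> st_edges T"
  shows "(U, l, st_iso T `` {u @ l}) \<in> cdawg_edges T"
proof -
  have "u @ l \<in> st_nodes T"
    using assms(3) by (simp add: st_edges_iff)
  then show ?thesis
    using assms in_st_iso_class st_iso_class_in_cdawg_nodes by (auto simp: cdawg_edges_def)
qed

lemma finite_cdawg_edges: "finite (cdawg_edges T)"
proof (rule finite_subset)
  let ?labels = "(\<lambda>(u, v). drop (length u) v) ` (st_nodes T \<times> st_nodes T)"
  show "cdawg_edges T \<subseteq> cdawg_nodes T \<times> ?labels \<times> cdawg_nodes T"
    by (force simp: cdawg_edges_def st_edges_iff image_iff)
  show "finite (cdawg_nodes T \<times> ?labels \<times> cdawg_nodes T)"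
    using finite_cdawg_nodes finite_st_nodes by auto
qed

lemma cdawg_out_edge_unique:
  assumes "(U, l, V) \<in> cdawg_edges T" "(U, l', V') \<in> cdawg_edges T" "hd l = hd l'"
  shows "l = l' \<and> V = V'"
proof -
  obtain u where u: "u \<in> U"
    using cdawg_node_nonempty[OF cdawg_edge_nodes(1)[OF assms(1)]] by blast
  note edge = cdawg_edge_st_edge[OF assms(1) u] and edge' = cdawg_edge_st_edge[OF assms(2) u]
  have "l = l'"
    by (rule st_edge_label_unique[OF edge(1) edge'(1) assms(3)])
  moreover have "V = V'"
    using cdawg_node_eqI[OF _ _ edge(2)] edge'(2) cdawg_edge_nodes(2) assms \<open>l = l'\<close> by blast
  ultimately show ?thesis ..
qed

lemma cdawg_in_edge_exists:
  assumes "V \<in> cdawg_nodes T" "v \<in> V" "v \<noteq> []"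
  obtains U u l where "(U, l, V) \<in> cdawg_edges T" "u \<in> U" "v = u @ l"
proof -
  have v: "[] @ v \<in> st_nodes T"
    using assms cdawg_node_in_st_nodes by simp
  obtain u l where "v = u @ l" and edge: "(u, l, u @ l) \<in> st_edges T"
    using st_parent_exists[OF Nil_in_st_nodes v assms(3)] by auto
  moreover have "u \<in> st_nodes T"
    using edge by (simp add: st_edges_iff)
  moreover have "st_iso T `` {v} = V"
    using v assms by (intro cdawg_node_eqI[of _ _ v] st_iso_class_in_cdawg_nodes in_st_iso_class) simp_all
  ultimately show ?thesis
    using that[of "st_iso T `` {u}" l u]
      cdawg_edgeI[OF st_iso_class_in_cdawg_nodes in_st_iso_class edge] in_st_iso_class by simp
qed

lemma cdawg_in_edge_unique:
  assumes "(U, l, V) \<in> cdawg_edges T" "(U', l', V') \<in> cdawg_edges T" "u \<in> U" "u' \<in> U'"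
    "u @ l = u' @ l'"
  shows "U = U' \<and> l = l' \<and> u = u'"
proof -
  have "u = u' \<and> l = l'"
    using st_parent_unique cdawg_edge_st_edge(1)[OF assms(1,3)] cdawg_edge_st_edge(1)[OF assms(2,4)]
      assms(5) by metis
  moreover from this have "U = U'"
    using cdawg_node_eqI[OF cdawg_edge_nodes(1)[OF assms(1)] cdawg_edge_nodes(1)[OF assms(2)]] assms
    by blast
  ultimately show ?thesis
    by simp
qed

lemma cdawg_edge_interval:
  assumes edge: "(U, l, V) \<in> cdawg_edges T" and v: "v \<in> V"
    and "length (shortest U @ l) \<le> length v" "length v \<le> length (longest U @ l)"
  obtains u where "u \<in> U" "v = u @ l"
proof -
  note nodes = cdawg_edge_nodes[OF edge]
  note ends = shortest_in[OF nodes(1)] longest_in[OF nodes(1)]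
  have "suffix (shortest U @ l) v" "suffix v (longest U @ l)"
    using cdawg_node_suffix[OF nodes(2)] cdawg_edge_st_edge(2)[OF edge] ends assms by auto
  then obtain q where q: "v = (q @ shortest U) @ l"
    by (auto simp: suffix_def)
  then have "suffix (q @ shortest U) (longest U)"
    using \<open>suffix v (longest U @ l)\<close> by (auto simp: suffix_def)
  then have "q @ shortest U \<in> U"
    by (rule cdawg_node_between[OF nodes(1) ends suffix_appendI[OF suffix_order.refl]])
  then show ?thesis
    using q that by blast
qed

lemma cdawg_in_edge_interval_exists:
  assumes "V \<in> cdawg_nodes T" "v \<in> V" "v \<noteq> []"
  obtains U l where "(U, l, V) \<in> cdawg_edges T"
    "length (shortest U @ l) \<le> length v" "length v \<le> length (longest U @ l)"
proof -
  obtain U u l where "(U, l, V) \<in> cdawg_edges T" "u \<in> U" "v = u @ l"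
    using cdawg_in_edge_exists[OF assms] .
  then show ?thesis
    using that length_shortest_le length_le_longest cdawg_edge_nodes(1) by simp
qed

lemma cdawg_in_edge_intervals_inj:
  assumes "(U, l, V) \<in> cdawg_edges T" "(U', l', V) \<in> cdawg_edges T"
    "length (longest U @ l) = length (longest U' @ l')"
  shows "U = U' \<and> l = l'"
proof -
  note longest_U = longest_in[OF cdawg_edge_nodes(1)[OF assms(1)]]
    and longest_U' = longest_in[OF cdawg_edge_nodes(1)[OF assms(2)]]
  have "longest U @ l = longest U' @ l'"
    using cdawg_edge_st_edge(2)[OF assms(1) longest_U] cdawg_edge_st_edge(2)[OF assms(2) longest_U']
      assms(3)
    by (rule cdawg_node_length_inj[OF cdawg_edge_nodes(2)[OF assms(1)]])
  then show ?thesis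
    using cdawg_in_edge_unique[OF assms(1,2) longest_U longest_U'] by blast
qed

lemma cdawg_in_edge_intervals_disjoint:
  assumes edge: "(U, l, V) \<in> cdawg_edges T" and edge': "(U', l', V) \<in> cdawg_edges T"
    and less: "length (longest U @ l) < length (longest U' @ l')"
  shows "length (longest U @ l) < length (shortest U' @ l')"
proof (rule ccontr)
  note longest_U = longest_in[OF cdawg_edge_nodes(1)[OF edge]]
  assume "\<not> length (longest U @ l) < length (shortest U' @ l')"
  then obtain u where "u \<in> U'" "longest U @ l = u @ l'"
    using cdawg_edge_interval[OF edge' cdawg_edge_st_edge(2)[OF edge longest_U]] less by auto
  then have "U = U' \<and> l = l'"
    using cdawg_in_edge_unique[OF edge edge' longest_U] by blast
  then show False
    using less by simp
qed

lemma Nil_not_in_cdawg_edge_target: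
  assumes "(U, l, V) \<in> cdawg_edges T"
  shows "[] \<notin> V"
proof -
  note nodes = cdawg_edge_nodes[OF assms]
  have "longest U @ l \<in> V" "longest U @ l \<noteq> []"
    using cdawg_edge_st_edge(2)[OF assms longest_in[OF nodes(1)]] nodes(3) by auto
  then show ?thesis
    using in_cdawg_node_iff[OF nodes(2)] contexts_eq_root_iff by metis
qed

lemma longest_eq_via_first_in_edge:
  assumes edge: "(U, l, V) \<in> cdawg_edges T"
    and first: "\<And>U' l'. (U', l', V) \<in> cdawg_edges T \<Longrightarrow> length (longest U' @ l') \<le> length (longest U @ l)"
  shows "longest V = longest U @ l"
proof -
  note nodes = cdawg_edge_nodes[OF edge]
  have in_V: "longest U @ l \<in> V" "longest V \<in> V"
    by (rule cdawg_edge_st_edge(2)[OF edge longest_in[OF nodes(1)]], rule longest_in[OF nodes(2)])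
  then have "longest V \<noteq> []"
    using Nil_not_in_cdawg_edge_target[OF edge] by auto
  then obtain U' l' where "(U', l', V) \<in> cdawg_edges T" "length (longest V) \<le> length (longest U' @ l')"
    using cdawg_in_edge_interval_exists[OF nodes(2) in_V(2)] by blast
  then have "length (longest V) \<le> length (longest U @ l)"
    using first le_trans by blast
  then show ?thesis
    using length_le_longest[OF nodes(2) in_V(1)]
    by (intro cdawg_node_length_inj[OF nodes(2) in_V(2,1)]) simp
qed

lemma shortest_eq_via_last_in_edge:
  assumes edge: "(U, l, V) \<in> cdawg_edges T"
    and last: "\<And>U' l'. (U', l', V) \<in> cdawg_edges T \<Longrightarrow> length (longest U @ l) \<le> length (longest U' @ l')"
  shows "shortest V = shortest U @ l"
proof -
  note nodes = cdawg_edge_nodes[OF edge]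
  note in_V = cdawg_edge_st_edge(2)[OF edge shortest_in[OF nodes(1)]] shortest_in[OF nodes(2)]
  then have "shortest V \<noteq> []"
    using Nil_not_in_cdawg_edge_target[OF edge] by auto
  then obtain U' l' where edge': "(U', l', V) \<in> cdawg_edges T"
    and le: "length (shortest U' @ l') \<le> length (shortest V)"
    using cdawg_in_edge_interval_exists[OF nodes(2) in_V(2)] by blast
  have "length (shortest V) \<le> length (longest U @ l)"
    by (intro length_shortest_le nodes(2) cdawg_edge_st_edge(2)[OF edge longest_in[OF nodes(1)]])
  then have "length (longest U @ l) = length (longest U' @ l')"
    using cdawg_in_edge_intervals_disjoint[OF edge edge'] last[OF edge'] le by linarith
  then have "U = U'" "l = l'"
    using cdawg_in_edge_intervals_inj[OF edge edge'] by auto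
  then show ?thesis
    using le length_shortest_le[OF nodes(2) in_V(1)]
    by (intro cdawg_node_length_inj[OF nodes(2) in_V(2,1)]) simp
qed

lemma cdawg_in_edge_intervals_consecutive:
  assumes edge: "(U, l, V) \<in> cdawg_edges T" and edge': "(U', l', V) \<in> cdawg_edges T"
    and preceding: "\<And>W m. (W, m, V) \<in> cdawg_edges T \<Longrightarrow> length (longest U @ l) < length (longest W @ m) \<Longrightarrow>
      length (longest U' @ l') \<le> length (longest W @ m)"
    and v: "v \<in> V" "length (longest U @ l) < length v"
  shows "length (shortest U' @ l') \<le> length v"
proof (rule ccontr)
  assume shorter: "\<not> length (shortest U' @ l') \<le> length v"
  have "v \<noteq> []"
    using v(1) Nil_not_in_cdawg_edge_target[OF edge] by blast
  then obtain W m where between: "(W, m, V) \<in> cdawg_edges T"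
    "length (shortest W @ m) \<le> length v" "length v \<le> length (longest W @ m)"
    by (rule cdawg_in_edge_interval_exists[OF cdawg_edge_nodes(2)[OF edge] v(1)])
  have "length (shortest U' @ l') \<le> length (longest U' @ l')"
    using length_shortest_le longest_in cdawg_edge_nodes(1)[OF edge'] by simp
  then have "length (longest U' @ l') = length (longest W @ m)"
    using cdawg_in_edge_intervals_disjoint[OF edge' between(1)] preceding[OF between(1)] between(2,3)
      shorter v(2)
    by linarith
  then have "U' = W" "l' = m"
    using cdawg_in_edge_intervals_inj[OF edge' between(1)] by auto
  then show False
    using between(2) shorter by simp
qed

lemma shortest_via_preceding_in_edge:
  assumes edge: "(U, l, V) \<in> cdawg_edges T" and edge': "(U', l', V) \<in> cdawg_edges T"
    and less: "length (longest U @ l) < length (longest U' @ l')"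
    and preceding: "\<And>W m. (W, m, V) \<in> cdawg_edges T \<Longrightarrow> length (longest U @ l) < length (longest W @ m) \<Longrightarrow>
      length (longest U' @ l') \<le> length (longest W @ m)"
  obtains a where "shortest U' @ l' = a # longest U @ l"
proof -
  note nodes = cdawg_edge_nodes[OF edge] and nodes' = cdawg_edge_nodes[OF edge']
  note in_V = cdawg_edge_st_edge(2)[OF edge longest_in[OF nodes(1)]]
    cdawg_edge_st_edge(2)[OF edge' shortest_in[OF nodes'(1)]]
  have disjoint: "length (longest U @ l) < length (shortest U' @ l')"
    by (rule cdawg_in_edge_intervals_disjoint[OF edge edge' less])
  then obtain a y where y: "shortest U' @ l' = a # y"
    using nodes'(3) by (cases "shortest U' @ l'") auto
  have "suffix (longest U @ l) (a # y)" "longest U @ l \<noteq> a # y"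
    using cdawg_node_suffix[OF nodes(2) in_V] disjoint unfolding y by (simp, fastforce)
  then have y_suffix: "suffix (longest U @ l) y"
    by (simp add: suffix_Cons)
  then have "y \<in> V"
    by (rule cdawg_node_between[OF nodes(2) in_V]) (simp add: y suffix_ConsI)
  then have "\<not> length (longest U @ l) < length y"
    using cdawg_in_edge_intervals_consecutive[OF edge edge' preceding, of y] y by auto
  then have "y = longest U @ l"
    using y_suffix by (auto simp: suffix_def)
  then show ?thesis
    using y that by simp
qed

end


section \<open>The BWT below a node\<close>

definition leaves :: "str \<Rightarrow> str \<Rightarrow> str list" where
  "leaves T x = sorted_list_of_set {s. s \<noteq> [] \<and> suffix s T \<and> prefix x s}"

definition preceding_symbol :: "str \<Rightarrow> str \<Rightarrow> nat" where
  "preceding_symbol T s = (if s = T then last T else T ! (length T - length s - 1))"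

definition bwt_below :: "str \<Rightarrow> str \<Rightarrow> str" where
  "bwt_below T x = map (preceding_symbol T) (leaves T x)"

lemma finite_suffixes: "finite {s. s \<noteq> [] \<and> suffix s T \<and> P s}"
  by (rule finite_subset[of _ "set (suffixes T)"]) auto

lemma set_leaves: "set (leaves T x) = {s. s \<noteq> [] \<and> suffix s T \<and> prefix x s}"
  by (simp add: leaves_def finite_suffixes)

lemma strict_sorted_leaves: "sorted_wrt (<) (leaves T x)"
  by (simp add: leaves_def)

lemma distinct_leaves: "distinct (leaves T x)"
  by (simp add: leaves_def)

lemma sorted_wrt_concat_map:
  assumes "\<And>x. x \<in> set xs \<Longrightarrow> sorted_wrt P (f x)"
    and "sorted_wrt (\<lambda>x y. \<forall>s \<in> set (f x). \<forall>t \<in> set (f y). P s t) xs"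
  shows "sorted_wrt P (concat (map f xs))"
  using assms by (induction xs) (auto simp: sorted_wrt_append)

lemma append_less_append_iff: "x @ s < x @ (t :: 'a :: linorder list) \<longleftrightarrow> s < t"
  by (simp add: list_less_def irrefl_def)

lemma drop_suffix_array: "map (\<lambda>p. drop p T) (suffix_array T) = leaves T []"
proof (rule strict_sorted_equal[OF strict_sorted_leaves])
  have "inj_on (\<lambda>p. drop p T) {0..<length T}"
    by (rule inj_on_inverseI[where g = "\<lambda>s. length T - length s"]) simp
  then show "sorted_wrt (<) (map (\<lambda>p. drop p T) (suffix_array T))"
    by (simp add: strict_sorted_iff suffix_array_def distinct_map)
  show "set (map (\<lambda>p. drop p T) (suffix_array T)) = set (leaves T [])"
  proof (intro equalityI subsetI)
    fix s assume "s \<in> set (leaves T [])"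
    then have "s = drop (length T - length s) T" "length T - length s < length T"
      by (auto simp: set_leaves suffix_def)
    then show "s \<in> set (map (\<lambda>p. drop p T) (suffix_array T))"
      by (auto simp: suffix_array_def)
  qed (auto simp: set_leaves suffix_array_def suffix_drop)
qed

lemma bwt_eq_bwt_below_root: "bwt T = bwt_below T []"
proof -
  have "preceding_symbol T (drop p T) = (if p = 0 then last T else T ! (p - 1))"
    if "p < length T" for p
  proof -
    have "length (drop p T) = length T \<longleftrightarrow> p = 0"
      using that by auto
    then have "drop p T = T \<longleftrightarrow> p = 0"
      by (metis drop0)
    then show ?thesis
      using that by (auto simp: preceding_symbol_def)
  qed
  moreover have "p \<in> set (suffix_array T) \<Longrightarrow> p < length T" for p
    by (simp add: suffix_array_def)
  ultimately show ?thesis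
    unfolding bwt_below_def drop_suffix_array[symmetric] bwt_def by simp
qed

lemma length_bwt: "length (bwt T) = length T"
  by (simp add: bwt_def suffix_array_def)

context terminated_text
begin

lemma set_leaves_eq_contexts: "set (leaves T x) = (@) x ` contexts x"
  by (auto simp: set_leaves right_contexts_def prefix_def image_iff)

lemma length_bwt_below: "length (bwt_below T x) = card (contexts x)"
proof -
  have "length (leaves T x) = card ((@) x ` contexts x)"
    using distinct_card[OF distinct_leaves] set_leaves_eq_contexts by metis
  then show ?thesis
    by (simp add: bwt_below_def card_image inj_on_def)
qed

lemma card_contexts_le: "card (contexts x) \<le> length T"
proof -
  have "card (contexts x) = card (set (leaves T x))"
    using length_bwt_below by (simp add: bwt_below_def distinct_card[OF distinct_leaves])
  also have "\<dots> \<le> card (set (leaves T []))"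
    by (rule card_mono[OF List.finite_set]) (auto simp: set_leaves)
  also have "\<dots> = length (bwt T)"
    by (simp add: bwt_eq_bwt_below_root bwt_below_def distinct_card[OF distinct_leaves])
  finally show ?thesis
    by (simp add: length_bwt)
qed

lemma bwt_below_text: "bwt_below T T = [last T]"
proof -
  have "{s. s \<noteq> [] \<and> suffix s T \<and> prefix T s} = {T}"
    using text_nonempty by (auto dest: suffix_length_le simp: prefix_def)
  then show ?thesis
    by (simp add: bwt_below_def leaves_def preceding_symbol_def)
qed

lemma set_leaves_eq_children:
  assumes "x \<in> st_nodes T" "[] \<notin> contexts x"
  shows "set (leaves T x) = (\<Union>l \<in> {l. (x, l, x @ l) \<in> st_edges T}. set (leaves T (x @ l)))"
proof (intro equalityI subsetI)
  fix s assume "s \<in> set (leaves T x)"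
  then obtain z where z: "s = x @ z" "z \<in> contexts x"
    by (auto simp: set_leaves_eq_contexts)
  then have "z \<noteq> []"
    using assms(2) by auto
  then obtain l z' where "(x, l, x @ l) \<in> st_edges T" "z = l @ z'"
    using st_edge_exists[OF assms(1) z(2)] by (metis prefixE)
  then show "s \<in> (\<Union>l \<in> {l. (x, l, x @ l) \<in> st_edges T}. set (leaves T (x @ l)))"
    using z by (auto simp: set_leaves_eq_contexts contexts_append_iff)
qed (auto simp: set_leaves_eq_contexts contexts_append_iff)

lemma leaves_less_if_label_less:
  assumes "l \<noteq> []" "l' \<noteq> []" "hd l < hd l'" "s \<in> set (leaves T (x @ l))" "t \<in> set (leaves T (x @ l'))"
  shows "s < t"
proof -
  obtain u v where "s = x @ l @ u" "t = x @ l' @ v"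
    using assms(4,5) by (auto simp: set_leaves_eq_contexts)
  then show ?thesis
    using assms(1-3) by (cases l; cases l') (auto simp: append_less_append_iff)
qed

lemma bwt_below_eq_concat_children:
  assumes x: "x \<in> st_nodes T" "[] \<notin> contexts x"
    and sorted: "sorted_wrt (\<lambda>l l'. hd l < hd l') ls"
    and labels: "set ls = {l. (x, l, x @ l) \<in> st_edges T}"
  shows "bwt_below T x = concat (map (\<lambda>l. bwt_below T (x @ l)) ls)"
proof -
  have "leaves T x = concat (map (\<lambda>l. leaves T (x @ l)) ls)"
  proof (rule strict_sorted_equal[OF strict_sorted_leaves, symmetric])
    show "sorted_wrt (<) (concat (map (\<lambda>l. leaves T (x @ l)) ls))"
    proof (rule sorted_wrt_concat_map[OF strict_sorted_leaves sorted_wrt_mono_rel[OF _ sorted]])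
      fix l l' assume "l \<in> set ls" "l' \<in> set ls" "hd l < hd l'"
      moreover from this have "l \<noteq> []" "l' \<noteq> []"
        using labels by (auto simp: st_edges_iff)
      ultimately show "\<forall>s \<in> set (leaves T (x @ l)). \<forall>t \<in> set (leaves T (x @ l')). s < t"
        using leaves_less_if_label_less by blast
    qed
  qed (simp add: set_leaves_eq_children[OF x] labels)
  then show ?thesis
    by (simp add: bwt_below_def map_concat comp_def)
qed

lemma preceding_symbol_if_contexts_eq:
  assumes "contexts (a # x) = contexts x" "s \<in> set (leaves T x)"
  shows "preceding_symbol T s = a"
proof -
  obtain z where "s = x @ z" "z \<in> contexts (a # x)"
    using assms by (auto simp: set_leaves_eq_contexts)
  then obtain p where "T = p @ a # s"
    by (auto simp: right_contexts_def suffix_def)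
  then show ?thesis
    by (auto simp: preceding_symbol_def nth_append)
qed

lemma bwt_below_single_run:
  assumes "contexts (a # x) = contexts x"
  shows "bwt_below T x = replicate (card (contexts x)) a"
proof -
  have "bwt_below T x = map (\<lambda>_. a) (leaves T x)"
    unfolding bwt_below_def by (rule map_cong[OF refl preceding_symbol_if_contexts_eq[OF assms]])
  then show ?thesis
    using length_bwt_below[of x] by (metis length_map map_replicate_const)
qed

lemma end_marker_st_edge: "([], [last T], [last T]) \<in> st_edges T"
proof -
  have "[last T] \<in> contexts []"
    using text_nonempty
    by (auto simp: right_contexts_def suffix_def intro: append_butlast_last_id[symmetric])
  then obtain l where l: "([], l, [] @ l) \<in> st_edges T" "prefix l [last T]"
    using st_edge_exists[OF Nil_in_st_nodes] by blast
  then have "l = [last T]"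
    by (auto simp: st_edges_iff prefix_Cons)
  then show ?thesis
    using l(1) by simp
qed

lemma last_symbol_le_hd_st_edge:
  assumes "([], l, l) \<in> st_edges T"
  shows "last T \<le> hd l"
proof -
  have l: "l \<noteq> []" "l \<in> st_nodes T"
    using assms by (auto simp: st_edges_iff)
  then obtain z where "suffix (l @ z) T"
    using contexts_nonempty by (auto simp: right_contexts_def)
  then have "set l \<subseteq> set T"
    by (auto simp: suffix_def)
  then show ?thesis
    using l(1) by (intro last_symbol_le) auto
qed

end


section \<open>Appending runs\<close>

definition add_run :: "('a \<times> nat) list \<Rightarrow> 'a \<Rightarrow> nat \<Rightarrow> ('a \<times> nat) list" where
  "add_run ps c k =
     (if ps \<noteq> [] \<and> fst (last ps) = c then butlast ps @ [(c, snd (last ps) + k)] else ps @ [(c, k)])"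

lemma add_run_Nil [simp]: "add_run [] c k = [(c, k)]"
  by (simp add: add_run_def)

lemma add_run_snoc [simp]:
  "add_run (ps @ [(c', k')]) c k = (if c' = c then ps @ [(c, k' + k)] else ps @ [(c', k'), (c, k)])"
  by (simp add: add_run_def)

lemma length_add_run_le: "length (add_run ps c k) \<le> Suc (length ps)"
  by (auto simp: add_run_def)

lemma run_length_encode_replicate: "run_length_encode (replicate (Suc k) c) = [(c, Suc k)]"
  by (induction k) auto

lemma run_length_encode_append_replicate:
  assumes "0 < k"
  shows "run_length_encode (xs @ replicate k c) = add_run (run_length_encode xs) c k"
proof (induction xs)
  case Nil
  then show ?case
    using assms run_length_encode_replicate[of "k - 1" c] by simp
next
  case (Cons x xs)
  show ?case
  proof (cases "run_length_encode xs")
    case Nil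
    then show ?thesis
      using Cons by (simp add: add_run_def)
  next
    case (Cons p ps)
    then show ?thesis
      using Cons.IH by (cases p; cases "ps = []") (auto simp: add_run_def split: list.splits)
  qed
qed

lemma run_le_length: "(c, k) \<in> set (run_length_encode xs) \<Longrightarrow> k \<le> length xs"
  by (induction xs arbitrary: c k) (fastforce split: list.splits if_splits)+


section \<open>Numbered acyclic graphs\<close>

locale numbered_dag =
  fixes N E rt sk :: nat and src tgt out_off in_off ins rank :: "nat \<Rightarrow> nat"
  assumes rt_less: "rt < N" and sk_less: "sk < N" and rt_neq_sk: "rt \<noteq> sk"
    and src_less: "f < E \<Longrightarrow> src f < N" and tgt_less: "f < E \<Longrightarrow> tgt f < N"
    and rank_less: "f < E \<Longrightarrow> rank (src f) < rank (tgt f)"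
    and ins_bij: "bij_betw ins {..<E} {..<E}"
    and out_off_mono: "out_off k \<le> out_off (Suc k)" and out_off_le: "out_off k \<le> E"
    and in_off_mono: "in_off k \<le> in_off (Suc k)" and in_off_le: "in_off k \<le> E"
    and src_eq_iff: "f < E \<Longrightarrow> src f = k \<longleftrightarrow> out_off k \<le> f \<and> f < out_off (Suc k)"
    and tgt_ins_eq_iff: "p < E \<Longrightarrow> tgt (ins p) = k \<longleftrightarrow> in_off k \<le> p \<and> p < in_off (Suc k)"
    and out_off_less_iff: "k < N \<Longrightarrow> out_off k < out_off (Suc k) \<longleftrightarrow> k \<noteq> sk"
    and in_off_less_iff: "k < N \<Longrightarrow> in_off k < in_off (Suc k) \<longleftrightarrow> k \<noteq> rt"
begin

definition out_edges :: "nat \<Rightarrow> nat list" where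
  "out_edges k = [out_off k..<out_off (Suc k)]"

lemma set_out_edges: "set (out_edges k) = {f. f < E \<and> src f = k}"
proof (rule set_eqI)
  show "f \<in> set (out_edges k) \<longleftrightarrow> f \<in> {f. f < E \<and> src f = k}" for f
    using src_eq_iff[of f k] out_off_le[of "Suc k"] by (cases "f < E") (auto simp: out_edges_def)
qed

lemma distinct_out_edges: "distinct (out_edges k)"
  by (simp add: out_edges_def)

lemma sk_no_out_edge: "f < E \<Longrightarrow> src f \<noteq> sk"
  using out_off_less_iff[OF sk_less] src_eq_iff[of f sk] by auto

lemma ins_less: "p < E \<Longrightarrow> ins p < E"
  using ins_bij by (auto simp: bij_betw_def)

lemma ins_eq_iff: "p < E \<Longrightarrow> q < E \<Longrightarrow> ins p = ins q \<longleftrightarrow> p = q"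
  using ins_bij by (auto simp: bij_betw_def inj_on_def)

lemma ins_exists:
  assumes "f < E"
  obtains p where "p < E" "ins p = f"
  using ins_bij assms by (metis bij_betw_imp_surj_on imageE lessThan_iff)

lemma in_edges: "ins ` {in_off k..<in_off (Suc k)} = {f. f < E \<and> tgt f = k}"
proof (intro equalityI subsetI)
  fix f assume "f \<in> {f. f < E \<and> tgt f = k}"
  then obtain p where "p < E" "ins p = f" "tgt f = k"
    using ins_exists by blast
  then show "f \<in> ins ` {in_off k..<in_off (Suc k)}"
    using tgt_ins_eq_iff[of p k] by auto
qed (use tgt_ins_eq_iff[of _ k] in_off_le[of "Suc k"] ins_less in auto)

lemma tgt_neq_rt: "f < E \<Longrightarrow> tgt f \<noteq> rt"
  using in_edges[of rt] in_off_less_iff[OF rt_less] by force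

lemma first_in_edge:
  assumes "k < N" "k \<noteq> rt"
  shows "in_off k < E" "tgt (ins (in_off k)) = k"
  using assms in_off_less_iff[of k] in_off_le[of "Suc k"] tgt_ins_eq_iff[of "in_off k" k] by auto

lemma last_in_edge:
  assumes "k < N" "k \<noteq> rt"
  shows "Suc (in_off (Suc k) - 1) = in_off (Suc k)" "in_off (Suc k) - 1 < E"
    "tgt (ins (in_off (Suc k) - 1)) = k"
  using assms in_off_less_iff[of k] in_off_le[of "Suc k"] tgt_ins_eq_iff[of "in_off (Suc k) - 1" k]
  by auto

definition edges_into :: "nat set \<Rightarrow> nat set" where
  "edges_into S = {f. f < E \<and> tgt f \<in> S}"

lemma edges_into_empty [simp]: "edges_into {} = {}"
  by (simp add: edges_into_def)

lemma edges_into_insert: "edges_into (insert v S) = edges_into S \<union> ins ` {in_off v..<in_off (Suc v)}"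
  unfolding in_edges by (auto simp: edges_into_def)

lemma card_edges_into_le: "card (edges_into S) \<le> E"
proof -
  have "card (edges_into S) \<le> card {..<E}"
    by (intro card_mono) (auto simp: edges_into_def)
  then show ?thesis
    by simp
qed

lemma card_edges_into_insert:
  assumes "v \<notin> S"
  shows "card (edges_into (insert v S)) = card (edges_into S) + (in_off (Suc v) - in_off v)"
proof -
  have "inj_on ins {in_off v..<in_off (Suc v)}"
    using in_off_le[of "Suc v"] by (auto intro!: inj_onI simp: ins_eq_iff)
  then have "card (ins ` {in_off v..<in_off (Suc v)}) = in_off (Suc v) - in_off v"
    by (simp add: card_image)
  moreover have "edges_into S \<inter> ins ` {in_off v..<in_off (Suc v)} = {}"
    using assms unfolding in_edges by (auto simp: edges_into_def)
  moreover have "finite (edges_into S)"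
    by (simp add: edges_into_def)
  ultimately show ?thesis
    unfolding edges_into_insert by (subst card_Un_disjoint) auto
qed

lemma num_nodes_le: "N \<le> Suc E"
proof -
  have "{..<N} \<subseteq> insert rt (tgt ` {..<E})"
  proof
    fix k assume "k \<in> {..<N}"
    then show "k \<in> insert rt (tgt ` {..<E})"
      using first_in_edge[of k] ins_less[of "in_off k"] by (cases "k = rt") force+
  qed
  then have "card {..<N} \<le> card (insert rt (tgt ` {..<E}))"
    by (intro card_mono) auto
  also have "\<dots> \<le> Suc (card (tgt ` {..<E}))"
    by (simp add: card_insert_if)
  also have "\<dots> \<le> Suc E"
    using card_image_le[of "{..<E}" tgt] by simp
  finally show ?thesis
    by simp
qed

lemma num_edges_pos: "0 < E"
  using out_off_less_iff[OF rt_less] rt_neq_sk out_off_le[of "Suc rt"] by simp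

definition targets_first :: "nat list \<Rightarrow> bool" where
  "targets_first q \<longleftrightarrow> (\<forall>i < length q. \<forall>f < E. src f = q ! i \<longrightarrow> tgt f \<in> set (take i q))"

lemma targets_first_sk: "targets_first [sk]"
  using sk_no_out_edge by (simp add: targets_first_def)

lemma targets_first_snoc:
  assumes "targets_first q" "\<And>f. f < E \<Longrightarrow> src f = u \<Longrightarrow> tgt f \<in> set q"
  shows "targets_first (q @ [u])"
  using assms by (auto simp: targets_first_def nth_append less_Suc_eq)

lemma targets_first_source_later:
  assumes q: "targets_first q" "distinct q" "src f \<in> set q" and f: "f < E"
    and i: "i < length q" "q ! i = tgt f"
  obtains j where "i < j" "j < length q" "q ! j = src f"
proof -
  obtain j where j: "j < length q" "q ! j = src f"
    using q(3) by (auto simp: in_set_conv_nth)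
  then have "tgt f \<in> set (take j q)"
    using q(1) f by (simp add: targets_first_def)
  then obtain i' where "i' < j" "q ! i' = tgt f"
    using j(1) by (auto simp: in_set_conv_nth)
  moreover from this have "i' = i"
    using q(2) i j(1) by (simp add: nth_eq_iff_index_eq[symmetric])
  ultimately show ?thesis
    using that j by blast
qed

end


section \<open>Counting paths\<close>

locale path_counting = numbered_dag +
  fixes num_paths :: "nat \<Rightarrow> nat"
  assumes num_paths_sk: "num_paths sk = 1"
    and num_paths_eq: "k < N \<Longrightarrow> k \<noteq> sk \<Longrightarrow> num_paths k = (\<Sum>f \<in> set (out_edges k). num_paths (tgt f))"
begin

definition pending_edges :: "nat set \<Rightarrow> nat \<Rightarrow> nat set" where
  "pending_edges F u = set (out_edges u) - F"

definition partial_count :: "nat set \<Rightarrow> nat \<Rightarrow> nat" where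
  "partial_count F u = (if u = sk then 1 else 0) + (\<Sum>f \<in> set (out_edges u) \<inter> F. num_paths (tgt f))"

lemma finite_pending_edges: "finite (pending_edges F u)"
  by (simp add: pending_edges_def)

lemma card_pending_edges_empty: "card (pending_edges {} u) = out_off (Suc u) - out_off u"
  by (simp add: pending_edges_def out_edges_def)

lemma card_pending_edges_le: "card (pending_edges F u) \<le> E"
proof -
  have "card (pending_edges F u) \<le> card {..<E}"
    by (intro card_mono) (auto simp: pending_edges_def set_out_edges)
  then show ?thesis
    by simp
qed

lemma card_pending_edges_pos:
  assumes "f < E" "f \<notin> F"
  shows "0 < card (pending_edges F (src f))"
  using assms finite_pending_edges by (auto simp: card_gt_0_iff pending_edges_def set_out_edges)

lemma pending_edges_insert:
  assumes "f < E"
  shows "pending_edges (insert f F) u =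
    (if u = src f then pending_edges F u - {f} else pending_edges F u)"
  using assms by (auto simp: pending_edges_def set_out_edges)

lemma card_pending_edges_insert:
  assumes "f < E" "f \<notin> F"
  shows "card (pending_edges (insert f F) u) = card (pending_edges F u) - (if u = src f then 1 else 0)"
proof (cases "u = src f")
  case True
  then have "f \<in> pending_edges F u"
    using assms by (simp add: pending_edges_def set_out_edges)
  then show ?thesis
    using True assms(1) by (simp add: pending_edges_insert)
qed (use assms in \<open>simp add: pending_edges_insert\<close>)

lemma partial_count_empty: "partial_count {} u = (if u = sk then 1 else 0)"
  by (simp add: partial_count_def)

lemma partial_count_insert:
  assumes "f < E" "f \<notin> F"
  shows "partial_count (insert f F) u = partial_count F u + (if u = src f then num_paths (tgt f) else 0)"
proof -
  have "set (out_edges u) \<inter> insert f F =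
      (if u = src f then insert f (set (out_edges u) \<inter> F) else set (out_edges u) \<inter> F)"
    using assms by (auto simp: set_out_edges)
  then show ?thesis
    using assms(2) by (simp add: partial_count_def)
qed

lemma partial_count_no_pending:
  assumes "u < N" "pending_edges F u = {}"
  shows "partial_count F u = num_paths u"
proof -
  have "set (out_edges u) \<inter> F = set (out_edges u)"
    using assms(2) by (auto simp: pending_edges_def)
  moreover have "set (out_edges sk) = {}"
    using sk_no_out_edge by (auto simp: set_out_edges)
  ultimately show ?thesis
    using num_paths_sk num_paths_eq[OF assms(1)] by (cases "u = sk") (simp_all add: partial_count_def)
qed

lemma partial_count_le:
  assumes "u < N"
  shows "partial_count F u \<le> num_paths u"
proof -
  have "partial_count F u \<le> partial_count (F \<union> set (out_edges u)) u"
    by (auto simp: partial_count_def intro!: sum_mono2)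
  also have "\<dots> = num_paths u"
    by (intro partial_count_no_pending assms) (simp add: pending_edges_def)
  finally show ?thesis .
qed

text \<open>Kahn's algorithm on the reversed graph, with queue \<open>q\<close> and set \<open>F\<close> of processed edges.\<close>

definition kahn :: "nat list \<Rightarrow> nat set \<Rightarrow> bool" where
  "kahn q F \<longleftrightarrow> distinct q \<and> set q = {u. u < N \<and> pending_edges F u = {}} \<and>
     F \<subseteq> {..<E} \<and> tgt ` F \<subseteq> set q \<and> targets_first q"

lemma kahnD:
  assumes "kahn q F"
  shows "distinct q" "set q = {u. u < N \<and> pending_edges F u = {}}" "F \<subseteq> {..<E}"
    "f \<in> F \<Longrightarrow> tgt f \<in> set q" "targets_first q"
  using assms by (auto simp: kahn_def)

lemma kahn_init: "kahn [sk] {}"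
proof -
  have "pending_edges {} u = {} \<longleftrightarrow> u = sk" if "u < N" for u
    using out_off_less_iff[OF that] by (auto simp: pending_edges_def out_edges_def)
  then show ?thesis
    using sk_less targets_first_sk by (auto simp: kahn_def)
qed

lemma kahn_length_le: "kahn q F \<Longrightarrow> length q \<le> N"
  using card_mono[of "{..<N}" "set q"] distinct_card[of q] by (auto simp: kahn_def)

lemma kahn_insert:
  assumes kahn: "kahn q F" and f: "f < E" "f \<notin> F" "tgt f \<in> set q"
  shows "kahn (if pending_edges (insert f F) (src f) = {} then q @ [src f] else q) (insert f F)"
proof -
  let ?q = "if pending_edges (insert f F) (src f) = {} then q @ [src f] else q"
  have new: "src f \<notin> set q"
    using f card_pending_edges_pos[of f F] kahnD(2)[OF kahn] by auto
  show ?thesis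
    unfolding kahn_def
  proof (intro conjI)
    show "set ?q = {u. u < N \<and> pending_edges (insert f F) u = {}}"
      using kahnD(2)[OF kahn] new src_less[OF f(1)] by (auto simp: pending_edges_insert[OF f(1)])
    have "tgt g \<in> set q" if "pending_edges (insert f F) (src f) = {}" "g < E" "src g = src f" for g
      using that f kahnD(4)[OF kahn, of g] by (auto simp: pending_edges_def set_out_edges)
    then show "targets_first ?q"
      using kahnD(5)[OF kahn] by (auto intro: targets_first_snoc)
  qed (use kahnD[OF kahn] new f in auto)
qed

lemma kahn_complete:
  assumes kahn: "kahn q F" and F: "\<And>f. f < E \<Longrightarrow> tgt f \<in> set q \<Longrightarrow> f \<in> F"
  shows "set q = {..<N}"
proof (rule ccontr)
  assume "set q \<noteq> {..<N}"
  then have "rank ` ({..<N} - set q) \<noteq> {}"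
    using kahnD(2)[OF kahn] by auto
  then have "Max (rank ` ({..<N} - set q)) \<in> rank ` ({..<N} - set q)"
    by (intro Max_in) auto
  then obtain u where u: "u < N" "u \<notin> set q" "rank u = Max (rank ` ({..<N} - set q))"
    by auto
  then have highest: "v \<in> set q" if "v < N" "rank u < rank v" for v
    using that Max_ge[of "rank ` ({..<N} - set q)" "rank v"] by fastforce
  have "pending_edges F u \<noteq> {}"
    using u kahnD(2)[OF kahn] by auto
  then obtain f where f: "f < E" "src f = u" "f \<notin> F"
    by (auto simp: pending_edges_def set_out_edges)
  then have "tgt f \<in> set q"
    using tgt_less rank_less by (intro highest) auto
  then show False
    using F f by blast
qed

end


section \<open>Traversal along primary edges\<close>

locale bwt_dag = path_counting +
  fixes n :: nat and label_symbol entry_symbol node_symbol :: "nat \<Rightarrow> nat" and edge_bwt :: "nat \<Rightarrow> str"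
  assumes num_paths_le: "num_paths k \<le> n" and num_paths_pos: "k < N \<Longrightarrow> 0 < num_paths k"
    and entry_symbol_eq:
      "f < E \<Longrightarrow> entry_symbol f = (if src f = rt then label_symbol f else node_symbol (src f))"
    and node_symbol_eq: "k < N \<Longrightarrow> k \<noteq> rt \<Longrightarrow> node_symbol k = entry_symbol (ins (in_off (Suc k) - 1))"
    and edge_bwt_sink: "edge_bwt (ins (in_off sk)) = [label_symbol (out_off rt)]"
    and edge_bwt_primary: "k < N \<Longrightarrow> k \<noteq> rt \<Longrightarrow> k \<noteq> sk \<Longrightarrow>
      edge_bwt (ins (in_off k)) = concat (map edge_bwt (out_edges k))"
    and edge_bwt_secondary: "k < N \<Longrightarrow> in_off k < p \<Longrightarrow> p < in_off (Suc k) \<Longrightarrow>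
      edge_bwt (ins p) = replicate (num_paths k) (entry_symbol (ins (p - 1)))"
    and length_root_bwt_le: "length (concat (map edge_bwt (out_edges rt))) \<le> n"
begin

definition root_bwt :: str where
  "root_bwt = concat (map edge_bwt (out_edges rt))"

text \<open>Here \<open>s\<close> is the stack of edges (top first), \<open>D\<close> the set of the edges already popped and \<open>out\<close>
  the part of the BWT emitted so far. An edge is pushed only after the primary edge into its source has
  been popped, and each node has only one primary edge, so no edge is pushed twice.\<close>

definition traversal :: "nat list \<Rightarrow> nat set \<Rightarrow> str \<Rightarrow> bool" where
  "traversal s D out \<longleftrightarrow> distinct s \<and> set s \<inter> D = {} \<and> set s \<union> D \<subseteq> {..<E} \<and>
     (\<forall>g \<in> set s \<union> D. src g = rt \<or> ins (in_off (src g)) \<in> D) \<and>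
     out @ concat (map edge_bwt s) = root_bwt \<and> length (run_length_encode out) \<le> card D"

lemma traversal_init: "traversal (out_edges rt) {} []"
  by (auto simp: traversal_def root_bwt_def distinct_out_edges set_out_edges)

lemma traversal_finite: "traversal s D out \<Longrightarrow> finite D"
  using finite_subset[of D "{..<E}"] by (auto simp: traversal_def)

lemma traversal_card_le:
  assumes "traversal s D out"
  shows "card D + length s \<le> E"
proof -
  have "card D + length s = card (set s \<union> D)"
    using assms traversal_finite[OF assms]
    by (subst card_Un_disjoint) (auto simp: traversal_def distinct_card)
  also have "\<dots> \<le> card {..<E}"
    using assms by (intro card_mono) (auto simp: traversal_def)
  finally show ?thesis
    by simp
qed

lemma traversal_length_le:
  assumes "traversal s D out"
  shows "length out + length (concat (map edge_bwt s)) \<le> n"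
  using assms length_root_bwt_le unfolding traversal_def root_bwt_def by (metis length_append)

lemma traversal_top:
  assumes "traversal (f # s) D out"
  shows "f < E" "card (insert f D) = Suc (card D)"
  using assms traversal_finite[OF assms] by (auto simp: traversal_def)

lemma traversal_emit:
  assumes trav: "traversal (f # s) D out" and f: "edge_bwt f = replicate k c" "0 < k"
  shows "traversal s (insert f D) (out @ replicate k c)"
proof -
  have "length (run_length_encode (out @ replicate k c)) \<le> card (insert f D)"
    using trav length_add_run_le[of "run_length_encode out" c k] traversal_top(2)[OF trav]
    by (simp add: run_length_encode_append_replicate[OF f(2)] traversal_def)
  then show ?thesis
    using trav f(1) by (auto simp: traversal_def)
qed

lemma traversal_expand:
  assumes trav: "traversal (ins (in_off k) # s) D out" and k: "k < N" "k \<noteq> rt" "k \<noteq> sk"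
  shows "traversal (out_edges k @ s) (insert (ins (in_off k)) D) out"
proof -
  let ?f = "ins (in_off k)"
  have "g \<notin> insert ?f (set s \<union> D)" if "g \<in> set (out_edges k)" for g
  proof
    have g: "g < E" "src g = k"
      using that by (simp_all add: set_out_edges)
    assume "g \<in> insert ?f (set s \<union> D)"
    then have "?f \<in> D"
      using trav g(2) k(2) unfolding traversal_def by fastforce
    then show False
      using trav by (simp add: traversal_def)
  qed
  then show ?thesis
    using trav edge_bwt_primary[OF k] traversal_top(2)[OF trav]
    unfolding traversal_def by (auto simp: distinct_out_edges set_out_edges)
qed

lemma traversal_done: "traversal [] D out \<Longrightarrow> out = root_bwt"
  by (simp add: traversal_def)

lemma traversal_runs_le:
  assumes "traversal s D out"
  shows "length (run_length_encode out) \<le> E"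
  using assms traversal_card_le[OF assms] by (simp add: traversal_def)

lemma edge_cases:
  assumes "f < E"
  obtains (sink) "tgt f = sk" "f = ins (in_off sk)"
    | (primary) "tgt f \<noteq> rt" "tgt f \<noteq> sk" "f = ins (in_off (tgt f))"
    | (secondary) p where "in_off (tgt f) < p" "p < in_off (Suc (tgt f))" "f = ins p"
proof -
  obtain p where "p < E" "ins p = f"
    using ins_exists[OF assms] .
  then have "in_off (tgt f) \<le> p" "p < in_off (Suc (tgt f))"
    using tgt_ins_eq_iff[of p "tgt f"] by auto
  moreover from this have "p = in_off (tgt f) \<and> tgt f = sk \<or>
    p = in_off (tgt f) \<and> tgt f \<noteq> sk \<or> in_off (tgt f) < p"
    by auto
  ultimately show thesis
    using that \<open>ins p = f\<close> tgt_neq_rt[OF assms] by metis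
qed

lemma traversal_step_exists:
  assumes trav: "traversal (f # s) D out"
  shows "\<exists>s' out'. traversal s' (insert f D) out'"
proof -
  note top = traversal_top(1)[OF trav]
  from top show ?thesis
  proof (cases rule: edge_cases)
    case sink
    then have "edge_bwt f = replicate 1 (label_symbol (out_off rt))"
      using edge_bwt_sink by simp
    then show ?thesis
      using traversal_emit[OF trav _ zero_less_one] by blast
  next
    case primary
    then show ?thesis
      using traversal_expand[of "tgt f"] trav tgt_less[OF top] by metis
  next
    case (secondary p)
    then have "edge_bwt f = replicate (num_paths (tgt f)) (entry_symbol (ins (p - 1)))"
      using edge_bwt_secondary[OF tgt_less[OF top]] by simp
    then show ?thesis
      using traversal_emit[OF trav] num_paths_pos[OF tgt_less[OF top]] by blast
  qed
qed

lemma runs_root_bwt_le: "length (run_length_encode root_bwt) \<le> E"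
proof -
  have "length (run_length_encode root_bwt) \<le> E" if "traversal s D out" for s D out
    using that
  proof (induction "E - card D" arbitrary: s D out rule: less_induct)
    case less
    show ?case
    proof (cases s)
      case Nil
      then show ?thesis
        using less.prems traversal_done traversal_runs_le by blast
    next
      case (Cons f s')
      then have trav: "traversal (f # s') D out"
        using less.prems by simp
      obtain s'' out' where "traversal s'' (insert f D) out'"
        using traversal_step_exists[OF trav] by blast
      moreover have "E - card (insert f D) < E - card D"
        using traversal_top(2)[OF trav] traversal_card_le[OF trav] by simp
      ultimately show ?thesis
        using less.hyps by blast
    qed
  qed
  then show ?thesis
    using traversal_init by blast
qed

end


section \<open>The graph stored in a self-index\<close>

lemma sorted_key_less_iff_filter:
  assumes "sorted_wrt (\<lambda>x y. (key x :: 'b :: linorder) \<le> key y) xs" "i < length xs"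
  shows "key (xs ! i) < k \<longleftrightarrow> i < length (filter (\<lambda>x. key x < k) xs)"
  using assms
proof (induction xs arbitrary: i)
  case (Cons x xs)
  show ?case
  proof (cases "key x < k")
    case True
    then show ?thesis
      using Cons by (cases i) auto
  next
    case False
    then have "\<forall>y \<in> set (x # xs). \<not> key y < k"
      using Cons.prems(1) by auto
    then have "filter (\<lambda>x. key x < k) (x # xs) = []" "\<not> key ((x # xs) ! i) < k"
      using nth_mem[OF Cons.prems(2)] unfolding filter_empty_conv by blast+
    then show ?thesis
      by simp
  qed
qed simp

abbreviation numbered_edges :: "str \<Rightarrow> str set list \<Rightarrow> (nat \<times> str \<times> nat) set" where
  "numbered_edges T ns \<equiv> {(i, l, j). i < length ns \<and> j < length ns \<and> (ns ! i, l, ns ! j) \<in> cdawg_edges T}"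

abbreviation sorted_by_source :: "(nat \<times> str \<times> nat) list \<Rightarrow> bool" where
  "sorted_by_source es \<equiv> sorted_wrt (\<lambda>(i, l, j) (i', l', j'). i < i' \<or> i = i' \<and> hd l < hd l') es"

abbreviation sorted_by_target :: "str set list \<Rightarrow> (nat \<times> str \<times> nat) list \<Rightarrow> nat list \<Rightarrow> bool" where
  "sorted_by_target ns es ins \<equiv> sorted_wrt (\<lambda>f g. case (es ! f, es ! g) of ((i, l, j), (i', l', j')) \<Rightarrow>
     j < j' \<or> j = j' \<and> node_length (ns ! i) + length l > node_length (ns ! i') + length l') ins"

locale self_index = terminated_text +
  fixes ns :: "str set list" and rt sk :: nat and es :: "(nat \<times> str \<times> nat) list" and ins :: "nat list"
  assumes distinct_ns: "distinct ns" and set_ns: "set ns = cdawg_nodes T"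
    and rt_less: "rt < length ns" and nth_rt: "ns ! rt = cdawg_root T"
    and sk_less: "sk < length ns" and nth_sk: "ns ! sk = cdawg_sink T"
    and distinct_es: "distinct es"
    and set_es: "set es = numbered_edges T ns"
    and sorted_es: "sorted_by_source es"
    and distinct_ins: "distinct ins" and set_ins: "set ins = {..<length es}"
    and sorted_ins: "sorted_by_target ns es ins"
begin

abbreviation "N \<equiv> length ns"
abbreviation "E \<equiv> length es"

definition src :: "nat \<Rightarrow> nat" where "src f = fst (es ! f)"
definition lab :: "nat \<Rightarrow> str" where "lab f = fst (snd (es ! f))"
definition tgt :: "nat \<Rightarrow> nat" where "tgt f = snd (snd (es ! f))"
definition out_off :: "nat \<Rightarrow> nat" where "out_off k = length (filter (\<lambda>(i, l, j). i < k) es)"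
definition in_off :: "nat \<Rightarrow> nat" where "in_off k = length (filter (\<lambda>(i, l, j). j < k) es)"

definition edge_string :: "nat \<Rightarrow> str" where "edge_string f = longest (ns ! src f) @ lab f"
definition entry_string :: "nat \<Rightarrow> str" where "entry_string f = shortest (ns ! src f) @ lab f"

lemma es_nth: "es ! f = (src f, lab f, tgt f)"
  by (simp add: src_def lab_def tgt_def)

lemma edge_in_cdawg:
  assumes "f < E"
  shows src_less: "src f < N" and tgt_less: "tgt f < N"
    and cdawg_edge: "(ns ! src f, lab f, ns ! tgt f) \<in> cdawg_edges T"
proof -
  have "(src f, lab f, tgt f) \<in> set es"
    using assms es_nth nth_mem by metis
  then show "src f < N" "tgt f < N" "(ns ! src f, lab f, ns ! tgt f) \<in> cdawg_edges T"
    by (auto simp: set_es)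
qed

lemma node_in_cdawg_nodes: "k < N \<Longrightarrow> ns ! k \<in> cdawg_nodes T"
  using set_ns nth_mem by blast

lemma node_eq_iff: "i < N \<Longrightarrow> j < N \<Longrightarrow> ns ! i = ns ! j \<longleftrightarrow> i = j"
  using distinct_ns by (simp add: nth_eq_iff_index_eq)

lemma node_number_exists:
  assumes "U \<in> cdawg_nodes T"
  obtains k where "k < N" "ns ! k = U"
  using assms set_ns by (metis in_set_conv_nth)

lemma edge_number_exists:
  assumes "(U, l, V) \<in> cdawg_edges T"
  obtains f where "f < E" "ns ! src f = U" "lab f = l" "ns ! tgt f = V"
proof -
  obtain i j where ij: "i < N" "j < N" "ns ! i = U" "ns ! j = V"
    using cdawg_edge_nodes[OF assms] node_number_exists by metis
  then have "(i, l, j) \<in> set es"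
    using assms by (simp add: set_es)
  then obtain f where "f < E" "es ! f = (i, l, j)"
    by (auto simp: in_set_conv_nth)
  then show ?thesis
    using that ij by (simp add: es_nth)
qed

lemma Nil_in_node_iff: "k < N \<Longrightarrow> [] \<in> ns ! k \<longleftrightarrow> k = rt"
  using cdawg_node_eqI[OF node_in_cdawg_nodes cdawg_root_in_cdawg_nodes] node_eq_iff[OF _ rt_less]
  by (auto simp: nth_rt cdawg_root_eq)

lemma leaf_iff_sk: "k < N \<Longrightarrow> x \<in> ns ! k \<Longrightarrow> [] \<in> contexts x \<longleftrightarrow> k = sk"
  using leaf_iff_cdawg_sink[OF node_in_cdawg_nodes] node_eq_iff[OF _ sk_less] nth_sk by auto

lemma rt_neq_sk: "rt \<noteq> sk"
  using Nil_in_node_iff[OF rt_less] leaf_iff_sk[OF rt_less] by (auto simp: Nil_in_contexts_iff)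

lemma st_edge_iff_edge:
  assumes k: "k < N" and x: "x \<in> ns ! k"
  shows "(x, l, x @ l) \<in> st_edges T \<longleftrightarrow> (\<exists>f < E. src f = k \<and> lab f = l)"
proof
  assume "(x, l, x @ l) \<in> st_edges T"
  then obtain f where "f < E" "ns ! src f = ns ! k" "lab f = l"
    using cdawg_edgeI[OF node_in_cdawg_nodes[OF k] x] edge_number_exists by metis
  then show "\<exists>f < E. src f = k \<and> lab f = l"
    using node_eq_iff src_less k by blast
next
  assume "\<exists>f < E. src f = k \<and> lab f = l"
  then show "(x, l, x @ l) \<in> st_edges T"
    using cdawg_edge_st_edge(1)[OF cdawg_edge] x by blast
qed

lemma ex_out_edge_iff:
  assumes "k < N"
  shows "(\<exists>f < E. src f = k) \<longleftrightarrow> k \<noteq> sk"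
proof -
  have longest: "longest (ns ! k) \<in> ns ! k" "longest (ns ! k) \<in> st_nodes T"
    using longest_in cdawg_node_in_st_nodes node_in_cdawg_nodes[OF assms] by blast+
  have "(\<exists>f < E. src f = k) \<longleftrightarrow> (\<exists>l. (longest (ns ! k), l, longest (ns ! k) @ l) \<in> st_edges T)"
    using st_edge_iff_edge[OF assms longest(1)] by blast
  then show ?thesis
    using leaf_iff_no_st_edge[OF longest(2)] leaf_iff_sk[OF assms longest(1)] by blast
qed

lemma ex_in_edge_iff:
  assumes "k < N"
  shows "(\<exists>f < E. tgt f = k) \<longleftrightarrow> k \<noteq> rt"
proof
  assume "\<exists>f < E. tgt f = k"
  then show "k \<noteq> rt"
    using Nil_not_in_cdawg_edge_target[OF cdawg_edge] Nil_in_node_iff[OF assms] by blast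
next
  assume "k \<noteq> rt"
  note node = node_in_cdawg_nodes[OF assms]
  have "longest (ns ! k) \<noteq> []"
    using longest_in[OF node] Nil_in_node_iff[OF assms] \<open>k \<noteq> rt\<close> by auto
  then obtain f where "f < E" "ns ! tgt f = ns ! k"
    using cdawg_in_edge_exists[OF node longest_in[OF node]] edge_number_exists by metis
  then show "\<exists>f < E. tgt f = k"
    using node_eq_iff tgt_less assms by blast
qed

lemma src_less_iff:
  assumes "f < E"
  shows "src f < k \<longleftrightarrow> f < out_off k"
proof -
  have "sorted_wrt (\<lambda>x y. fst x \<le> fst y) es"
    by (rule sorted_wrt_mono_rel[OF _ sorted_es]) auto
  from sorted_key_less_iff_filter[OF this assms] show ?thesis
    unfolding out_off_def src_def by (simp add: case_prod_unfold)
qed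

lemma length_ins: "length ins = E"
  using distinct_card[OF distinct_ins] by (simp add: set_ins)

lemma ins_bij: "bij_betw (\<lambda>p. ins ! p) {..<E} {..<E}"
  using distinct_ins set_ins length_ins by (intro bij_betw_nth) auto

lemma ins_less: "p < E \<Longrightarrow> ins ! p < E"
  using ins_bij by (auto simp: bij_betw_def)

lemma tgt_ins_less_iff:
  assumes "p < E"
  shows "tgt (ins ! p) < k \<longleftrightarrow> p < in_off k"
proof -
  have "sorted_wrt (\<lambda>f g. tgt f \<le> tgt g) ins"
    by (rule sorted_wrt_mono_rel[OF _ sorted_ins]) (auto simp: es_nth)
  then have "tgt (ins ! p) < k \<longleftrightarrow> p < length (filter (\<lambda>f. tgt f < k) ins)"
    using assms length_ins by (intro sorted_key_less_iff_filter) simp_all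
  also have "length (filter (\<lambda>f. tgt f < k) ins) = card {f \<in> set ins. tgt f < k}"
    using distinct_ins distinct_card[of "filter (\<lambda>f. tgt f < k) ins"] by simp
  also have "\<dots> = in_off k"
    unfolding in_off_def length_filter_conv_card set_ins by (simp add: es_nth)
  finally show ?thesis .
qed

lemma node_length_less:
  assumes "f < E"
  shows "node_length (ns ! src f) < node_length (ns ! tgt f)"
proof -
  note edge = cdawg_edge[OF assms] and nodes = cdawg_edge_nodes[OF cdawg_edge[OF assms]]
  have "length (longest (ns ! src f)) < length (longest (ns ! src f) @ lab f)"
    using nodes(3) by simp
  also have "\<dots> \<le> length (longest (ns ! tgt f))"
    by (intro length_le_longest nodes(2) cdawg_edge_st_edge(2)[OF edge] longest_in nodes(1))
  finally show ?thesis
    using nodes by (simp add: node_length_eq_length_longest)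
qed

sublocale graph: numbered_dag N E rt sk src tgt out_off in_off "\<lambda>p. ins ! p" "\<lambda>k. node_length (ns ! k)"
proof
  show src_eq_iff: "src f = k \<longleftrightarrow> out_off k \<le> f \<and> f < out_off (Suc k)" if "f < E" for f k
    using src_less_iff[OF that, of k] src_less_iff[OF that, of "Suc k"] by auto
  show tgt_ins_eq_iff: "tgt (ins ! p) = k \<longleftrightarrow> in_off k \<le> p \<and> p < in_off (Suc k)" if "p < E" for p k
    using tgt_ins_less_iff[OF that, of k] tgt_ins_less_iff[OF that, of "Suc k"] by auto
  show "out_off k \<le> out_off (Suc k)" "in_off k \<le> in_off (Suc k)" for k
    by (auto simp: out_off_def in_off_def length_filter_conv_card intro!: card_mono)
  show out_off_le: "out_off k \<le> E" and in_off_le: "in_off k \<le> E" for k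
    by (simp_all add: out_off_def in_off_def)
  have nonempty_iff: "a < b \<longleftrightarrow> (\<exists>f < E. P f)"
    if P: "\<And>f. f < E \<Longrightarrow> P f \<longleftrightarrow> a \<le> f \<and> f < b" and "b \<le> E" for a b P
  proof
    assume "a < b"
    then show "\<exists>f < E. P f"
      using P[of a] \<open>b \<le> E\<close> by (intro exI[of _ a]) simp
  next
    assume "\<exists>f < E. P f"
    then show "a < b"
      using P le_less_trans by blast
  qed
  show "out_off k < out_off (Suc k) \<longleftrightarrow> k \<noteq> sk" if "k < N" for k
  proof -
    have "out_off k < out_off (Suc k) \<longleftrightarrow> (\<exists>f < E. src f = k)"
      by (rule nonempty_iff[OF src_eq_iff out_off_le])
    then show ?thesis
      using ex_out_edge_iff[OF that] by simp
  qed
  show "in_off k < in_off (Suc k) \<longleftrightarrow> k \<noteq> rt" if "k < N" for k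
  proof -
    have "in_off k < in_off (Suc k) \<longleftrightarrow> (\<exists>p < E. tgt (ins ! p) = k)"
      by (rule nonempty_iff[OF tgt_ins_eq_iff in_off_le])
    also have "\<dots> \<longleftrightarrow> (\<exists>f < E. tgt f = k)"
      using ins_bij by (metis bij_betw_imp_surj_on image_iff lessThan_iff)
    finally show ?thesis
      using ex_in_edge_iff[OF that] by simp
  qed
qed (simp_all add: rt_less sk_less rt_neq_sk src_less tgt_less ins_bij node_length_less)

definition edge_bwt :: "nat \<Rightarrow> str" where "edge_bwt f = bwt_below T (edge_string f)"
definition num_paths :: "nat \<Rightarrow> nat" where "num_paths k = card (contexts (longest (ns ! k)))"

lemma edge_string_in: "f < E \<Longrightarrow> edge_string f \<in> ns ! tgt f"
  unfolding edge_string_def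
  by (intro cdawg_edge_st_edge(2)[OF cdawg_edge] longest_in node_in_cdawg_nodes src_less)

lemma entry_string_in: "f < E \<Longrightarrow> entry_string f \<in> ns ! tgt f"
  unfolding entry_string_def
  by (intro cdawg_edge_st_edge(2)[OF cdawg_edge] shortest_in node_in_cdawg_nodes src_less)

lemma contexts_edge_string: "f < E \<Longrightarrow> card (contexts (edge_string f)) = num_paths (tgt f)"
  using cdawg_node_contexts_eq[OF node_in_cdawg_nodes edge_string_in longest_in[OF node_in_cdawg_nodes]]
  by (simp add: num_paths_def tgt_less)

lemma length_edge_bwt: "f < E \<Longrightarrow> length (edge_bwt f) = num_paths (tgt f)"
  by (simp add: edge_bwt_def length_bwt_below contexts_edge_string)

lemma out_labels_sorted: "sorted_wrt (\<lambda>l l'. hd l < hd l') (map lab (graph.out_edges k))"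
proof -
  have "hd (lab f) < hd (lab g)"
    if "f \<in> set (graph.out_edges k)" "g \<in> set (graph.out_edges k)" "f < g" for f g
    using sorted_wrt_nth_less[OF sorted_es, of f g] that by (simp add: es_nth graph.set_out_edges)
  then show ?thesis
    unfolding sorted_wrt_map
    by (rule sorted_wrt_mono_rel[of _ "(<)"]) (simp_all add: graph.out_edges_def)
qed

lemma set_out_labels:
  assumes "k < N" "x \<in> ns ! k"
  shows "set (map lab (graph.out_edges k)) = {l. (x, l, x @ l) \<in> st_edges T}"
  using st_edge_iff_edge[OF assms] by (auto simp: graph.set_out_edges)

lemma bwt_below_longest:
  assumes k: "k < N" "k \<noteq> sk"
  shows "bwt_below T (longest (ns ! k)) = concat (map edge_bwt (graph.out_edges k))"
proof -
  note longest = longest_in[OF node_in_cdawg_nodes[OF k(1)]]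
  have leaf: "longest (ns ! k) \<in> st_nodes T" "[] \<notin> contexts (longest (ns ! k))"
    using cdawg_node_in_st_nodes[OF node_in_cdawg_nodes[OF k(1)] longest] leaf_iff_sk[OF k(1) longest]
      k(2) by auto
  have edge_bwt_eq: "map edge_bwt (graph.out_edges k) =
      map (\<lambda>l. bwt_below T (longest (ns ! k) @ l)) (map lab (graph.out_edges k))"
    by (auto simp: edge_bwt_def edge_string_def graph.set_out_edges)
  show ?thesis
    unfolding edge_bwt_eq
    by (rule bwt_below_eq_concat_children[OF leaf out_labels_sorted set_out_labels[OF k(1) longest]])
qed

sublocale graph: path_counting N E rt sk src tgt out_off in_off "\<lambda>p. ins ! p"
  "\<lambda>k. node_length (ns ! k)" num_paths
proof
  show "num_paths sk = 1"
    by (simp add: num_paths_def nth_sk longest_cdawg_sink contexts_text)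
  show "num_paths k = (\<Sum>f \<in> set (graph.out_edges k). num_paths (tgt f))" if "k < N" "k \<noteq> sk" for k
  proof -
    have "num_paths k = (\<Sum>f\<leftarrow>graph.out_edges k. length (edge_bwt f))"
      using arg_cong[OF bwt_below_longest[OF that], of length]
      by (simp add: num_paths_def length_bwt_below length_concat comp_def)
    also have "\<dots> = (\<Sum>f \<in> set (graph.out_edges k). num_paths (tgt f))"
      unfolding sum_list_distinct_conv_sum_set[OF graph.distinct_out_edges]
      by (rule sum.cong) (simp_all add: graph.set_out_edges length_edge_bwt)
    finally show ?thesis .
  qed
qed

lemma in_position_exists:
  assumes "(U, l, ns ! k) \<in> cdawg_edges T" "k < N"
  obtains p where "p < E" "in_off k \<le> p" "p < in_off (Suc k)" "ns ! src (ins ! p) = U" "lab (ins ! p) = l"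
proof -
  obtain f where f: "f < E" "ns ! src f = U" "lab f = l" "ns ! tgt f = ns ! k"
    using edge_number_exists[OF assms(1)] .
  then have "tgt f = k"
    using node_eq_iff tgt_less assms(2) by blast
  moreover obtain p where "p < E" "ins ! p = f"
    using graph.ins_exists[OF f(1)] .
  ultimately show ?thesis
    using that f graph.tgt_ins_eq_iff[of p k] by auto
qed

lemma length_edge_string_le_iff:
  assumes "p < E" "q < E" "tgt (ins ! p) = tgt (ins ! q)"
  shows "length (edge_string (ins ! q)) \<le> length (edge_string (ins ! p)) \<longleftrightarrow> p \<le> q"
proof -
  have "length (edge_string (ins ! q)) < length (edge_string (ins ! p))"
    if "p < q" "q < E" "tgt (ins ! p) = tgt (ins ! q)" for p q
    using sorted_wrt_nth_less[OF sorted_ins, of p q] that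
    by (simp add: length_ins es_nth edge_string_def node_length_eq_length_longest node_in_cdawg_nodes
        src_less ins_less)
  then show ?thesis
    using assms by (metis le_less_linear less_imp_le linorder_neqE_nat not_less order_refl)
qed

lemma longest_via_first_in_edge:
  assumes k: "k < N" "k \<noteq> rt"
  shows "longest (ns ! k) = edge_string (ins ! in_off k)"
proof -
  note first = graph.first_in_edge[OF k]
  show ?thesis
    unfolding edge_string_def
  proof (rule longest_eq_via_first_in_edge)
    show "(ns ! src (ins ! in_off k), lab (ins ! in_off k), ns ! k) \<in> cdawg_edges T"
      using cdawg_edge[OF ins_less] first by metis
    fix U l assume edge: "(U, l, ns ! k) \<in> cdawg_edges T"
    obtain q where q: "q < E" "in_off k \<le> q" "q < in_off (Suc k)"
      "ns ! src (ins ! q) = U" "lab (ins ! q) = l"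
      using in_position_exists[OF edge k(1)] .
    then show "length (longest U @ l) \<le>
        length (longest (ns ! src (ins ! in_off k)) @ lab (ins ! in_off k))"
      using length_edge_string_le_iff[OF first(1) q(1)] first(2) graph.tgt_ins_eq_iff[of q k]
      by (simp add: edge_string_def)
  qed
qed

lemma shortest_via_last_in_edge:
  assumes k: "k < N" "k \<noteq> rt"
  shows "shortest (ns ! k) = entry_string (ins ! (in_off (Suc k) - 1))"
proof -
  note last = graph.last_in_edge[OF k]
  let ?p = "in_off (Suc k) - 1"
  show ?thesis
    unfolding entry_string_def
  proof (rule shortest_eq_via_last_in_edge)
    show "(ns ! src (ins ! ?p), lab (ins ! ?p), ns ! k) \<in> cdawg_edges T"
      using cdawg_edge[OF ins_less] last by metis
    fix U l assume edge: "(U, l, ns ! k) \<in> cdawg_edges T"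
    obtain q where q: "q < E" "in_off k \<le> q" "q < in_off (Suc k)"
      "ns ! src (ins ! q) = U" "lab (ins ! q) = l"
      using in_position_exists[OF edge k(1)] .
    then show "length (longest (ns ! src (ins ! ?p)) @ lab (ins ! ?p)) \<le> length (longest U @ l)"
      using length_edge_string_le_iff[OF q(1) last(2)] last(1,3) graph.tgt_ins_eq_iff[of q k]
      by (auto simp: edge_string_def)
  qed
qed

lemma entry_string_of_preceding:
  assumes k: "k < N" and p: "in_off k < p" "p < in_off (Suc k)"
  obtains a where "entry_string (ins ! (p - 1)) = a # edge_string (ins ! p)"
proof -
  have in_range: "p < E" "p - 1 < E" and tgt: "tgt (ins ! p) = k" "tgt (ins ! (p - 1)) = k"
    using p graph.in_off_le[of "Suc k"] graph.tgt_ins_eq_iff[of _ k] by auto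
  note edge = cdawg_edge[OF ins_less[OF in_range(1)], unfolded tgt]
    cdawg_edge[OF ins_less[OF in_range(2)], unfolded tgt]
  have "length (edge_string (ins ! p)) < length (edge_string (ins ! (p - 1)))"
    using length_edge_string_le_iff[OF in_range] tgt p(1) by auto
  moreover have "length (edge_string (ins ! (p - 1))) \<le> length (longest W @ m)"
    if W: "(W, m, ns ! k) \<in> cdawg_edges T"
      and less: "length (edge_string (ins ! p)) < length (longest W @ m)"
    for W m
  proof -
    obtain q where q: "q < E" "in_off k \<le> q" "q < in_off (Suc k)"
      "ns ! src (ins ! q) = W" "lab (ins ! q) = m"
      using in_position_exists[OF W k] .
    then have "tgt (ins ! q) = k" "longest W @ m = edge_string (ins ! q)"
      using graph.tgt_ins_eq_iff[of q k] by (auto simp: edge_string_def)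
    moreover from this have "q < p"
      using length_edge_string_le_iff[OF in_range(1) q(1)] less tgt by auto
    ultimately show ?thesis
      using length_edge_string_le_iff[OF q(1) in_range(2)] tgt by simp
  qed
  ultimately obtain a where "entry_string (ins ! (p - 1)) = a # edge_string (ins ! p)"
    using shortest_via_preceding_in_edge[OF edge] unfolding edge_string_def entry_string_def by metis
  then show ?thesis
    by (rule that)
qed

lemma edge_bwt_secondary:
  assumes k: "k < N" and p: "in_off k < p" "p < in_off (Suc k)"
  shows "edge_bwt (ins ! p) = replicate (num_paths k) (hd (entry_string (ins ! (p - 1))))"
proof -
  have in_range: "p < E" "p - 1 < E" and tgt: "tgt (ins ! p) = k" "tgt (ins ! (p - 1)) = k"
    using p graph.in_off_le[of "Suc k"] graph.tgt_ins_eq_iff[of _ k] by auto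
  obtain a where a: "entry_string (ins ! (p - 1)) = a # edge_string (ins ! p)"
    using entry_string_of_preceding[OF assms] .
  then have "a # edge_string (ins ! p) \<in> ns ! k" "edge_string (ins ! p) \<in> ns ! k"
    using entry_string_in[OF ins_less[OF in_range(2)]] edge_string_in[OF ins_less[OF in_range(1)]] tgt
    by simp_all
  then have "contexts (a # edge_string (ins ! p)) = contexts (edge_string (ins ! p))"
    by (rule cdawg_node_contexts_eq[OF node_in_cdawg_nodes[OF k]])
  then have "edge_bwt (ins ! p) = replicate (num_paths k) a"
    using contexts_edge_string[OF ins_less[OF in_range(1)]] tgt
    by (simp add: edge_bwt_def bwt_below_single_run)
  then show ?thesis
    by (simp only: a list.sel)
qed

lemma longest_rt: "longest (ns ! rt) = []"
  using longest_in[OF node_in_cdawg_nodes[OF rt_less]] by (simp add: nth_rt cdawg_root_eq)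

lemma hd_entry_string:
  assumes "f < E"
  shows "hd (entry_string f) = (if src f = rt then hd (lab f) else hd (shortest (ns ! src f)))"
proof -
  have in_node: "shortest (ns ! src f) \<in> ns ! src f"
    by (intro shortest_in node_in_cdawg_nodes src_less assms)
  have "shortest (ns ! src f) = [] \<longleftrightarrow> src f = rt"
  proof
    assume "src f = rt"
    then show "shortest (ns ! src f) = []"
      using in_node by (simp add: nth_rt cdawg_root_eq)
  next
    assume "shortest (ns ! src f) = []"
    then show "src f = rt"
      using in_node Nil_in_node_iff[OF src_less[OF assms]] by simp
  qed
  then show ?thesis
    by (cases "src f = rt") (simp_all add: entry_string_def)
qed

lemma last_symbol_eq_first_label: "last T = hd (lab (out_off rt))"
proof -
  have x: "[] \<in> ns ! rt"
    by (simp add: nth_rt cdawg_root_eq)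
  have labels: "set (map lab (graph.out_edges rt)) = {l. ([], l, l) \<in> st_edges T}"
    using set_out_labels[OF rt_less x] by simp
  have out_edges: "graph.out_edges rt = out_off rt # [Suc (out_off rt)..<out_off (Suc rt)]"
    using graph.out_off_less_iff[OF rt_less] rt_neq_sk by (simp add: graph.out_edges_def upt_conv_Cons)
  have least: "hd (lab (out_off rt)) \<le> hd l" if "([], l, l) \<in> st_edges T" for l
  proof -
    have "l \<in> set (map lab (graph.out_edges rt))"
      unfolding labels using that by simp
    then show ?thesis
      using out_labels_sorted[of rt] unfolding out_edges by auto
  qed
  have "lab (out_off rt) \<in> set (map lab (graph.out_edges rt))"
    unfolding out_edges by simp
  then have "([], lab (out_off rt), lab (out_off rt)) \<in> st_edges T"
    unfolding labels by simp
  then show ?thesis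
    using least[OF end_marker_st_edge] last_symbol_le_hd_st_edge by (simp add: antisym)
qed

lemma bwt_eq_concat_edge_bwt: "bwt T = concat (map edge_bwt (graph.out_edges rt))"
  unfolding bwt_eq_bwt_below_root using bwt_below_longest[OF rt_less rt_neq_sk] by (simp add: longest_rt)

sublocale graph: bwt_dag N E rt sk src tgt out_off in_off "\<lambda>p. ins ! p"
  "\<lambda>k. node_length (ns ! k)" num_paths
  "length T" "\<lambda>f. hd (lab f)" "\<lambda>f. hd (entry_string f)" "\<lambda>k. hd (shortest (ns ! k))" edge_bwt
proof
  show "num_paths k \<le> length T" for k
    by (simp add: num_paths_def card_contexts_le)
  show "0 < num_paths k" if "k < N" for k
  proof -
    have "longest (ns ! k) \<in> st_nodes T"
      using cdawg_node_in_st_nodes longest_in node_in_cdawg_nodes[OF that] by blast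
    then show ?thesis
      by (simp add: num_paths_def card_gt_0_iff finite_contexts contexts_nonempty)
  qed
  show "hd (shortest (ns ! k)) = hd (entry_string (ins ! (in_off (Suc k) - 1)))" if "k < N" "k \<noteq> rt" for k
    by (simp only: shortest_via_last_in_edge[OF that])
  have "edge_string (ins ! in_off sk) = T"
    using longest_via_first_in_edge[OF sk_less rt_neq_sk[symmetric]]
    by (simp add: nth_sk longest_cdawg_sink)
  then show "edge_bwt (ins ! in_off sk) = [hd (lab (out_off rt))]"
    by (simp add: edge_bwt_def bwt_below_text last_symbol_eq_first_label)
  show "edge_bwt (ins ! in_off k) = concat (map edge_bwt (graph.out_edges k))"
    if "k < N" "k \<noteq> rt" "k \<noteq> sk" for k
    using longest_via_first_in_edge[OF that(1,2)] bwt_below_longest[OF that(1,3)]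
    by (simp add: edge_bwt_def)
  show "length (concat (map edge_bwt (graph.out_edges rt))) \<le> length T"
    unfolding bwt_eq_concat_edge_bwt[symmetric] by (simp add: length_bwt)
qed (simp_all add: hd_entry_string edge_bwt_secondary)

lemma root_bwt_eq_bwt: "graph.root_bwt = bwt T"
  by (simp add: graph.root_bwt_def bwt_eq_concat_edge_bwt)

lemma num_edges_le_cdawg_size: "E \<le> cdawg_size T"
proof -
  have "card (set es) \<le> card (cdawg_edges T)"
  proof (rule card_inj_on_le[of "\<lambda>(i, l, j). (ns ! i, l, ns ! j)"])
    show "inj_on (\<lambda>(i, l, j). (ns ! i, l, ns ! j)) (set es)"
      using node_eq_iff by (auto simp: inj_on_def set_es)
  qed (auto simp: set_es finite_cdawg_edges)
  then show ?thesis
    by (simp add: distinct_card[OF distinct_es] cdawg_size_def)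
qed

lemma rlbwt_length_le: "length (rlbwt T) \<le> E"
  using graph.runs_root_bwt_le by (simp add: rlbwt_def root_bwt_eq_bwt)

end


section \<open>The number of runs\<close>

lemma sorted_enumeration_exists:
  fixes key :: "'a \<Rightarrow> 'b :: linorder"
  assumes "finite S" "inj_on key S"
  obtains xs where "distinct xs" "set xs = S" "sorted_wrt (\<lambda>x y. key x < key y) xs"
proof -
  obtain ys where ys: "set ys = S" "distinct ys"
    using finite_distinct_list[OF assms(1)] by blast
  have "sorted_wrt (<) (map key (sort_key key ys))"
    using ys assms(2) by (simp add: strict_sorted_iff distinct_map)
  then show ?thesis
    using that[of "sort_key key ys"] ys by (simp add: sorted_wrt_map)
qed

context terminated_text
begin

lemma out_edge_order_exists:
  assumes "distinct ns"
  obtains es where "distinct es" "set es = numbered_edges T ns" "sorted_by_source es"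
proof -
  have nodes: "i = j" if "i < length ns" "j < length ns" "ns ! i = ns ! j" for i j
    using that assms by (simp add: nth_eq_iff_index_eq)
  have "finite (numbered_edges T ns)"
  proof (rule inj_on_finite)
    show "inj_on (\<lambda>(i, l, j). (ns ! i, l, ns ! j)) (numbered_edges T ns)"
      using nodes by (auto simp: inj_on_def)
    show "(\<lambda>(i, l, j). (ns ! i, l, ns ! j)) ` numbered_edges T ns \<subseteq> cdawg_edges T"
      by auto
  qed (rule finite_cdawg_edges)
  moreover have "inj_on (\<lambda>(i, l, j). [i, hd l]) (numbered_edges T ns)"
    using cdawg_out_edge_unique nodes by (auto simp: inj_on_def)
  ultimately obtain es where "distinct es" "set es = numbered_edges T ns"
    and sorted: "sorted_wrt
      (\<lambda>x y. (case x of (i, l, j) \<Rightarrow> [i, hd l]) < (case y of (i, l, j) \<Rightarrow> [i, hd l])) es"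
    by (rule sorted_enumeration_exists)
  moreover have "sorted_by_source es"
    by (rule sorted_wrt_mono_rel[OF _ sorted]) auto
  ultimately show ?thesis
    using that by blast
qed

lemma numbered_edge_eqI:
  assumes "distinct ns" "(i, l, j) \<in> numbered_edges T ns" "(i', l', j) \<in> numbered_edges T ns"
    and "node_length (ns ! i) + length l = node_length (ns ! i') + length l'"
  shows "i = i' \<and> l = l'"
proof -
  have edges: "(ns ! i, l, ns ! j) \<in> cdawg_edges T" "(ns ! i', l', ns ! j) \<in> cdawg_edges T"
    using assms(2,3) by auto
  then have "length (longest (ns ! i) @ l) = length (longest (ns ! i') @ l')"
    using cdawg_edge_nodes(1)[OF edges(1)] cdawg_edge_nodes(1)[OF edges(2)] assms(4)
    by (simp add: node_length_eq_length_longest)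
  then have "ns ! i = ns ! i' \<and> l = l'"
    using cdawg_in_edge_intervals_inj[OF edges] by blast
  then show ?thesis
    using assms(1-3) by (simp add: nth_eq_iff_index_eq)
qed

lemma in_edge_order_exists:
  assumes ns: "distinct ns" and es: "distinct es" "set es = numbered_edges T ns"
  obtains ins where "distinct ins" "set ins = {..<length es}" "sorted_by_target ns es ins"
proof -
  define key where "key f = (case es ! f of (i, l, j) \<Rightarrow>
    [int j, - int (node_length (ns ! i) + length l)])" for f
  have "inj_on key {..<length es}"
  proof (rule inj_onI)
    fix f g assume fg: "f \<in> {..<length es}" "g \<in> {..<length es}" "key f = key g"
    obtain i l j i' l' j' where nth: "es ! f = (i, l, j)" "es ! g = (i', l', j')"
      by (metis surj_pair)
    then have j: "j = j'"
      and lengths: "node_length (ns ! i) + length l = node_length (ns ! i') + length l'"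
      using fg(3) by (simp_all add: key_def)
    have "(i, l, j) \<in> numbered_edges T ns" "(i', l', j) \<in> numbered_edges T ns"
      unfolding nth[folded j, symmetric] es(2)[symmetric] using fg(1,2) by simp_all
    from numbered_edge_eqI[OF ns this lengths] have "es ! f = es ! g"
      using nth j by simp
    then show "f = g"
      using fg es(1) by (simp add: nth_eq_iff_index_eq)
  qed
  then obtain ins where "distinct ins" "set ins = {..<length es}"
    and sorted: "sorted_wrt (\<lambda>f g. key f < key g) ins"
    using sorted_enumeration_exists[of "{..<length es}" key] by blast
  moreover have "sorted_by_target ns es ins"
    by (rule sorted_wrt_mono_rel[OF _ sorted]) (auto simp: key_def split: prod.splits)
  ultimately show ?thesis
    using that by blast
qed

lemma self_index_exists: "\<exists>ns rt sk es ins. self_index T ns rt sk es ins"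
proof -
  obtain ns where ns: "distinct ns" "set ns = cdawg_nodes T"
    using finite_distinct_list[OF finite_cdawg_nodes] by blast
  obtain rt where rt: "rt < length ns" "ns ! rt = cdawg_root T"
    using cdawg_root_in_cdawg_nodes ns(2) by (metis in_set_conv_nth)
  obtain sk where sk: "sk < length ns" "ns ! sk = cdawg_sink T"
    using cdawg_sink_in_cdawg_nodes ns(2) by (metis in_set_conv_nth)
  obtain es where es: "distinct es" "set es = numbered_edges T ns" "sorted_by_source es"
    using out_edge_order_exists[OF ns(1)] .
  obtain ins where ins: "distinct ins" "set ins = {..<length es}" "sorted_by_target ns es ins"
    using in_edge_order_exists[OF ns(1) es(1,2)] .
  have "self_index T ns rt sk es ins"
    by unfold_locales (fact ns rt sk es ins)+
  then show ?thesis
    by blast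
qed

end

lemma bwt_runs_le_cdawg_size:
  assumes "terminated T"
  shows "bwt_runs T \<le> cdawg_size T"
proof -
  interpret terminated_text T
    by unfold_locales (rule assms)
  obtain ns rt sk es ins where "self_index T ns rt sk es ins"
    using self_index_exists by blast
  then interpret self_index T ns rt sk es ins .
  show ?thesis
    using rlbwt_length_le num_edges_le_cdawg_size by (simp add: bwt_runs_def)
qed


section \<open>A structured language for the word RAM\<close>

datatype ('r, 'a) com =
    Skip
  | Set_reg 'r nat
  | Add_reg 'r 'r 'r
  | Sub_reg 'r 'r 'r
  | Read 'r 'a 'r
  | Write 'a 'r 'r
  | Seq "('r, 'a) com" "('r, 'a) com" (infixr ";;" 60)
  | If_eq 'r 'r "('r, 'a) com" "('r, 'a) com"
  | While_less 'r 'r "('r, 'a) com"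

type_synonym 'r regs = "'r \<Rightarrow> nat"
type_synonym 'a arrays = "'a \<Rightarrow> nat \<Rightarrow> nat"

text \<open>The fourth argument of \<open>exec\<close> is the number of RAM instructions that the compiled code executes.
  Additions that overflow, negative differences and accesses outside of an array are stuck.\<close>

locale array_machine =
  fixes word_bound :: nat and len :: "'a \<Rightarrow> nat"
begin

inductive exec :: "('r, 'a) com \<Rightarrow> 'r regs \<Rightarrow> 'a arrays \<Rightarrow> nat \<Rightarrow> 'r regs \<Rightarrow> 'a arrays \<Rightarrow> bool" where
  Skip: "exec Skip R A 0 R A"
| Set_reg: "k < word_bound \<Longrightarrow> exec (Set_reg d k) R A 1 (R(d := k)) A"
| Add_reg: "R a + R b < word_bound \<Longrightarrow> exec (Add_reg d a b) R A 1 (R(d := R a + R b)) A"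
| Sub_reg: "R b \<le> R a \<Longrightarrow> R a < word_bound \<Longrightarrow> exec (Sub_reg d a b) R A 1 (R(d := R a - R b)) A"
| Read: "R i < len a \<Longrightarrow> exec (Read d a i) R A 4 (R(d := A a (R i))) A"
| Write: "R i < len a \<Longrightarrow> exec (Write a i s) R A 4 R (A(a := (A a)(R i := R s)))"
| Seq: "exec c R A t R' A' \<Longrightarrow> exec c' R' A' t' R'' A'' \<Longrightarrow> exec (c ;; c') R A (t + t') R'' A''"
| If_true: "R a = R b \<Longrightarrow> exec c R A t R' A' \<Longrightarrow> exec (If_eq a b c c') R A (t + 1) R' A'"
| If_false: "R a \<noteq> R b \<Longrightarrow> exec c' R A t R' A' \<Longrightarrow> exec (If_eq a b c c') R A (t + 2) R' A'"
| While_true: "R a < R b \<Longrightarrow> exec c R A t R' A' \<Longrightarrow> exec (While_less a b c) R' A' t' R'' A'' \<Longrightarrow>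
    exec (While_less a b c) R A (t + t' + 2) R'' A''"
| While_false: "\<not> R a < R b \<Longrightarrow> exec (While_less a b c) R A 2 R A"

inductive_cases exec_SeqE: "exec (c ;; c') R A t R' A'"
inductive_cases exec_IfE: "exec (If_eq a b c c') R A t R' A'"

definition wp ::
    "('r, 'a) com \<Rightarrow> ('r regs \<Rightarrow> 'a arrays \<Rightarrow> nat \<Rightarrow> bool) \<Rightarrow> 'r regs \<Rightarrow> 'a arrays \<Rightarrow> nat \<Rightarrow> bool" where
  "wp c Q R A t \<longleftrightarrow> (\<exists>k R' A'. exec c R A k R' A' \<and> Q R' A' (t + k))"

lemma wpI: "exec c R A k R' A' \<Longrightarrow> Q R' A' (t + k) \<Longrightarrow> wp c Q R A t"
  unfolding wp_def by blast

lemma wpE: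
  assumes "wp c Q R A t"
  obtains k R' A' where "exec c R A k R' A'" "Q R' A' (t + k)"
  using assms unfolding wp_def by blast

lemma wp_atomic [simp]:
  "wp Skip Q R A t \<longleftrightarrow> Q R A t"
  "wp (Set_reg d k) Q R A t \<longleftrightarrow> k < word_bound \<and> Q (R(d := k)) A (t + 1)"
  "wp (Add_reg d a b) Q R A t \<longleftrightarrow> R a + R b < word_bound \<and> Q (R(d := R a + R b)) A (t + 1)"
  "wp (Sub_reg d a b) Q R A t \<longleftrightarrow> R b \<le> R a \<and> R a < word_bound \<and> Q (R(d := R a - R b)) A (t + 1)"
  "wp (Read d ar i) Q R A t \<longleftrightarrow> R i < len ar \<and> Q (R(d := A ar (R i))) A (t + 4)"
  "wp (Write ar i s) Q R A t \<longleftrightarrow> R i < len ar \<and> Q R (A(ar := (A ar)(R i := R s))) (t + 4)"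
  unfolding wp_def by (subst exec.simps, fastforce)+

lemma wp_Seq [simp]: "wp (c ;; c') Q R A t \<longleftrightarrow> wp c (wp c' Q) R A t"
proof
  assume "wp (c ;; c') Q R A t"
  then obtain k k' R' A' R'' A''
    where "exec c R A k R' A'" "exec c' R' A' k' R'' A''" "Q R'' A'' (t + k + k')"
    by (fastforce elim: wpE exec_SeqE simp: add.assoc)
  then show "wp c (wp c' Q) R A t"
    by (blast intro: wpI)
next
  assume "wp c (wp c' Q) R A t"
  then obtain k k' R' A' R'' A''
    where "exec c R A k R' A'" "exec c' R' A' k' R'' A''" "Q R'' A'' (t + (k + k'))"
    by (fastforce elim: wpE simp: add.assoc)
  then show "wp (c ;; c') Q R A t"
    by (blast intro: wpI exec.Seq)
qed

lemma wp_If [simp]: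
  "wp (If_eq a b c c') Q R A t \<longleftrightarrow> (if R a = R b then wp c Q R A (t + 1) else wp c' Q R A (t + 2))"
proof -
  have shift: "wp c Q R A (t + s) \<longleftrightarrow> (\<exists>k R' A'. exec c R A k R' A' \<and> Q R' A' (t + (k + s)))" for c s
    by (simp add: wp_def ac_simps)
  show ?thesis
    unfolding shift unfolding wp_def
    by (cases "R a = R b") (fastforce elim!: exec_IfE intro: exec.If_true exec.If_false)+
qed

lemma wp_mono:
  assumes "wp c Q R A t" "\<And>R A t. Q R A t \<Longrightarrow> Q' R A t"
  shows "wp c Q' R A t"
  using assms by (blast elim: wpE intro: wpI)

lemma wp_SeqI:
  assumes "wp c P R A t" "\<And>R A t. P R A t \<Longrightarrow> wp c' Q R A t"
  shows "wp (c ;; c') Q R A t"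
  unfolding wp_Seq by (rule wp_mono[OF assms])

text \<open>Each iteration takes time, so an upper bound on the elapsed time doubles as the variant of a loop.\<close>

lemma wp_While:
  assumes "I R A t"
    and bound: "\<And>R A t. I R A t \<Longrightarrow> t \<le> b"
    and body: "\<And>R A t. I R A t \<Longrightarrow> R x < R y \<Longrightarrow> wp c I R A (t + 2)"
    and exit: "\<And>R A t. I R A t \<Longrightarrow> \<not> R x < R y \<Longrightarrow> Q R A (t + 2)"
  shows "wp (While_less x y c) Q R A t"
  using assms(1)
proof (induction "b - t" arbitrary: R A t rule: less_induct)
  case less
  show ?case
  proof (cases "R x < R y")
    case True
    obtain k R' A' where body: "exec c R A k R' A'" "I R' A' (t + 2 + k)"
      using body[OF less.prems True] by (rule wpE)
    have "b - (t + 2 + k) < b - t"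
      using bound[OF body(2)] by simp
    then obtain k' R'' A'' where "exec (While_less x y c) R' A' k' R'' A''" "Q R'' A'' (t + 2 + k + k')"
      using less.hyps body(2) by (blast elim: wpE)
    then show ?thesis
      using exec.While_true[OF True body(1)] by (intro wpI) (auto simp: ac_simps)
  next
    case False
    then show ?thesis
      using exit[OF less.prems] by (intro wpI[OF exec.While_false])
  qed
qed

end


section \<open>Compilation\<close>

text \<open>Registers 0 and 1 receive the output and register 2 is scratch. The base address of array \<open>a\<close> is
  kept in register \<open>base_reg a\<close>, and entry \<open>i\<close> of the array has the address \<open>base a + stride a * i\<close>.\<close>

definition scratch :: nat where
  "scratch = 2"

definition reg :: "'r :: countable \<Rightarrow> nat" where
  "reg r = 3 + 2 * to_nat r"

definition base_reg :: "'a :: countable \<Rightarrow> nat" where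
  "base_reg a = 4 + 2 * to_nat a"

lemma reg_simps [simp]:
  "reg r = reg r' \<longleftrightarrow> r = r'" "base_reg a = base_reg a' \<longleftrightarrow> a = a'"
  "reg r \<noteq> base_reg a" "base_reg a \<noteq> reg r"
  "reg r \<noteq> 0" "0 \<noteq> reg r" "reg r \<noteq> Suc 0" "Suc 0 \<noteq> reg r"
  "base_reg a \<noteq> 0" "0 \<noteq> base_reg a" "base_reg a \<noteq> Suc 0" "Suc 0 \<noteq> base_reg a"
  "reg r \<noteq> scratch" "scratch \<noteq> reg r" "base_reg a \<noteq> scratch" "scratch \<noteq> base_reg a"
  unfolding reg_def base_reg_def scratch_def by (simp_all, presburger+)

primrec code_size :: "('r, 'a) com \<Rightarrow> nat" where
  "code_size Skip = 0"
| "code_size (Set_reg d k) = 1"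
| "code_size (Add_reg d a b) = 1"
| "code_size (Sub_reg d a b) = 1"
| "code_size (Read d a i) = 4"
| "code_size (Write a i s) = 4"
| "code_size (c ;; c') = code_size c + code_size c'"
| "code_size (If_eq a b c c') = code_size c + code_size c' + 2"
| "code_size (While_less a b c) = code_size c + 3"

definition compute_address :: "('a :: countable \<Rightarrow> nat) \<Rightarrow> 'a \<Rightarrow> 'r :: countable \<Rightarrow> instr list" where
  "compute_address stride a i =
     [Const scratch (stride a), Op Mul scratch scratch (reg i), Op Add scratch scratch (base_reg a)]"

primrec compile :: "('a :: countable \<Rightarrow> nat) \<Rightarrow> nat \<Rightarrow> ('r :: countable, 'a) com \<Rightarrow> instr list" where
  "compile stride pc Skip = []"
| "compile stride pc (Set_reg d k) = [Const (reg d) k]"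
| "compile stride pc (Add_reg d a b) = [Op Add (reg d) (reg a) (reg b)]"
| "compile stride pc (Sub_reg d a b) = [Op Sub (reg d) (reg a) (reg b)]"
| "compile stride pc (Read d a i) = compute_address stride a i @ [Load (reg d) scratch]"
| "compile stride pc (Write a i s) = compute_address stride a i @ [Store scratch (reg s)]"
| "compile stride pc (c ;; c') = compile stride pc c @ compile stride (pc + code_size c) c'"
| "compile stride pc (If_eq a b c c') =
     [Jump_eq (reg a) (reg b) (pc + code_size c' + 2)] @ compile stride (pc + 1) c' @
     [Jump (pc + code_size c' + 2 + code_size c)] @ compile stride (pc + code_size c' + 2) c"
| "compile stride pc (While_less a b c) =
     [Jump_less (reg a) (reg b) (pc + 2), Jump (pc + code_size c + 3)] @
       compile stride (pc + 2) c @ [Jump pc]"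

lemma length_compile [simp]: "length (compile stride pc c) = code_size c"
  by (induction c arbitrary: pc) (auto simp: compute_address_def)

primrec writes :: "('r, 'a) com \<Rightarrow> 'a set" where
  "writes Skip = {}"
| "writes (Set_reg d k) = {}"
| "writes (Add_reg d a b) = {}"
| "writes (Sub_reg d a b) = {}"
| "writes (Read d a i) = {}"
| "writes (Write a i s) = {a}"
| "writes (c ;; c') = writes c \<union> writes c'"
| "writes (If_eq a b c c') = writes c \<union> writes c'"
| "writes (While_less a b c) = writes c"

definition code_at :: "instr list \<Rightarrow> nat \<Rightarrow> instr list \<Rightarrow> bool" where
  "code_at P pc cs \<longleftrightarrow> prefix cs (drop pc P)"

lemma code_at_Nil [simp]: "code_at P pc []"
  by (simp add: code_at_def)

lemma code_at_append [simp]: "code_at P pc (cs @ cs') \<longleftrightarrow> code_at P pc cs \<and> code_at P (pc + length cs) cs'"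
proof -
  have "prefix (cs @ cs') zs \<longleftrightarrow> prefix cs zs \<and> prefix cs' (drop (length cs) zs)" for zs
    by (auto simp: prefix_def)
  then show ?thesis
    by (simp add: code_at_def add.commute)
qed

lemma code_at_Cons [simp]: "code_at P pc (c # cs) \<longleftrightarrow> pc < length P \<and> P ! pc = c \<and> code_at P (pc + 1) cs"
proof (cases "pc < length P")
  case True
  then have "drop pc P = P ! pc # drop (pc + 1) P"
    by (simp add: Cons_nth_drop_Suc)
  then show ?thesis
    using True by (auto simp: code_at_def)
qed (simp add: code_at_def)

lemma steps_add: "steps w P (t + t') s = Option.bind (steps w P t s) (steps w P t')"
proof (induction t arbitrary: s)
  case (Suc t)
  then show ?case
    by (cases "step w P s") simp_all
qed simp

lemma steps_trans:
  "steps w P t s = Some s' \<Longrightarrow> steps w P t' s' = Some s'' \<Longrightarrow> steps w P (t + t') s = Some s''"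
  by (simp add: steps_add)

locale memory_layout = array_machine "2 ^ w" len
  for w :: nat and len :: "'a :: countable \<Rightarrow> nat" +
  fixes m :: nat and writable :: "'a set" and base stride :: "'a \<Rightarrow> nat"
  assumes memory_le: "m \<le> 2 ^ w"
    and in_memory: "i < len a \<Longrightarrow> base a + stride a * i < m"
    and stride_less: "stride a < 2 ^ w"
    and disjoint: "a \<in> writable \<Longrightarrow> i < len a \<Longrightarrow> i' < len a' \<Longrightarrow>
      base a + stride a * i = base a' + stride a' * i' \<Longrightarrow> a = a' \<and> i = i'"
begin

definition represents :: "(nat \<Rightarrow> nat) \<Rightarrow> nat list \<Rightarrow> 'r :: countable regs \<Rightarrow> 'a arrays \<Rightarrow> bool" where
  "represents R' M R A \<longleftrightarrow> (\<forall>r. R' (reg r) = R r) \<and> (\<forall>a. R' (base_reg a) = base a) \<and> length M = m \<and>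
     (\<forall>a. \<forall>i < len a. M ! (base a + stride a * i) = A a i)"

lemma representsD:
  assumes "represents R' M R A"
  shows "R' (reg r) = R r" "R' (base_reg a) = base a" "length M = m"
    "i < len a \<Longrightarrow> M ! (base a + stride a * i) = A a i"
  using assms by (auto simp: represents_def)

lemma represents_update: "represents R' M R A \<Longrightarrow> represents (R'(reg d := x)) M (R(d := x)) A"
  by (auto simp: represents_def)

lemma represents_scratch: "represents R' M R A \<Longrightarrow> represents (R'(scratch := x)) M R A"
  by (auto simp: represents_def)

lemma represents_write:
  assumes "represents R' M R A" "a \<in> writable" "i < len a"
  shows "represents R' (M[base a + stride a * i := x]) R (A(a := (A a)(i := x)))"
proof -
  have "M[base a + stride a * i := x] ! (base a' + stride a' * i') = (A(a := (A a)(i := x))) a' i'"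
    if "i' < len a'" for a' i'
  proof (cases "a' = a \<and> i' = i")
    case True
    then show ?thesis
      using in_memory[OF assms(3)] representsD(3)[OF assms(1)] by simp
  next
    case False
    then have "base a + stride a * i \<noteq> base a' + stride a' * i'"
      using disjoint[OF assms(2,3) that] by auto
    then show ?thesis
      using False representsD(4)[OF assms(1) that] by auto
  qed
  then show ?thesis
    using representsD[OF assms(1)] by (simp add: represents_def)
qed

definition reaches :: "instr list \<Rightarrow> nat \<Rightarrow> state \<Rightarrow> nat \<Rightarrow> 'r :: countable regs \<Rightarrow> 'a arrays \<Rightarrow> bool" where
  "reaches P t s pc R A \<longleftrightarrow> (\<exists>R' M. steps w P t s = Some (pc, R', M) \<and> represents R' M R A)"

lemma reachesI: "steps w P t s = Some (pc, R', M) \<Longrightarrow> represents R' M R A \<Longrightarrow> reaches P t s pc R A"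
  by (auto simp: reaches_def)

lemma reaches_stepI: "step w P s = Some (pc, R', M) \<Longrightarrow> represents R' M R A \<Longrightarrow> reaches P 1 s pc R A"
  by (rule reachesI) simp_all

lemma reaches_trans:
  assumes "reaches P t s pc R A" "\<And>R' M. represents R' M R A \<Longrightarrow> reaches P t' (pc, R', M) pc' R2 A2"
  shows "reaches P (t + t') s pc' R2 A2"
  using assms steps_trans unfolding reaches_def by blast

lemma compute_address_correct:
  assumes rep: "represents R' M R A" and i: "R i < len a"
    and code: "code_at P pc (compute_address stride a i)"
  shows "steps w P 3 (pc, R', M) = Some (pc + 3, R'(scratch := base a + stride a * R i), M)"
proof -
  have "base a + stride a * R i < 2 ^ w"
    using in_memory[OF i] memory_le by (rule less_le_trans)
  then have "(stride a * R i) mod 2 ^ w = stride a * R i"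
    "(stride a * R i + base a) mod 2 ^ w = base a + stride a * R i"
    by (simp_all add: add.commute)
  then show ?thesis
    using code representsD(1,2)[OF rep] stride_less[of a]
    by (simp add: compute_address_def eval_nat_numeral)
qed

lemma compile_Read_correct:
  assumes rep: "represents R' M R A" and i: "R i < len a"
    and code: "code_at P pc (compile stride pc (Read d a i))"
  shows "reaches P 4 (pc, R', M) (pc + code_size (Read d a i)) (R(d := A a (R i))) A"
proof -
  let ?p = "base a + stride a * R i"
  have "steps w P 3 (pc, R', M) = Some (pc + 3, R'(scratch := ?p), M)"
    using code by (intro compute_address_correct[OF rep i]) simp
  moreover have "steps w P 1 (pc + 3, R'(scratch := ?p), M) =
    Some (pc + 4, R'(scratch := ?p, reg d := A a (R i)), M)"
    using code in_memory[OF i] by (simp add: compute_address_def representsD[OF rep] i eval_nat_numeral)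
  ultimately have "steps w P (3 + 1) (pc, R', M) =
    Some (pc + 4, R'(scratch := ?p, reg d := A a (R i)), M)"
    by (rule steps_trans)
  then have "reaches P (3 + 1) (pc, R', M) (pc + 4) (R(d := A a (R i))) A"
    by (rule reachesI[OF _ represents_update[OF represents_scratch[OF rep]]])
  then show ?thesis
    by simp
qed

lemma compile_Write_correct:
  assumes rep: "represents R' M R A" and i: "R i < len a"
    and code: "code_at P pc (compile stride pc (Write a i s))"
    and "a \<in> writable"
  shows "reaches P 4 (pc, R', M) (pc + code_size (Write a i s)) R (A(a := (A a)(R i := R s)))"
proof -
  let ?p = "base a + stride a * R i"
  have "steps w P 3 (pc, R', M) = Some (pc + 3, R'(scratch := ?p), M)"
    using code by (intro compute_address_correct[OF rep i]) simp
  moreover have "steps w P 1 (pc + 3, R'(scratch := ?p), M) =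
    Some (pc + 4, R'(scratch := ?p), M[?p := R s])"
    using code in_memory[OF i] by (simp add: compute_address_def representsD[OF rep] eval_nat_numeral)
  ultimately have "steps w P (3 + 1) (pc, R', M) = Some (pc + 4, R'(scratch := ?p), M[?p := R s])"
    by (rule steps_trans)
  then have "reaches P (3 + 1) (pc, R', M) (pc + 4) R (A(a := (A a)(R i := R s)))"
    by (rule reachesI[OF _ represents_scratch[OF represents_write[OF rep assms(4) i]]])
  then show ?thesis
    by simp
qed

lemma compile_If_true_correct:
  assumes rep: "represents R' M R A" and "R a = R b"
    and code: "code_at P pc (compile stride pc (If_eq a b c c'))"
    and branch: "\<And>pc R' M. represents R' M R A \<Longrightarrow> code_at P pc (compile stride pc c) \<Longrightarrow>
      reaches P t (pc, R', M) (pc + code_size c) R1 A1"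
  shows "reaches P (t + 1) (pc, R', M) (pc + code_size (If_eq a b c c')) R1 A1"
proof -
  have "reaches P 1 (pc, R', M) (pc + code_size c' + 2) R A"
    using rep code assms(2) by (intro reaches_stepI) (auto simp: representsD(1))
  moreover have "code_at P (pc + code_size c' + 2) (compile stride (pc + code_size c' + 2) c)"
    using code by (simp add: ac_simps)
  ultimately have "reaches P (1 + t) (pc, R', M) (pc + code_size c' + 2 + code_size c) R1 A1"
    using reaches_trans branch by blast
  then show ?thesis
    by (simp add: ac_simps)
qed

lemma compile_If_false_correct:
  assumes rep: "represents R' M R A" and "R a \<noteq> R b"
    and code: "code_at P pc (compile stride pc (If_eq a b c c'))"
    and branch: "\<And>pc R' M. represents R' M R A \<Longrightarrow> code_at P pc (compile stride pc c') \<Longrightarrow>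
      reaches P t (pc, R', M) (pc + code_size c') R1 A1"
  shows "reaches P (t + 2) (pc, R', M) (pc + code_size (If_eq a b c c')) R1 A1"
proof -
  have "reaches P 1 (pc, R', M) (pc + 1) R A"
    using rep code assms(2) by (intro reaches_stepI) (auto simp: representsD(1))
  moreover have "code_at P (pc + 1) (compile stride (pc + 1) c')"
    using code by simp
  ultimately have "reaches P (1 + t) (pc, R', M) (pc + 1 + code_size c') R1 A1"
    using reaches_trans branch by blast
  moreover have "reaches P 1 (pc + 1 + code_size c', R2, M2) (pc + code_size c' + 2 + code_size c) R1 A1"
    if "represents R2 M2 R1 A1" for R2 M2
    using code that by (intro reaches_stepI) auto
  ultimately have "reaches P (1 + t + 1) (pc, R', M) (pc + code_size c' + 2 + code_size c) R1 A1"
    by (rule reaches_trans)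
  then show ?thesis
    by (simp add: ac_simps)
qed

lemma compile_While_iteration_correct:
  assumes rep: "represents R' M R A" and "R a < R b"
    and code: "code_at P pc (compile stride pc (While_less a b c))"
    and body: "\<And>pc R' M. represents R' M R A \<Longrightarrow> code_at P pc (compile stride pc c) \<Longrightarrow>
      reaches P t (pc, R', M) (pc + code_size c) R1 A1"
  shows "reaches P (t + 2) (pc, R', M) pc R1 A1"
proof -
  have "reaches P 1 (pc, R', M) (pc + 2) R A"
    using rep code assms(2) by (intro reaches_stepI) (auto simp: representsD(1))
  moreover have "code_at P (pc + 2) (compile stride (pc + 2) c)"
    using code by simp
  ultimately have "reaches P (1 + t) (pc, R', M) (pc + 2 + code_size c) R1 A1"
    using reaches_trans body by blast
  moreover have "reaches P 1 (pc + 2 + code_size c, R2, M2) pc R1 A1" if "represents R2 M2 R1 A1"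
    for R2 M2
    using code that by (intro reaches_stepI) auto
  ultimately have "reaches P (1 + t + 1) (pc, R', M) pc R1 A1"
    by (rule reaches_trans)
  then show ?thesis
    by simp
qed

lemma compile_While_exit_correct:
  assumes rep: "represents R' M R A" and "\<not> R a < R b"
    and code: "code_at P pc (compile stride pc (While_less a b c))"
  shows "reaches P 2 (pc, R', M) (pc + code_size (While_less a b c)) R A"
proof -
  have "reaches P 1 (pc, R', M) (pc + 1) R A"
    using rep code assms(2) by (intro reaches_stepI) (auto simp: representsD(1))
  moreover have "reaches P 1 (pc + 1, R2, M2) (pc + code_size c + 3) R A" if "represents R2 M2 R A"
    for R2 M2
    using code that by (intro reaches_stepI) auto
  ultimately have "reaches P (1 + 1) (pc, R', M) (pc + code_size c + 3) R A"
    by (rule reaches_trans)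
  then show ?thesis
    by (simp add: add.assoc numeral_2_eq_2)
qed

lemma compile_correct:
  assumes "exec c R A t R1 A1" "writes c \<subseteq> writable" "represents R' M R A"
    and "code_at P pc (compile stride pc c)"
  shows "reaches P t (pc, R', M) (pc + code_size c) R1 A1"
  using assms
proof (induction arbitrary: R' M pc rule: exec.induct)
  case (Skip R A)
  then show ?case
    by (auto simp: reaches_def)
next
  case (Set_reg k d R A)
  then show ?case
    by (intro reaches_stepI[OF _ represents_update]) auto
next
  case (Add_reg R a b d A)
  then show ?case
    by (intro reaches_stepI[OF _ represents_update]) (auto simp: representsD(1))
next
  case (Sub_reg R b a d A)
  have "(R a + 2 ^ w - R b) mod 2 ^ w = R a - R b"
    using Sub_reg.hyps by (metis diff_add_assoc2 less_imp_diff_less mod_add_self2 mod_less)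
  then show ?case
    using Sub_reg.prems by (intro reaches_stepI[OF _ represents_update]) (auto simp: representsD(1))
next
  case (Read R i a d A)
  then show ?case
    by (intro compile_Read_correct)
next
  case (Write R i a s A)
  then show ?case
    by (intro compile_Write_correct) simp_all
next
  case (Seq c R A t R1 A1 c' t' R2 A2)
  have "reaches P t (pc, R', M) (pc + code_size c) R1 A1"
    using Seq.prems by (intro Seq.IH(1)) auto
  moreover have "reaches P t' (pc + code_size c, R1', M1) (pc + code_size c + code_size c') R2 A2"
    if "represents R1' M1 R1 A1" for R1' M1
    using Seq.prems that by (intro Seq.IH(2)) auto
  ultimately have "reaches P (t + t') (pc, R', M) (pc + code_size c + code_size c') R2 A2"
    by (rule reaches_trans)
  then show ?case
    by (simp add: add.assoc)
next
  case (If_true R a b c A t R1 A1 c')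
  show ?case
    by (rule compile_If_true_correct[OF If_true.prems(2) If_true.hyps(1) If_true.prems(3)])
      (use If_true in auto)
next
  case (If_false R a b c' A t R1 A1 c)
  show ?case
    by (rule compile_If_false_correct[OF If_false.prems(2) If_false.hyps(1) If_false.prems(3)])
      (use If_false in auto)
next
  case (While_true R a b c A t R1 A1 t' R2 A2)
  have "reaches P (t + 2) (pc, R', M) pc R1 A1"
    by (rule compile_While_iteration_correct[OF While_true.prems(2) While_true.hyps(1)
          While_true.prems(3)]) (use While_true in auto)
  then have "reaches P (t + 2 + t') (pc, R', M) (pc + code_size (While_less a b c)) R2 A2"
    by (rule reaches_trans) (rule While_true.IH(2)[OF While_true.prems(1) _ While_true.prems(3)])
  then show ?case
    by (simp add: ac_simps)
next
  case (While_false R a b c A)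
  then show ?case
    by (intro compile_While_exit_correct)
qed

end


section \<open>The program\<close>

datatype register =
    Num_nodes | Num_edges | Root | Sink | Zero | One
  | Index | Tmp1 | Tmp2 | Head | Tail | Node | Pos | Pos_end | Edge | Source | Symbol | Count
  | Top | Out_end | Num_runs

datatype array =
    Out_offset | In_offset | Edge_source | Edge_symbol | Edge_target | In_edge
  | Degree | Path_count | Queue | Node_symbol | In_position | Stack | Output

instance register :: countable
  by countable_datatype

instance array :: countable
  by countable_datatype

type_synonym command = "(register, array) com"

abbreviation increment :: "register \<Rightarrow> command" where
  "increment r \<equiv> Add_reg r r One"

abbreviation decrement :: "register \<Rightarrow> command" where
  "decrement r \<equiv> Sub_reg r r One"

abbreviation copy_reg :: "register \<Rightarrow> register \<Rightarrow> command" where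
  "copy_reg d r \<equiv> Add_reg d r Zero"

definition init_counters_step :: command where
  "init_counters_step =
     Read Tmp1 Out_offset Index ;; Add_reg Tmp2 Index One ;; Read Tmp2 Out_offset Tmp2 ;;
     Sub_reg Tmp2 Tmp2 Tmp1 ;;
     Write Degree Index Tmp2 ;; Write Path_count Index Zero ;; increment Index"

definition init_counters :: command where
  "init_counters =
     Set_reg Index 0 ;; While_less Index Num_nodes init_counters_step ;; Write Path_count Sink One"

definition process_in_edge :: command where
  "process_in_edge =
     Read Edge In_edge Pos ;; Read Source Edge_source Edge ;;
     Read Tmp1 Path_count Source ;; Add_reg Tmp1 Tmp1 Count ;; Write Path_count Source Tmp1 ;;
     Read Tmp1 Degree Source ;; decrement Tmp1 ;; Write Degree Source Tmp1 ;;
     If_eq Tmp1 Zero (Write Queue Tail Source ;; increment Tail) Skip ;;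
     increment Pos"

definition process_node :: command where
  "process_node =
     Read Node Queue Head ;; increment Head ;; Read Count Path_count Node ;;
     Read Pos In_offset Node ;; Add_reg Pos_end Node One ;; Read Pos_end In_offset Pos_end ;;
     While_less Pos Pos_end process_in_edge"

definition count_paths :: command where
  "count_paths =
     Set_reg Head 0 ;; Write Queue Head Sink ;; Set_reg Tail 1 ;; While_less Head Tail process_node"

definition read_entry_symbol :: command where
  "read_entry_symbol =
     Read Source Edge_source Edge ;;
     If_eq Source Root (Read Symbol Edge_symbol Edge) (Read Symbol Node_symbol Source)"

definition node_symbols_step :: command where
  "node_symbols_step =
     decrement Index ;; Read Node Queue Index ;;
     If_eq Node Root Skip (
       Add_reg Pos Node One ;; Read Pos In_offset Pos ;; decrement Pos ;; Read Edge In_edge Pos ;;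
       read_entry_symbol ;; Write Node_symbol Node Symbol)"

definition node_symbols :: command where
  "node_symbols = copy_reg Index Num_nodes ;; While_less Zero Index node_symbols_step"

definition in_positions_step :: command where
  "in_positions_step = Read Edge In_edge Pos ;; Write In_position Edge Pos ;; increment Pos"

definition in_positions :: command where
  "in_positions = Set_reg Pos 0 ;; While_less Pos Num_edges in_positions_step"

definition push_edge :: command where
  "push_edge = decrement Index ;; Write Stack Top Index ;; increment Top"

definition push_out_edges :: command where
  "push_out_edges =
     Read Pos Out_offset Node ;; Add_reg Index Node One ;; Read Index Out_offset Index ;;
     While_less Pos Index push_edge"

definition append_run :: command where
  "append_run =
     Write Output Out_end Symbol ;; increment Out_end ;; Write Output Out_end Count ;;
     increment Out_end ;; increment Num_runs"

definition extend_run :: command where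
  "extend_run = Read Tmp2 Output Tmp1 ;; Add_reg Tmp2 Tmp2 Count ;; Write Output Tmp1 Tmp2"

definition emit_run :: command where
  "emit_run =
     If_eq Out_end Zero append_run (
       Sub_reg Tmp1 Out_end One ;; Sub_reg Tmp2 Tmp1 One ;; Read Tmp2 Output Tmp2 ;;
       If_eq Tmp2 Symbol extend_run append_run)"

definition visit_primary :: command where
  "visit_primary =
     If_eq Node Sink
       (Read Edge Out_offset Root ;; Read Symbol Edge_symbol Edge ;; Set_reg Count 1 ;; emit_run)
       push_out_edges"

definition visit_secondary :: command where
  "visit_secondary =
     decrement Pos ;; Read Edge In_edge Pos ;; Read Count Path_count Node ;;
     read_entry_symbol ;; emit_run"

definition visit_edge :: command where
  "visit_edge =
     decrement Top ;; Read Edge Stack Top ;; Read Node Edge_target Edge ;; Read Pos In_position Edge ;;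
     Read Tmp1 In_offset Node ;; If_eq Pos Tmp1 visit_primary visit_secondary"

definition output_runs :: command where
  "output_runs =
     Set_reg Top 0 ;; Set_reg Out_end 0 ;; Set_reg Num_runs 0 ;; copy_reg Node Root ;; push_out_edges ;;
     While_less Zero Top visit_edge"

definition rlbwt_main :: command where
  "rlbwt_main = init_counters ;; count_paths ;; node_symbols ;; in_positions ;; output_runs"


section \<open>Correctness of the path counts\<close>

definition stores :: "(nat \<Rightarrow> 'a) \<Rightarrow> 'a list \<Rightarrow> bool" where
  "stores a xs \<longleftrightarrow> (\<forall>i < length xs. a i = xs ! i)"

lemma stores_Nil [simp]: "stores a []"
  by (simp add: stores_def)

lemma stores_nth: "stores a xs \<Longrightarrow> i < length xs \<Longrightarrow> a i = xs ! i"
  by (simp add: stores_def)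

lemma stores_append1: "stores a (xs @ ys) \<Longrightarrow> stores a xs"
  by (auto simp: stores_def nth_append)

lemma stores_snoc: "stores a xs \<Longrightarrow> stores (a(length xs := x)) (xs @ [x])"
  by (auto simp: stores_def nth_append less_Suc_eq)

primrec array_len :: "nat \<Rightarrow> nat \<Rightarrow> array \<Rightarrow> nat" where
  "array_len N E Out_offset = Suc N"
| "array_len N E In_offset = Suc N"
| "array_len N E Edge_source = E"
| "array_len N E Edge_symbol = E"
| "array_len N E Edge_target = E"
| "array_len N E In_edge = E"
| "array_len N E Degree = 2 * E + 2"
| "array_len N E Path_count = 2 * E + 2"
| "array_len N E Queue = 2 * E + 2"
| "array_len N E Node_symbol = 2 * E + 2"
| "array_len N E In_position = 2 * E + 2"
| "array_len N E Stack = 2 * E + 2"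
| "array_len N E Output = 2 * E + 2"

locale rlbwt_algorithm = bwt_dag +
  fixes W :: nat
  assumes n_less: "n < W" and num_edges_less: "2 * E + 2 < W"
begin

sublocale array_machine W "array_len N E" .

definition input_loaded :: "register regs \<Rightarrow> array arrays \<Rightarrow> bool" where
  "input_loaded R A \<longleftrightarrow> R Num_nodes = N \<and> R Num_edges = E \<and> R Root = rt \<and> R Sink = sk \<and> R Zero = 0 \<and>
     R One = 1 \<and> (\<forall>k \<le> N. A Out_offset k = out_off k \<and> A In_offset k = in_off k) \<and>
     (\<forall>f < E. A Edge_source f = src f \<and> A Edge_symbol f = label_symbol f \<and> A Edge_target f = tgt f \<and>
        A In_edge f = ins f)"

lemma input_loaded_update [simp]:
  "d \<notin> {Num_nodes, Num_edges, Root, Sink, Zero, One} \<Longrightarrow> input_loaded (R(d := x)) A \<longleftrightarrow> input_loaded R A"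
  "a \<notin> {Out_offset, In_offset, Edge_source, Edge_symbol, Edge_target, In_edge} \<Longrightarrow>
     input_loaded R (A(a := g)) \<longleftrightarrow> input_loaded R A"
  by (auto simp: input_loaded_def)

lemma input_loadedD:
  assumes "input_loaded R A"
  shows "R Num_nodes = N" "R Num_edges = E" "R Root = rt" "R Sink = sk" "R Zero = 0" "R One = 1"
    "k \<le> N \<Longrightarrow> A Out_offset k = out_off k" "k \<le> N \<Longrightarrow> A In_offset k = in_off k"
    "f < E \<Longrightarrow> A Edge_source f = src f" "f < E \<Longrightarrow> A Edge_symbol f = label_symbol f"
    "f < E \<Longrightarrow> A Edge_target f = tgt f" "f < E \<Longrightarrow> A In_edge f = ins f"
  using assms by (auto simp: input_loaded_def)

lemma node_bounds:
  assumes "u < N"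
  shows "u < 2 * E + 2" "Suc u < W" "out_off (Suc u) < W" "in_off (Suc u) < W"
  using assms num_nodes_le num_edges_less out_off_le[of "Suc u"] in_off_le[of "Suc u"] by linarith+

definition counters :: "nat set \<Rightarrow> array arrays \<Rightarrow> bool" where
  "counters F A \<longleftrightarrow> (\<forall>u < N. A Degree u = card (pending_edges F u) \<and> A Path_count u = partial_count F u)"

lemma init_counters_step_correct:
  assumes loaded: "input_loaded R A" and index: "R Index < N"
    and initialised: "\<forall>u < R Index. A Degree u = out_off (Suc u) - out_off u \<and> A Path_count u = 0"
  shows "wp init_counters_step (\<lambda>R' A' t'. input_loaded R' A' \<and> R' Index = Suc (R Index) \<and>
    (\<forall>u < R' Index. A' Degree u = out_off (Suc u) - out_off u \<and> A' Path_count u = 0) \<and> t' = t + 19) R A t"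
  using assms node_bounds[OF index] out_off_mono[of "R Index"]
  by (simp add: init_counters_step_def input_loadedD[OF loaded] All_less_Suc)

lemma init_counters_correct:
  assumes "input_loaded R A"
  shows "wp init_counters (\<lambda>R' A' t'. input_loaded R' A' \<and> counters {} A' \<and> t' \<le> t + 30 * N + 10) R A t"
proof -
  define I where "I R' A' t' \<longleftrightarrow> input_loaded R' A' \<and> R' Index \<le> N \<and>
    (\<forall>u < R' Index. A' Degree u = out_off (Suc u) - out_off u \<and> A' Path_count u = 0) \<and>
    t' \<le> t + 1 + 30 * R' Index" for R' A' t'
  have "wp (While_less Index Num_nodes init_counters_step)
    (wp (Write Path_count Sink One)
      (\<lambda>R' A' t'. input_loaded R' A' \<and> counters {} A' \<and> t' \<le> t + 30 * N + 10))
    (R(Index := 0)) A (t + 1)"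
  proof (rule wp_While[where I = I])
    show "I (R(Index := 0)) A (t + 1)"
      using assms by (simp add: I_def)
    show "t' \<le> t + 1 + 30 * N" if "I R' A' t'" for R' A' t'
      using that unfolding I_def by (meson add_left_mono le_trans mult_le_mono2)
    show "wp init_counters_step I R' A' (t' + 2)" if "I R' A' t'" "R' Index < R' Num_nodes" for R' A' t'
      using that input_loadedD(1)[of R' A']
      by (intro wp_mono[OF init_counters_step_correct]) (auto simp: I_def)
    show "wp (Write Path_count Sink One)
        (\<lambda>R' A' t'. input_loaded R' A' \<and> counters {} A' \<and> t' \<le> t + 30 * N + 10) R' A' (t' + 2)"
      if "I R' A' t'" "\<not> R' Index < R' Num_nodes" for R' A' t'
    proof -
      have loaded: "input_loaded R' A'" and "R' Index = N"
        using that input_loadedD(1)[of R' A'] by (auto simp: I_def)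
      then show ?thesis
        using that(1) node_bounds[OF sk_less]
        by (simp add: I_def counters_def input_loadedD[OF loaded] card_pending_edges_empty
            partial_count_empty)
    qed
  qed
  then show ?thesis
    using num_edges_less by (simp add: init_counters_def)
qed

definition kahn_loaded :: "nat list \<Rightarrow> nat set \<Rightarrow> register regs \<Rightarrow> array arrays \<Rightarrow> bool" where
  "kahn_loaded q F R A \<longleftrightarrow>
     input_loaded R A \<and> kahn q F \<and> counters F A \<and> stores (A Queue) q \<and> R Tail = length q"

lemma partial_count_less: "u < N \<Longrightarrow> partial_count F u < W"
  using partial_count_le num_paths_le n_less by (meson le_less_trans)

lemma counters_insert:
  assumes "counters F A" "f < E" "f \<notin> F" "u = src f"
  shows "counters (insert f F) (A(Path_count := (A Path_count)(u := A Path_count u + num_paths (tgt f)),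
    Degree := (A Degree)(u := A Degree u - 1)))"
  using assms src_less[of f] by (simp add: counters_def card_pending_edges_insert partial_count_insert)

lemma counters_source:
  assumes "counters F A" "f < E" "f \<notin> F" "u = src f"
  shows "0 < A Degree u" "A Degree u < W" "A Path_count u + num_paths (tgt f) < W"
    "A Degree u - 1 = 0 \<longleftrightarrow> pending_edges (insert f F) u = {}"
proof -
  have u: "u < N"
    using src_less assms(2,4) by simp
  have degree: "A Degree u = card (pending_edges F u)"
    using assms(1) u by (simp add: counters_def)
  show "0 < A Degree u" "A Degree u < W"
    using card_pending_edges_pos[OF assms(2,3), folded assms(4)] card_pending_edges_le[of F u]
      num_edges_less
    by (simp_all add: degree)
  show "A Path_count u + num_paths (tgt f) < W"
    using partial_count_less[OF u, of "insert f F"] partial_count_insert[OF assms(2,3), of u] assms(1,4) u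
    by (simp add: counters_def)
  have "A Degree u - 1 = card (pending_edges (insert f F) u)"
    using card_pending_edges_insert[OF assms(2,3), of u] degree assms(4) by simp
  then show "A Degree u - 1 = 0 \<longleftrightarrow> pending_edges (insert f F) u = {}"
    using finite_pending_edges by simp
qed

lemma process_in_edge_correct:
  assumes kahn: "kahn_loaded q F R A"
    and pos: "R Pos < E" "ins (R Pos) = f"
    and f: "f < E" "f \<notin> F" "tgt f \<in> set q" "R Count = num_paths (tgt f)"
  shows "wp process_in_edge (\<lambda>R' A' t'. (\<exists>q'. kahn_loaded (q @ q') (insert f F) R' A') \<and>
    R' Pos = Suc (R Pos) \<and> R' Pos_end = R Pos_end \<and> R' Count = R Count \<and> R' Head = R Head \<and>
    t' \<le> t + 45) R A t"
proof -
  have loaded: "input_loaded R A" and counters: "counters F A"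
    and queue: "stores (A Queue) q" "R Tail = length q"
    and q: "kahn q F"
    using kahn by (auto simp: kahn_loaded_def)
  define u where "u = src f"
  note kahn' = kahn_insert[OF q f(1-3), folded u_def]
  note counters' = counters_insert[OF counters f(1,2) u_def]
  note bounds = counters_source[OF counters f(1,2) u_def]
  have in_range: "length q < 2 * E + 2" "Suc (length q) < W" "Suc (R Pos) < W" "u < 2 * E + 2"
    using kahn_length_le[OF q] node_bounds[of u] src_less[OF f(1)] num_nodes_le num_edges_less pos(1)
    by (auto simp: u_def)
  note simps = process_in_edge_def input_loadedD[OF loaded] queue(2) pos f u_def[symmetric]
  show ?thesis
  proof (cases "A Degree u - 1 = 0")
    case True
    then have "A Degree u = Suc 0" "kahn (q @ [u]) (insert f F)"
      using bounds(1,4) kahn' by simp_all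
    then show ?thesis
      using counters' stores_snoc[OF queue(1), of u] loaded bounds(3) in_range
      by (simp add: simps kahn_loaded_def) (auto intro!: exI[of _ "[u]"] simp: counters_def)
  next
    case False
    then have "kahn q (insert f F)"
      using kahn' bounds(4) by simp
    then show ?thesis
      using False counters' queue(1) loaded bounds(2,3) in_range
      by (simp add: simps kahn_loaded_def exI[of _ "[]"] counters_def)
  qed
qed

lemma process_in_edges_correct:
  assumes kahn: "kahn_loaded q (edges_into S) R A" and v: "v \<in> set q" "v \<notin> S"
    and regs: "R Count = num_paths v" "R Pos = in_off v" "R Pos_end = in_off (Suc v)"
  shows "wp (While_less Pos Pos_end process_in_edge)
    (\<lambda>R' A' t'. (\<exists>q'. kahn_loaded (q @ q') (edges_into (insert v S)) R' A') \<and> R' Head = R Head \<and>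
      t' \<le> t + 2 + 50 * (in_off (Suc v) - in_off v)) R A t"
proof -
  define processed where "processed p = edges_into S \<union> ins ` {in_off v..<p}" for p
  define I where "I R' A' t' \<longleftrightarrow> (\<exists>q'. kahn_loaded (q @ q') (processed (R' Pos)) R' A') \<and>
      R' Count = num_paths v \<and> R' Pos_end = in_off (Suc v) \<and> in_off v \<le> R' Pos \<and> R' Pos \<le> in_off (Suc v) \<and>
      R' Head = R Head \<and> t' \<le> t + 50 * (R' Pos - in_off v)" for R' A' t'
  show ?thesis
  proof (rule wp_While[where I = I])
    have "\<exists>q'. kahn_loaded (q @ q') (processed (R Pos)) R A"
      using kahn regs(2) by (intro exI[of _ "[]"]) (simp add: processed_def)
    then show "I R A t"
      using regs in_off_mono[of v] by (simp add: I_def)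
    show "t' \<le> t + 50 * (in_off (Suc v) - in_off v)" if "I R' A' t'" for R' A' t'
      using that unfolding I_def by (meson add_left_mono diff_le_mono le_trans mult_le_mono2)
  next
    fix R' A' t' assume inv: "I R' A' t'" "R' Pos < R' Pos_end"
    then obtain q' where kahn': "kahn_loaded (q @ q') (processed (R' Pos)) R' A'"
      and pos: "in_off v \<le> R' Pos" "R' Pos < in_off (Suc v)" "R' Count = num_paths v"
      by (auto simp: I_def)
    then have p: "R' Pos < E" "tgt (ins (R' Pos)) = v" "ins (R' Pos) < E"
      using in_off_le[of "Suc v"] tgt_ins_eq_iff[of "R' Pos" v] ins_less by auto
    have "ins (R' Pos) \<notin> processed (R' Pos)"
      using p v(2) by (auto simp: processed_def edges_into_def ins_eq_iff)
    moreover have "insert (ins (R' Pos)) (processed (R' Pos)) = processed (Suc (R' Pos))"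
      using pos(1) by (auto simp: processed_def atLeastLessThanSuc)
    ultimately show "wp process_in_edge I R' A' (t' + 2)"
      using inv(1) p v(1) pos
      by (intro wp_mono[OF process_in_edge_correct[OF kahn' p(1) refl p(3)]])
        (auto simp: I_def Suc_diff_le)
  next
    fix R' A' t' assume inv: "I R' A' t'" "\<not> R' Pos < R' Pos_end"
    then have "R' Pos = in_off (Suc v)"
      by (simp add: I_def)
    then show "(\<exists>q'. kahn_loaded (q @ q') (edges_into (insert v S)) R' A') \<and> R' Head = R Head \<and>
        t' + 2 \<le> t + 2 + 50 * (in_off (Suc v) - in_off v)"
      using inv(1) by (simp add: I_def processed_def edges_into_insert)
  qed
qed

lemma process_node_correct:
  assumes kahn: "kahn_loaded q (edges_into S) R A" and h: "R Head < length q" "q ! R Head = v"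
    and v: "v \<notin> S"
  shows "wp process_node
    (\<lambda>R' A' t'. (\<exists>q'. kahn_loaded (q @ q') (edges_into (insert v S)) R' A') \<and> R' Head = Suc (R Head) \<and>
      t' \<le> t + 20 + 50 * (in_off (Suc v) - in_off v)) R A t"
proof -
  have loaded: "input_loaded R A" and counters: "counters (edges_into S) A"
    and queue: "stores (A Queue) q"
    and q: "kahn q (edges_into S)"
    using kahn by (auto simp: kahn_loaded_def)
  have "v \<in> set q"
    using h nth_mem by blast
  then have "v < N" "pending_edges (edges_into S) v = {}"
    using kahnD(2)[OF q] by auto
  then have "A Path_count v = num_paths v" "v < N"
    using counters partial_count_no_pending by (auto simp: counters_def)
  moreover have "A Queue (R Head) = v" "R Head < 2 * E + 2" "Suc (R Head) < W"
    using stores_nth[OF queue h(1)] h kahn_length_le[OF q] num_nodes_le num_edges_less by auto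
  moreover have "wp (While_less Pos Pos_end process_in_edge)
      (\<lambda>R' A' t'. (\<exists>q'. kahn_loaded (q @ q') (edges_into (insert v S)) R' A') \<and> R' Head = Suc (R Head) \<and>
        t' \<le> t + 20 + 50 * (in_off (Suc v) - in_off v)) R' A (18 + t)"
    if "R' = R(Node := v, Head := Suc (R Head), Count := num_paths v, Pos := in_off v,
      Pos_end := in_off (Suc v))" for R'
  proof (rule wp_mono[OF process_in_edges_correct[OF _ \<open>v \<in> set q\<close> v]])
    show "kahn_loaded q (edges_into S) R' A"
      using kahn by (simp add: kahn_loaded_def that)
  qed (auto simp: that)
  ultimately show ?thesis
    using node_bounds[of v] by (simp add: process_node_def input_loadedD[OF loaded])
qed

definition process_nodes_invariant :: "nat \<Rightarrow> register regs \<Rightarrow> array arrays \<Rightarrow> nat \<Rightarrow> bool" where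
  "process_nodes_invariant t0 R A t \<longleftrightarrow> (\<exists>q. kahn_loaded q (edges_into (set (take (R Head) q))) R A \<and>
     R Head \<le> length q \<and> t \<le> t0 + 50 * R Head + 50 * card (edges_into (set (take (R Head) q))))"

lemma process_nodes_invariant_step:
  assumes "process_nodes_invariant t0 R A t" "R Head < R Tail"
  shows "wp process_node (process_nodes_invariant t0) R A (t + 2)"
proof -
  obtain q where kahn: "kahn_loaded q (edges_into (set (take (R Head) q))) R A"
    and bound: "t \<le> t0 + 50 * R Head + 50 * card (edges_into (set (take (R Head) q)))"
    using assms(1) by (auto simp: process_nodes_invariant_def)
  define S v where "S = set (take (R Head) q)" and "v = q ! R Head"
  have head: "R Head < length q" and "distinct q"
    using kahn assms(2) kahnD(1) by (auto simp: kahn_loaded_def)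
  then have new: "v \<notin> S"
    by (auto simp: S_def v_def distinct_conv_nth in_set_conv_nth)
  show ?thesis
  proof (rule wp_mono[OF process_node_correct[OF kahn head v_def[symmetric] new[unfolded S_def]]])
    fix R' A' t'
    assume post: "(\<exists>q'. kahn_loaded (q @ q') (edges_into (insert v (set (take (R Head) q)))) R' A') \<and>
      R' Head = Suc (R Head) \<and> t' \<le> t + 2 + 20 + 50 * (in_off (Suc v) - in_off v)"
    then obtain q' where "kahn_loaded (q @ q') (edges_into (insert v S)) R' A'"
      by (auto simp: S_def)
    moreover have "insert v S = set (take (R' Head) (q @ q'))"
      using post head by (simp add: S_def v_def take_Suc_conv_app_nth)
    moreover have "t' \<le> t0 + 50 * Suc (R Head) + 50 * card (edges_into (insert v S))"
      using post bound unfolding card_edges_into_insert[OF new] by (simp add: S_def)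
    ultimately show "process_nodes_invariant t0 R' A' t'"
      using post head unfolding process_nodes_invariant_def by (intro exI[of _ "q @ q'"]) simp
  qed
qed

lemma process_nodes_correct:
  assumes "kahn_loaded [sk] {} R A" "R Head = 0"
  shows "wp (While_less Head Tail process_node)
    (\<lambda>R' A' t'. (\<exists>q. kahn_loaded q (edges_into (set q)) R' A') \<and> t' \<le> t + 2 + 50 * N + 50 * E) R A t"
proof (rule wp_While[where I = "process_nodes_invariant t"])
  show "process_nodes_invariant t R A t"
    using assms by (auto simp: process_nodes_invariant_def)
next
  fix R A t' assume "process_nodes_invariant t R A t'"
  then obtain q where kahn: "kahn_loaded q (edges_into (set (take (R Head) q))) R A"
    and bound: "R Head \<le> length q" "t' \<le> t + 50 * R Head + 50 * card (edges_into (set (take (R Head) q)))"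
    by (auto simp: process_nodes_invariant_def)
  then show le: "t' \<le> t + 50 * N + 50 * E"
    using kahn_length_le[of q] card_edges_into_le[of "set (take (R Head) q)"]
    by (fastforce simp: kahn_loaded_def)
  assume "\<not> R Head < R Tail"
  then have "R Head = length q"
    using kahn bound(1) by (simp add: kahn_loaded_def)
  then show "(\<exists>q. kahn_loaded q (edges_into (set q)) R A) \<and> t' + 2 \<le> t + 2 + 50 * N + 50 * E"
    using kahn le by auto
qed (rule process_nodes_invariant_step)

definition path_counts_loaded :: "array arrays \<Rightarrow> bool" where
  "path_counts_loaded A \<longleftrightarrow> (\<forall>u < N. A Path_count u = num_paths u)"

definition queue_loaded :: "nat list \<Rightarrow> array arrays \<Rightarrow> bool" where
  "queue_loaded q A \<longleftrightarrow> distinct q \<and> set q = {..<N} \<and> targets_first q \<and> stores (A Queue) q"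

lemma kahn_loaded_complete:
  assumes "kahn_loaded q (edges_into (set q)) R A"
  shows "queue_loaded q A" "path_counts_loaded A"
proof -
  have q: "kahn q (edges_into (set q))" "counters (edges_into (set q)) A" "stores (A Queue) q"
    using assms by (simp_all add: kahn_loaded_def)
  have set_q: "set q = {..<N}"
    by (rule kahn_complete[OF q(1)]) (simp add: edges_into_def)
  then show "queue_loaded q A"
    using kahnD(1,5)[OF q(1)] q(3) by (simp add: queue_loaded_def)
  have "pending_edges (edges_into (set q)) u = {}" if "u < N" for u
    using kahnD(2)[OF q(1)] set_q that by blast
  then show "path_counts_loaded A"
    using q(2) partial_count_no_pending by (simp add: path_counts_loaded_def counters_def)
qed

lemma count_paths_correct:
  assumes loaded: "input_loaded R A" and counters: "counters {} A"
  shows "wp count_paths (\<lambda>R' A' t'. input_loaded R' A' \<and> (\<exists>q. queue_loaded q A') \<and> path_counts_loaded A' \<and>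
    t' \<le> t + 10 + 50 * N + 50 * E) R A t"
proof -
  let ?R = "R(Head := 0, Tail := 1)" and ?A = "A(Queue := (A Queue)(0 := sk))"
  have "kahn_loaded [sk] {} ?R ?A"
    using assms kahn_init by (simp add: kahn_loaded_def stores_def counters_def)
  then have "wp (While_less Head Tail process_node) (\<lambda>R' A' t'. input_loaded R' A' \<and>
    (\<exists>q. queue_loaded q A') \<and> path_counts_loaded A' \<and> t' \<le> t + 10 + 50 * N + 50 * E) ?R ?A (6 + t)"
    by (rule wp_mono[OF process_nodes_correct]) (use kahn_loaded_complete in \<open>auto simp: kahn_loaded_def\<close>)
  then show ?thesis
    using num_edges_less by (simp add: count_paths_def input_loadedD[OF loaded])
qed

end


section \<open>Correctness of the tables\<close>

context rlbwt_algorithm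
begin

definition node_symbols_loaded :: "array arrays \<Rightarrow> bool" where
  "node_symbols_loaded A \<longleftrightarrow> (\<forall>u < N. u \<noteq> rt \<longrightarrow> A Node_symbol u = node_symbol u)"

lemma queue_loaded_update [simp]: "a \<noteq> Queue \<Longrightarrow> queue_loaded q (A(a := g)) \<longleftrightarrow> queue_loaded q A"
  by (simp add: queue_loaded_def)

lemma path_counts_loaded_update [simp]:
  "a \<noteq> Path_count \<Longrightarrow> path_counts_loaded (A(a := g)) \<longleftrightarrow> path_counts_loaded A"
  by (simp add: path_counts_loaded_def)

lemma node_symbols_loaded_update [simp]:
  "a \<noteq> Node_symbol \<Longrightarrow> node_symbols_loaded (A(a := g)) \<longleftrightarrow> node_symbols_loaded A"
  by (simp add: node_symbols_loaded_def)

lemma read_entry_symbol_correct: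
  assumes loaded: "input_loaded R A" and f: "R Edge = f" "f < E"
    and symbol: "src f \<noteq> rt \<Longrightarrow> A Node_symbol (src f) = node_symbol (src f)"
  shows "wp read_entry_symbol
    (\<lambda>R' A' t'. R' = R(Source := src f, Symbol := entry_symbol f) \<and> A' = A \<and> t' \<le> t + 10) R A t"
  using f symbol node_bounds[OF src_less[OF f(2)]]
  by (simp add: read_entry_symbol_def input_loadedD[OF loaded] entry_symbol_eq)

definition node_symbols_state :: "nat list \<Rightarrow> register regs \<Rightarrow> array arrays \<Rightarrow> bool" where
  "node_symbols_state q R A \<longleftrightarrow> input_loaded R A \<and> queue_loaded q A \<and> path_counts_loaded A \<and> R Index \<le> N \<and>
     (\<forall>j < N. R Index \<le> j \<and> q ! j \<noteq> rt \<longrightarrow> A Node_symbol (q ! j) = node_symbol (q ! j))"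

lemma node_symbols_state_decrement:
  assumes state: "node_symbols_state q R A" and i: "R Index = Suc i"
    and loaded: "input_loaded R' (A(Node_symbol := g))" "R' Index = i"
    and g: "q ! i \<noteq> rt \<Longrightarrow> g (q ! i) = node_symbol (q ! i)" "\<And>u. u \<noteq> q ! i \<Longrightarrow> g u = A Node_symbol u"
  shows "node_symbols_state q R' (A(Node_symbol := g))"
proof -
  have "g (q ! j) = node_symbol (q ! j)" if "j < N" "i \<le> j" "q ! j \<noteq> rt" for j
    using state i g that by (cases "q ! j = q ! i"; cases "j = i") (auto simp: node_symbols_state_def)
  then show ?thesis
    using state i loaded by (simp add: node_symbols_state_def)
qed

lemma node_symbols_state_source:
  assumes state: "node_symbols_state q R A" and i: "R Index = Suc i"
    and f: "f < E" "tgt f = q ! i" "src f \<noteq> rt"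
  shows "A Node_symbol (src f) = node_symbol (src f)"
proof -
  have q: "distinct q" "set q = {..<N}" "targets_first q" and len: "length q = N"
    using state distinct_card[of q] by (auto simp: node_symbols_state_def queue_loaded_def)
  obtain j where "i < j" "j < length q" "q ! j = src f"
    using targets_first_source_later[OF q(3,1) _ f(1), of i] state i q(2) len f(2) src_less[OF f(1)]
    by (auto simp: node_symbols_state_def)
  then show ?thesis
    using state i len f(3) by (auto simp: node_symbols_state_def)
qed

lemma assign_node_symbol_correct:
  assumes state: "node_symbols_state q R A" and i: "R Index = Suc i"
    and regs: "input_loaded R' A" "R' Index = i" "R' Node = q ! i" "R' Edge = f"
    and f: "f < E" "tgt f = q ! i" "entry_symbol f = node_symbol (q ! i)"
  shows "wp (read_entry_symbol ;; Write Node_symbol Node Symbol)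
    (\<lambda>R' A' t'. node_symbols_state q R' A' \<and> R' Index = i \<and> t' \<le> t + 15) R' A t"
proof (rule wp_SeqI[OF read_entry_symbol_correct[OF regs(1,4) f(1)]])
  show "A Node_symbol (src f) = node_symbol (src f)" if "src f \<noteq> rt"
    by (rule node_symbols_state_source[OF state i f(1,2) that])
  fix R2 A2 t2
  assume "R2 = R'(Source := src f, Symbol := entry_symbol f) \<and> A2 = A \<and> t2 \<le> t + 10"
  then show "wp (Write Node_symbol Node Symbol)
      (\<lambda>R' A' t'. node_symbols_state q R' A' \<and> R' Index = i \<and> t' \<le> t + 15) R2 A2 t2"
    using node_symbols_state_decrement[OF state i, of R2 "(A Node_symbol)(q ! i := node_symbol (q ! i))"]
      regs f(3) node_bounds[of "q ! i"] tgt_less[OF f(1)] f(2) by simp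
qed

lemma node_symbols_step_correct:
  assumes state: "node_symbols_state q R A" and i: "R Index = Suc i"
  shows "wp node_symbols_step (\<lambda>R' A' t'. node_symbols_state q R' A' \<and> R' Index = i \<and> t' \<le> t + 35) R A t"
proof -
  have loaded: "input_loaded R A" and queue: "stores (A Queue) q" "set q = {..<N}" "length q = N"
    and "i < N"
    using state i distinct_card[of q] by (auto simp: node_symbols_state_def queue_loaded_def)
  define v where "v = q ! i"
  have v: "A Queue i = v" "v < N" "Suc v \<le> N"
    using stores_nth[OF queue(1), of i] queue(2,3) \<open>i < N\<close> nth_mem[of i q] by (auto simp: v_def Suc_le_eq)
  note simps = node_symbols_step_def input_loadedD[OF loaded] i v
  show ?thesis
  proof (cases "v = rt")
    case True
    have "node_symbols_state q (R(Index := i, Node := rt)) A"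
      using node_symbols_state_decrement[OF state i, of _ "A Node_symbol"] loaded True
      by (simp add: v_def)
    then show ?thesis
      using True node_bounds[OF \<open>i < N\<close>] by (simp add: simps)
  next
    case False
    define p where "p = in_off (Suc v) - 1"
    note last = last_in_edge[OF v(2) False, folded p_def]
    let ?R = "R(Index := i, Node := v, Pos := Suc v, Pos := Suc p, Pos := p, Edge := ins p)"
    have "wp (read_entry_symbol ;; Write Node_symbol Node Symbol)
        (\<lambda>R' A' t'. node_symbols_state q R' A' \<and> R' Index = i \<and> t' \<le> t + 35) ?R A (17 + t)"
      using loaded last ins_less[OF last(2)] node_symbol_eq[OF v(2) False, folded p_def]
      by (intro wp_mono[OF assign_node_symbol_correct[OF state i, of ?R "ins p"]]) (auto simp: v_def)
    then show ?thesis
      using False node_bounds[OF \<open>i < N\<close>] node_bounds[OF v(2)] last(2) num_edges_less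
      by (simp add: simps last(1)[symmetric])
  qed
qed

lemma node_symbols_correct:
  assumes loaded: "input_loaded R A" and queue: "queue_loaded q A" and counts: "path_counts_loaded A"
  shows "wp node_symbols (\<lambda>R' A' t'. input_loaded R' A' \<and> path_counts_loaded A' \<and> node_symbols_loaded A' \<and>
    t' \<le> t + 10 + 50 * N) R A t"
proof -
  define I where "I R' A' t' \<longleftrightarrow> node_symbols_state q R' A' \<and> t' + 50 * R' Index \<le> t + 1 + 50 * N"
    for R' A' t'
  have "wp (While_less Zero Index node_symbols_step) (\<lambda>R' A' t'. input_loaded R' A' \<and>
    path_counts_loaded A' \<and> node_symbols_loaded A' \<and> t' \<le> t + 10 + 50 * N) (R(Index := N)) A (t + 1)"
  proof (rule wp_While[where I = I])
    show "I (R(Index := N)) A (t + 1)"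
      using assms by (simp add: I_def node_symbols_state_def)
    show "t' \<le> t + 1 + 50 * N" if "I R' A' t'" for R' A' t'
      using that by (simp add: I_def)
  next
    fix R' A' t' assume inv: "I R' A' t'" "R' Zero < R' Index"
    then obtain i where i: "R' Index = Suc i"
      by (cases "R' Index") auto
    moreover have "node_symbols_state q R' A'"
      using inv(1) by (simp add: I_def)
    ultimately show "wp node_symbols_step I R' A' (t' + 2)"
      using inv(1) by (intro wp_mono[OF node_symbols_step_correct]) (auto simp: I_def)
  next
    fix R' A' t' assume inv: "I R' A' t'" "\<not> R' Zero < R' Index"
    then have state: "node_symbols_state q R' A'" and index: "R' Index = 0"
      using input_loadedD(5)[of R' A'] by (auto simp: I_def node_symbols_state_def)
    have "A' Node_symbol u = node_symbol u" if "u < N" "u \<noteq> rt" for u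
    proof -
      have "u \<in> set q" "length q = N"
        using state that distinct_card[of q] by (auto simp: node_symbols_state_def queue_loaded_def)
      then show ?thesis
        using state index that by (auto simp: node_symbols_state_def in_set_conv_nth)
    qed
    then show "input_loaded R' A' \<and> path_counts_loaded A' \<and> node_symbols_loaded A' \<and>
      t' + 2 \<le> t + 10 + 50 * N"
      using inv(1) state by (simp add: I_def node_symbols_state_def node_symbols_loaded_def)
  qed
  then show ?thesis
    using node_bounds[OF rt_less] num_nodes_le num_edges_less
    by (simp add: node_symbols_def input_loadedD[OF loaded])
qed

definition tables_loaded :: "array arrays \<Rightarrow> bool" where
  "tables_loaded A \<longleftrightarrow> path_counts_loaded A \<and> node_symbols_loaded A \<and> (\<forall>p < E. A In_position (ins p) = p)"

lemma tables_loaded_update [simp]: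
  "a \<notin> {Path_count, Node_symbol, In_position} \<Longrightarrow> tables_loaded (A(a := g)) \<longleftrightarrow> tables_loaded A"
  by (auto simp: tables_loaded_def)

lemma tables_loadedD:
  assumes "tables_loaded A"
  shows "u < N \<Longrightarrow> A Path_count u = num_paths u" "u < N \<Longrightarrow> u \<noteq> rt \<Longrightarrow> A Node_symbol u = node_symbol u"
    "p < E \<Longrightarrow> A In_position (ins p) = p"
  using assms by (auto simp: tables_loaded_def path_counts_loaded_def node_symbols_loaded_def)

lemma in_positions_correct:
  assumes loaded: "input_loaded R A" and tables: "path_counts_loaded A" "node_symbols_loaded A"
  shows "wp in_positions (\<lambda>R' A' t'. input_loaded R' A' \<and> tables_loaded A' \<and> t' \<le> t + 10 + 20 * E) R A t"
proof -
  define I where "I R' A' t' \<longleftrightarrow> input_loaded R' A' \<and> path_counts_loaded A' \<and> node_symbols_loaded A' \<and>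
    R' Pos \<le> E \<and> (\<forall>p < R' Pos. A' In_position (ins p) = p) \<and> t' \<le> t + 1 + 20 * R' Pos" for R' A' t'
  have "wp (While_less Pos Num_edges in_positions_step)
    (\<lambda>R' A' t'. input_loaded R' A' \<and> tables_loaded A' \<and> t' \<le> t + 10 + 20 * E) (R(Pos := 0)) A (t + 1)"
  proof (rule wp_While[where I = I])
    show "I (R(Pos := 0)) A (t + 1)"
      using assms by (simp add: I_def)
    show "t' \<le> t + 1 + 20 * E" if "I R' A' t'" for R' A' t'
      using that unfolding I_def by (meson add_left_mono le_trans mult_le_mono2)
  next
    fix R' A' t' assume inv: "I R' A' t'" "R' Pos < R' Num_edges"
    then have loaded: "input_loaded R' A'"
      by (simp add: I_def)
    then have p: "R' Pos < E"
      using inv(2) by (simp add: input_loadedD)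
    have "ins p \<noteq> ins (R' Pos)" if "p < R' Pos" for p
      using ins_eq_iff[of p "R' Pos"] p that by simp
    then show "wp in_positions_step I R' A' (t' + 2)"
      using inv(1) p ins_less[OF p] num_edges_less
      by (simp add: in_positions_step_def input_loadedD[OF loaded] I_def less_Suc_eq)
  next
    fix R' A' t' assume "I R' A' t'" "\<not> R' Pos < R' Num_edges"
    then show "input_loaded R' A' \<and> tables_loaded A' \<and> t' + 2 \<le> t + 10 + 20 * E"
      using input_loadedD(2)[of R' A'] by (auto simp: I_def tables_loaded_def)
  qed
  then show ?thesis
    using num_edges_less by (simp add: in_positions_def)
qed

end


section \<open>Correctness of the traversal\<close>

definition flat_runs :: "(nat \<times> nat) list \<Rightarrow> nat list" where
  "flat_runs ps = concat (map (\<lambda>(c, k). [c, k]) ps)"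

lemma flat_runs_Nil [simp]: "flat_runs [] = []"
  by (simp add: flat_runs_def)

lemma flat_runs_snoc [simp]: "flat_runs (ps @ [(c, k)]) = (flat_runs ps @ [c]) @ [k]"
  by (simp add: flat_runs_def)

lemma length_flat_runs [simp]: "length (flat_runs ps) = 2 * length ps"
  by (induction ps) (auto simp: flat_runs_def)

context rlbwt_algorithm
begin

definition runs_loaded :: "(nat \<times> nat) list \<Rightarrow> register regs \<Rightarrow> array arrays \<Rightarrow> bool" where
  "runs_loaded ps R A \<longleftrightarrow>
     R Out_end = 2 * length ps \<and> R Num_runs = length ps \<and> stores (A Output) (flat_runs ps)"

lemma runs_loaded_update [simp]:
  "d \<notin> {Out_end, Num_runs} \<Longrightarrow> runs_loaded ps (R(d := x)) A \<longleftrightarrow> runs_loaded ps R A"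
  "a \<noteq> Output \<Longrightarrow> runs_loaded ps R (A(a := g)) \<longleftrightarrow> runs_loaded ps R A"
  by (auto simp: runs_loaded_def)

definition stack_loaded :: "nat list \<Rightarrow> register regs \<Rightarrow> array arrays \<Rightarrow> bool" where
  "stack_loaded s R A \<longleftrightarrow>
     input_loaded R A \<and> tables_loaded A \<and> R Top = length s \<and> stores (A Stack) (rev s)"

lemma stack_loaded_update [simp]:
  "d \<notin> {Num_nodes, Num_edges, Root, Sink, Zero, One, Top} \<Longrightarrow> stack_loaded s (R(d := x)) A \<longleftrightarrow>
    stack_loaded s R A"
  "stack_loaded s R (A(Output := g)) \<longleftrightarrow> stack_loaded s R A"
  by (auto simp: stack_loaded_def)

lemma stack_loadedD:
  assumes "stack_loaded s R A"
  shows "input_loaded R A" "tables_loaded A" "R Top = length s" "stores (A Stack) (rev s)"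
  using assms by (auto simp: stack_loaded_def)

lemma push_edge_correct:
  assumes "stack_loaded s R A" "runs_loaded ps R A" "R Index = Suc i" "i < E" "length s < E"
  shows "wp push_edge (\<lambda>R' A' t'. stack_loaded (i # s) R' A' \<and> runs_loaded ps R' A' \<and> R' Index = i \<and>
    R' Pos = R Pos \<and> t' = t + 6) R A t"
  using assms stores_snoc[of "A Stack" "rev s" i] num_edges_less
  by (simp add: push_edge_def stack_loaded_def input_loadedD[OF stack_loadedD(1)[OF assms(1)]])

lemma push_out_edges_correct:
  assumes stack: "stack_loaded s R A" and runs: "runs_loaded ps R A" and v: "R Node = v" "v < N"
    and room: "length (out_edges v) + length s \<le> E"
  shows "wp push_out_edges (\<lambda>R' A' t'. stack_loaded (out_edges v @ s) R' A' \<and> runs_loaded ps R' A' \<and>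
    t' \<le> t + 20 + 20 * length (out_edges v)) R A t"
proof -
  define a b where "a = out_off v" and "b = out_off (Suc v)"
  have ab: "a \<le> b" "b \<le> E" "out_edges v = [a..<b]"
    using out_off_mono[of v] out_off_le[of "Suc v"] by (simp_all add: a_def b_def out_edges_def)
  define I where "I R' A' t' \<longleftrightarrow> stack_loaded ([R' Index..<b] @ s) R' A' \<and> runs_loaded ps R' A' \<and>
    R' Pos = a \<and> a \<le> R' Index \<and> R' Index \<le> b \<and> t' + 20 * R' Index \<le> t + 9 + 20 * b" for R' A' t'
  have "wp (While_less Pos Index push_edge) (\<lambda>R' A' t'. stack_loaded ([a..<b] @ s) R' A' \<and>
    runs_loaded ps R' A' \<and> t' \<le> t + 20 + 20 * length [a..<b]) (R(Pos := a, Index := b)) A (9 + t)"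
  proof (rule wp_While[where I = I])
    show "I (R(Pos := a, Index := b)) A (9 + t)"
      using stack runs ab by (simp add: I_def)
    show "t' \<le> t + 9 + 20 * b" if "I R' A' t'" for R' A' t'
      using that by (simp add: I_def)
  next
    fix R' A' t' assume inv: "I R' A' t'" "R' Pos < R' Index"
    then obtain i where i: "R' Index = Suc i" "a \<le> i" "i < b"
      by (cases "R' Index") (auto simp: I_def)
    moreover have "length ([Suc i..<b] @ s) < E"
      using room i ab by simp
    ultimately show "wp push_edge I R' A' (t' + 2)"
      using inv(1) ab(2)
      by (intro wp_mono[OF push_edge_correct[of "[Suc i..<b] @ s" _ _ ps i]])
        (auto simp: I_def upt_conv_Cons)
  next
    fix R' A' t' assume inv: "I R' A' t'" "\<not> R' Pos < R' Index"
    then have "R' Index = a"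
      by (simp add: I_def)
    then show "stack_loaded ([a..<b] @ s) R' A' \<and> runs_loaded ps R' A' \<and>
      t' + 2 \<le> t + 20 + 20 * length [a..<b]"
      using inv(1) ab(1) by (auto simp: I_def)
  qed
  then show ?thesis
    using v node_bounds[OF v(2)]
    by (simp add: push_out_edges_def input_loadedD[OF stack_loadedD(1)[OF stack]] ab(3) a_def b_def)
qed

lemma append_run_correct:
  assumes stack: "stack_loaded s R A" and runs: "runs_loaded ps R A"
    and symbol: "R Symbol = c" "R Count = k" and room: "length ps < E"
  shows "wp append_run (\<lambda>R' A' t'. stack_loaded s R' A' \<and> runs_loaded (ps @ [(c, k)]) R' A' \<and>
    t' = t + 11) R A t"
proof -
  have "stores ((A Output)(2 * length ps := c, Suc (2 * length ps) := k)) (flat_runs (ps @ [(c, k)]))"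
    using stores_snoc[OF stores_snoc[of "A Output" "flat_runs ps" c], of k] runs
    by (simp add: runs_loaded_def)
  then show ?thesis
    using runs room num_edges_less stack symbol
    by (simp add: append_run_def input_loadedD[OF stack_loadedD(1)[OF stack]] runs_loaded_def)
qed

lemma extend_run_correct:
  assumes stack: "stack_loaded s R A" and runs: "runs_loaded (ps @ [(c, k)]) R A"
    and position: "R Tmp1 = Suc (2 * length ps)" and room: "length ps < E" "k + R Count < W"
  shows "wp extend_run
    (\<lambda>R' A' t'. stack_loaded s R' A' \<and> runs_loaded (ps @ [(c, k + R Count)]) R' A' \<and> t' \<le> t + 10) R A t"
proof -
  have "stores ((A Output)(Suc (2 * length ps) := k + R Count)) (flat_runs (ps @ [(c, k + R Count)]))"
    using runs stores_snoc[OF stores_append1, of "A Output" "flat_runs ps @ [c]" "[k]" "k + R Count"]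
    by (simp add: runs_loaded_def)
  moreover have "A Output (Suc (2 * length ps)) = k"
    using runs stores_nth[of "A Output" "flat_runs (ps @ [(c, k)])" "Suc (2 * length ps)"]
    by (simp add: runs_loaded_def nth_append)
  ultimately show ?thesis
    using stack runs position room num_edges_less
    by (simp add: extend_run_def input_loadedD[OF stack_loadedD(1)[OF stack]] runs_loaded_def)
qed

lemma emit_run_correct:
  assumes stack: "stack_loaded s R A" and runs: "runs_loaded (run_length_encode out) R A"
    and symbol: "R Symbol = c" "R Count = k" "0 < k"
    and room: "length (run_length_encode out) < E" "length out + k \<le> n"
  shows "wp emit_run (\<lambda>R' A' t'. stack_loaded s R' A' \<and>
    runs_loaded (run_length_encode (out @ replicate k c)) R' A' \<and>
    t' \<le> t + 40) R A t"
proof (cases "run_length_encode out" rule: rev_cases)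
  case Nil
  have "wp append_run (\<lambda>R' A' t'. stack_loaded s R' A' \<and> runs_loaded (add_run [] c k) R' A' \<and>
    t' \<le> t + 40) R A (t + 1)"
    using runs room symbol Nil by (intro wp_mono[OF append_run_correct[OF stack, of "[]" c k]]) auto
  then show ?thesis
    using runs Nil symbol(3)
    by (simp add: emit_run_def run_length_encode_append_replicate
        input_loadedD[OF stack_loadedD(1)[OF stack]]
        runs_loaded_def)
next
  case (snoc ps p)
  obtain c' k' where p: "p = (c', k')"
    by (cases p)
  note runs' = runs[unfolded snoc p]
  let ?R = "R(Tmp1 := Suc (2 * length ps), Tmp2 := 2 * length ps, Tmp2 := c')"
  let ?Q = "\<lambda>R' A' t'. stack_loaded s R' A' \<and> runs_loaded (add_run (ps @ [(c', k')]) c k) R' A' \<and>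
    t' \<le> t + 40"
  have "k' \<le> length out"
    using run_le_length[of c' k' out] snoc p by simp
  then have "wp extend_run ?Q ?R A (9 + t)" if "c' = c"
    using stack runs' symbol(2) room snoc p n_less that
    by (intro wp_mono[OF extend_run_correct[of s _ _ ps c k']]) auto
  moreover have "wp append_run ?Q ?R A (10 + t)" if "c' \<noteq> c"
    using stack runs' symbol room(1) snoc p that
    by (intro wp_mono[OF append_run_correct[of s _ _ "ps @ [(c', k')]" c k]]) auto
  moreover have "A Output (2 * length ps) = c'"
    using runs' stores_nth[of "A Output" "flat_runs (ps @ [(c', k')])" "2 * length ps"]
    by (simp add: runs_loaded_def nth_append)
  moreover have "R Out_end = Suc (Suc (2 * length ps))"
    using runs' by (simp add: runs_loaded_def)
  ultimately show ?thesis
    using symbol room(1) num_edges_less snoc p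
    by (simp add: emit_run_def run_length_encode_append_replicate
        input_loadedD[OF stack_loadedD(1)[OF stack]])
qed

definition traversal_loaded :: "nat list \<Rightarrow> nat set \<Rightarrow> str \<Rightarrow> register regs \<Rightarrow> array arrays \<Rightarrow> bool" where
  "traversal_loaded s D out R A \<longleftrightarrow>
     traversal s D out \<and> stack_loaded s R A \<and> runs_loaded (run_length_encode out) R A"

lemma traversal_room:
  assumes "traversal (f # s) D out"
  shows "length (run_length_encode out) < E" "length out + length (edge_bwt f) \<le> n"
  using assms traversal_card_le[OF assms] traversal_length_le[OF assms] by (auto simp: traversal_def)

lemma emit_edge_correct:
  assumes trav: "traversal (f # s) D out" and f: "edge_bwt f = replicate k c" "0 < k"
    and stack: "stack_loaded s R A" and runs: "runs_loaded (run_length_encode out) R A"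
    and symbol: "R Symbol = c" "R Count = k"
  shows "wp emit_run (\<lambda>R' A' t'. traversal_loaded s (insert f D) (out @ replicate k c) R' A' \<and>
    t' \<le> t0 + 40) R A t0"
  using traversal_emit[OF trav f] traversal_room[OF trav] f(1)
  by (intro wp_mono[OF emit_run_correct[OF stack runs symbol f(2)]]) (auto simp: traversal_loaded_def)

lemma visit_primary_correct:
  assumes trav: "traversal (f # s) D out" and stack: "stack_loaded s R A"
    and runs: "runs_loaded (run_length_encode out) R A"
    and v: "R Node = tgt f" "f = ins (in_off (tgt f))"
  shows "wp visit_primary (\<lambda>R' A' t'. \<exists>s' out'. traversal_loaded s' (insert f D) out' R' A' \<and>
    t' + 20 * length s \<le> t + 100 + 20 * length s') R A t"
proof -
  note loaded = stack_loadedD(1)[OF stack] and top = traversal_top(1)[OF trav]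
  show ?thesis
  proof (cases "tgt f = sk")
    case True
    let ?R = "R(Edge := out_off rt, Symbol := label_symbol (out_off rt), Count := 1)"
    have bwt: "edge_bwt f = replicate 1 (label_symbol (out_off rt))"
      using edge_bwt_sink v(2) True by simp
    have "wp emit_run (\<lambda>R' A' t'. \<exists>s' out'. traversal_loaded s' (insert f D) out' R' A' \<and>
        t' + 20 * length s \<le> t + 100 + 20 * length s') ?R A (10 + t)"
      using stack runs by (intro wp_mono[OF emit_edge_correct[OF trav bwt]]) fastforce+
    moreover have "out_off rt < E" "rt \<le> N"
      using out_off_less_iff[OF rt_less] rt_neq_sk out_off_le[of "Suc rt"] rt_less by auto
    ultimately show ?thesis
      using True v(1) rt_less num_edges_less by (simp add: visit_primary_def input_loadedD[OF loaded])
  next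
    case False
    have trav': "traversal (out_edges (tgt f) @ s) (insert f D) out"
      using traversal_expand[of "tgt f" s D out] trav v(2) tgt_less[OF top] tgt_neq_rt[OF top] False
      by simp
    then have "wp push_out_edges (\<lambda>R' A' t'. \<exists>s' out'. traversal_loaded s' (insert f D) out' R' A' \<and>
        t' + 20 * length s \<le> t + 100 + 20 * length s') R A (2 + t)"
      using stack runs v(1) tgt_less[OF top] traversal_card_le[OF trav']
      by (intro wp_mono[OF push_out_edges_correct[of s R A "run_length_encode out" "tgt f"]])
        (fastforce simp: traversal_loaded_def)+
    then show ?thesis
      using False v(1) by (simp add: visit_primary_def input_loadedD[OF loaded])
  qed
qed

lemma visit_secondary_correct:
  assumes trav: "traversal (f # s) D out" and stack: "stack_loaded s R A"
    and runs: "runs_loaded (run_length_encode out) R A"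
    and v: "R Node = tgt f" and p: "R Pos = p" "f = ins p" "in_off (tgt f) < p" "p < in_off (Suc (tgt f))"
  shows "wp visit_secondary (\<lambda>R' A' t'. \<exists>s' out'. traversal_loaded s' (insert f D) out' R' A' \<and>
    t' + 20 * length s \<le> t + 100 + 20 * length s') R A t"
proof -
  note loaded = stack_loadedD(1)[OF stack] and tables = stack_loadedD(2)[OF stack]
  define g c k where "g = ins (p - 1)" and "c = entry_symbol g" and "k = num_paths (tgt f)"
  have v_less: "tgt f < N"
    by (rule tgt_less[OF traversal_top(1)[OF trav]])
  have g: "p - 1 < E" "g < E"
    using p(3,4) in_off_le[of "Suc (tgt f)"] ins_less[of "p - 1"] by (simp_all add: g_def)
  have bwt: "edge_bwt f = replicate k c" "0 < k"
    using edge_bwt_secondary[OF v_less p(3,4)] num_paths_pos[OF v_less] p(2)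
    by (simp_all add: g_def c_def k_def)
  let ?R = "R(Pos := p - 1, Edge := g, Count := k)"
  let ?Q = "\<lambda>R' A' t'. \<exists>s' out'. traversal_loaded s' (insert f D) out' R' A' \<and>
    t' + 20 * length s \<le> t + 100 + 20 * length s'"
  have "wp emit_run ?Q R' A t'" if "R' = ?R(Source := src g, Symbol := c)" "t' \<le> t + 50" for R' t'
    using stack runs that by (intro wp_mono[OF emit_edge_correct[OF trav bwt]]) fastforce+
  moreover have "A Node_symbol (src g) = node_symbol (src g)" if "src g \<noteq> rt"
    using tables_loadedD(2)[OF tables src_less[OF g(2)] that] .
  ultimately have "wp read_entry_symbol (wp emit_run ?Q) ?R A (9 + t)"
    using loaded g(2) by (intro wp_mono[OF read_entry_symbol_correct[of ?R A g]]) (auto simp: c_def)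
  moreover have "0 < p" "p < W" "A In_edge (p - 1) = g" "A Path_count (tgt f) = k"
    using p(3,4) in_off_le[of "Suc (tgt f)"] num_edges_less input_loadedD(12)[OF loaded g(1)]
      tables_loadedD(1)[OF tables v_less] by (simp_all add: g_def k_def)
  ultimately show ?thesis
    using g(1) v p(1) node_bounds[OF v_less]
    by (simp add: visit_secondary_def input_loadedD(6)[OF loaded] Suc_leI)
qed

lemma visit_edge_correct:
  assumes state: "traversal_loaded (f # s) D out R A"
  shows "wp visit_edge (\<lambda>R' A' t'. \<exists>s' out'. traversal_loaded s' (insert f D) out' R' A' \<and>
    t' + 20 * length s \<le> t + 120 + 20 * length s') R A t"
proof -
  have trav: "traversal (f # s) D out" and stack: "stack_loaded (f # s) R A"
    and runs: "runs_loaded (run_length_encode out) R A"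
    using state by (auto simp: traversal_loaded_def)
  note loaded = stack_loadedD(1)[OF stack] and tables = stack_loadedD(2)[OF stack]
    and edge = traversal_top(1)[OF trav]
  define v where "v = tgt f"
  obtain p where p: "p < E" "ins p = f"
    using ins_exists[OF edge] .
  then have p_group: "in_off v \<le> p" "p < in_off (Suc v)"
    using tgt_ins_eq_iff[of p v] by (auto simp: v_def)
  have top: "R Top = Suc (length s)" "A Stack (length s) = f" "stores (A Stack) (rev s)"
    using stack stores_nth[of "A Stack" "rev (f # s)" "length s"]
      stores_append1[of "A Stack" "rev s" "[f]"]
    by (simp_all add: stack_loaded_def nth_append)
  have position: "A In_position f = p"
    using tables_loadedD(3)[OF tables p(1)] p(2) by simp
  have bounds: "length s < 2 * E + 2" "Suc (length s) < W" "f < 2 * E + 2" "v \<le> N" "v < N"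
    using traversal_card_le[OF trav] edge tgt_less[OF edge] num_edges_less by (auto simp: v_def)
  let ?R = "R(Top := length s, Edge := f, Node := v, Pos := p, Tmp1 := in_off v)"
  let ?Q = "\<lambda>R' A' t'. \<exists>s' out'. traversal_loaded s' (insert f D) out' R' A' \<and>
    t' + 20 * length s \<le> t + 120 + 20 * length s'"
  have stack': "stack_loaded s ?R A" and runs': "runs_loaded (run_length_encode out) ?R A"
    using stack runs top(3) by (simp_all add: stack_loaded_def)
  have "wp visit_primary ?Q ?R A (18 + t)" if "p = in_off v"
    using p(2) that by (intro wp_mono[OF visit_primary_correct[OF trav stack' runs']]) (auto simp: v_def)
  moreover have "wp visit_secondary ?Q ?R A (19 + t)" if "p \<noteq> in_off v"
    using p p_group that
    by (intro wp_mono[OF visit_secondary_correct[OF trav stack' runs', of p]]) (auto simp: v_def)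
  ultimately show ?thesis
    using edge top(1,2) position bounds
    by (simp add: visit_edge_def input_loadedD[OF loaded] v_def[symmetric])
qed

definition traversal_invariant :: "nat \<Rightarrow> register regs \<Rightarrow> array arrays \<Rightarrow> nat \<Rightarrow> bool" where
  "traversal_invariant t0 R A t \<longleftrightarrow> (\<exists>s D out. traversal_loaded s D out R A \<and>
     t \<le> t0 + 150 * card D + 20 * (card D + length s))"

lemma traversal_invariant_step:
  assumes "traversal_invariant t0 R A t" "R Zero < R Top"
  shows "wp visit_edge (traversal_invariant t0) R A (t + 2)"
proof -
  obtain s' D out where loaded: "traversal_loaded s' D out R A"
    and bound: "t \<le> t0 + 150 * card D + 20 * (card D + length s')"
    using assms(1) by (auto simp: traversal_invariant_def)
  obtain f s where s': "s' = f # s"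
    using assms(2) loaded by (cases s') (auto simp: traversal_loaded_def stack_loaded_def)
  have "card (insert f D) = Suc (card D)"
    using loaded s' traversal_top(2) by (auto simp: traversal_loaded_def)
  then show ?thesis
    using bound s'
    by (intro wp_mono[OF visit_edge_correct[OF loaded[unfolded s']]])
      (fastforce simp: traversal_invariant_def)
qed

lemma traversal_loop_correct:
  assumes "traversal_invariant t0 R A t"
  shows "wp (While_less Zero Top visit_edge) (\<lambda>R' A' t'. input_loaded R' A' \<and>
    runs_loaded (run_length_encode root_bwt) R' A' \<and> t' \<le> t0 + 2 + 170 * E) R A t"
proof (rule wp_While[where I = "traversal_invariant t0", OF assms])
  fix R A t assume inv: "traversal_invariant t0 R A t"
  then obtain s D out where loaded: "traversal_loaded s D out R A"
    and bound: "t \<le> t0 + 150 * card D + 20 * (card D + length s)"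
    by (auto simp: traversal_invariant_def)
  then show le: "t \<le> t0 + 170 * E"
    using traversal_card_le[of s D out] by (simp add: traversal_loaded_def)
  assume "\<not> R Zero < R Top"
  then have "s = []" "input_loaded R A"
    using loaded input_loadedD(5)[of R A] by (auto simp: traversal_loaded_def stack_loaded_def)
  then show "input_loaded R A \<and> runs_loaded (run_length_encode root_bwt) R A \<and> t + 2 \<le> t0 + 2 + 170 * E"
    using loaded le traversal_done[of D out] by (simp add: traversal_loaded_def)
qed (rule traversal_invariant_step)

lemma output_runs_correct:
  assumes loaded: "input_loaded R A" and tables: "tables_loaded A"
  shows "wp output_runs (\<lambda>R' A' t'. input_loaded R' A' \<and> runs_loaded (run_length_encode root_bwt) R' A' \<and>
    t' \<le> t + 50 + 190 * E) R A t"
proof -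
  let ?Q = "\<lambda>R' A' t'. input_loaded R' A' \<and> runs_loaded (run_length_encode root_bwt) R' A' \<and>
    t' \<le> t + 50 + 190 * E"
  let ?R = "R(Top := 0, Out_end := 0, Num_runs := 0, Node := rt)"
  have "wp push_out_edges (wp (While_less Zero Top visit_edge) ?Q) ?R A (t + 1 + 1 + 1 + 1)"
  proof (rule wp_mono[OF push_out_edges_correct[of "[]" _ _ "[]" rt]])
    show "stack_loaded [] ?R A" "runs_loaded [] ?R A"
      using assms by (simp_all add: stack_loaded_def runs_loaded_def)
    show "length (out_edges rt) + length [] \<le> E"
      using traversal_card_le[OF traversal_init] by simp
    fix R' A' t'
    assume "stack_loaded (out_edges rt @ []) R' A' \<and> runs_loaded [] R' A' \<and>
      t' \<le> t + 1 + 1 + 1 + 1 + 20 + 20 * length (out_edges rt)"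
    then have "traversal_invariant (t + 40) R' A' t'"
      unfolding traversal_invariant_def using traversal_init
      by (intro exI[of _ "out_edges rt"] exI[of _ "{}"] exI[of _ "[]"]) (simp add: traversal_loaded_def)
    then show "wp (While_less Zero Top visit_edge) ?Q R' A' t'"
      by (rule wp_mono[OF traversal_loop_correct]) auto
  qed (simp_all add: rt_less)
  then show ?thesis
    using num_edges_less node_bounds[OF rt_less] by (simp add: output_runs_def input_loadedD[OF loaded])
qed

lemma rlbwt_main_correct:
  assumes "input_loaded R A"
  shows "wp rlbwt_main (\<lambda>R' A' t'. input_loaded R' A' \<and> runs_loaded (run_length_encode root_bwt) R' A' \<and>
    t' \<le> t + 90 + 130 * N + 260 * E) R A t"
  unfolding rlbwt_main_def
proof (rule wp_SeqI[OF init_counters_correct[OF assms]])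
  fix R1 A1 t1
  assume init: "input_loaded R1 A1 \<and> counters {} A1 \<and> t1 \<le> t + 30 * N + 10"
  show "wp (count_paths ;; node_symbols ;; in_positions ;; output_runs) (\<lambda>R' A' t'. input_loaded R' A' \<and>
    runs_loaded (run_length_encode root_bwt) R' A' \<and> t' \<le> t + 90 + 130 * N + 260 * E) R1 A1 t1"
  proof (rule wp_SeqI[OF count_paths_correct])
    fix R2 A2 t2
    assume "input_loaded R2 A2 \<and> (\<exists>q. queue_loaded q A2) \<and> path_counts_loaded A2 \<and>
      t2 \<le> t1 + 10 + 50 * N + 50 * E"
    then obtain q where counted: "input_loaded R2 A2" "queue_loaded q A2" "path_counts_loaded A2"
      "t2 \<le> t1 + 10 + 50 * N + 50 * E"
      by blast
    show "wp (node_symbols ;; in_positions ;; output_runs) (\<lambda>R' A' t'. input_loaded R' A' \<and>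
      runs_loaded (run_length_encode root_bwt) R' A' \<and> t' \<le> t + 90 + 130 * N + 260 * E) R2 A2 t2"
    proof (rule wp_SeqI[OF node_symbols_correct[OF counted(1-3)]], rule wp_SeqI[OF in_positions_correct])
      fix R3 A3 t3 R4 A4 t4
      assume "input_loaded R3 A3 \<and> path_counts_loaded A3 \<and> node_symbols_loaded A3 \<and> t3 \<le> t2 + 10 + 50 * N"
        "input_loaded R4 A4 \<and> tables_loaded A4 \<and> t4 \<le> t3 + 10 + 20 * E"
      then show "wp output_runs (\<lambda>R' A' t'. input_loaded R' A' \<and>
        runs_loaded (run_length_encode root_bwt) R' A' \<and> t' \<le> t + 90 + 130 * N + 260 * E) R4 A4 t4"
        using init counted(4) by (intro wp_mono[OF output_runs_correct]) auto
    qed simp_all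
  qed (use init in simp_all)
qed

end


section \<open>Memory layout\<close>

primrec array_base :: "nat \<Rightarrow> nat \<Rightarrow> array \<Rightarrow> nat" where
  "array_base N E Out_offset = 4 + N"
| "array_base N E In_offset = 5 + 2 * N"
| "array_base N E Edge_source = 6 + 3 * N"
| "array_base N E Edge_symbol = 7 + 3 * N"
| "array_base N E Edge_target = 9 + 3 * N"
| "array_base N E In_edge = 6 + 3 * N + 4 * E"
| "array_base N E Degree = 6 + 3 * N + 5 * E"
| "array_base N E Path_count = 8 + 3 * N + 7 * E"
| "array_base N E Queue = 10 + 3 * N + 9 * E"
| "array_base N E Node_symbol = 12 + 3 * N + 11 * E"
| "array_base N E In_position = 14 + 3 * N + 13 * E"
| "array_base N E Stack = 16 + 3 * N + 15 * E"
| "array_base N E Output = 18 + 3 * N + 17 * E"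

definition array_stride :: "array \<Rightarrow> nat" where
  "array_stride a = (if a \<in> {Edge_source, Edge_symbol, Edge_target} then 4 else 1)"

definition work_arrays :: "array set" where
  "work_arrays = {Degree, Path_count, Queue, Node_symbol, In_position, Stack, Output}"

lemma writes_rlbwt_main: "writes rlbwt_main \<subseteq> work_arrays"
  by (simp add: work_arrays_def rlbwt_main_def init_counters_def init_counters_step_def count_paths_def
      process_node_def process_in_edge_def node_symbols_def node_symbols_step_def read_entry_symbol_def
      in_positions_def in_positions_step_def output_runs_def visit_edge_def visit_primary_def
      visit_secondary_def push_out_edges_def push_edge_def emit_run_def append_run_def
      extend_run_def)

lemma array_memory_layout:
  assumes "20 + 3 * N + 19 * E \<le> m" "m \<le> 2 ^ w"
  shows "memory_layout w (array_len N E) m work_arrays (array_base N E) array_stride"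
proof
  show "array_base N E a + array_stride a * i < m" if "i < array_len N E a" for a i
    using that assms(1) by (cases a) (simp_all add: array_stride_def)
  show "array_stride a < 2 ^ w" for a
    using assms by (simp add: array_stride_def)
  show "a = a' \<and> i = i'"
    if a: "a \<in> work_arrays" and i: "i < array_len N E a" "i' < array_len N E a'"
      and eq: "array_base N E a + array_stride a * i = array_base N E a' + array_stride a' * i'"
        for a a' i i'
    using a i eq by (cases a; cases a') (simp_all add: work_arrays_def array_stride_def)
qed (rule assms(2))

fun straight_line :: "nat \<Rightarrow> instr list \<Rightarrow> (nat \<Rightarrow> nat) \<Rightarrow> nat list \<Rightarrow> (nat \<Rightarrow> nat) \<Rightarrow> bool" where
  "straight_line w [] R M R' \<longleftrightarrow> R' = R"
| "straight_line w (Const d k # cs) R M R' \<longleftrightarrow> k < 2 ^ w \<and> straight_line w cs (R(d := k)) M R'"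
| "straight_line w (Op Add d a b # cs) R M R' \<longleftrightarrow>
     R a + R b < 2 ^ w \<and> straight_line w cs (R(d := R a + R b)) M R'"
| "straight_line w (Op Mul d a b # cs) R M R' \<longleftrightarrow>
     R a * R b < 2 ^ w \<and> straight_line w cs (R(d := R a * R b)) M R'"
| "straight_line w (Load d a # cs) R M R' \<longleftrightarrow> R a < length M \<and> straight_line w cs (R(d := M ! R a)) M R'"
| "straight_line w (_ # cs) R M R' \<longleftrightarrow> False"

lemma steps_straight_line:
  assumes "straight_line w cs R M R'" "code_at P pc cs"
  shows "steps w P (length cs) (pc, R, M) = Some (pc + length cs, R', M)"
  using assms by (induction w cs R M R' arbitrary: pc rule: straight_line.induct) auto

text \<open>The first four words of the input are the numbers of nodes and edges, the root and the sink.\<close>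

definition prologue :: "instr list" where
  "prologue =
     [Const (reg Zero) 0, Const (reg One) 1,
      Load (reg Num_nodes) (reg Zero),
      Load (reg Num_edges) (reg One),
      Op Add 0 (reg One) (reg One), Load (reg Root) 0,
      Op Add 0 0 (reg One), Load (reg Sink) 0,
      Op Add 0 0 (reg One), Op Add (base_reg Out_offset) 0 (reg Num_nodes),
      Op Add 1 (reg Num_nodes) (reg One),
      Op Add (base_reg In_offset) (base_reg Out_offset) 1,
      Op Add (base_reg Edge_source) (base_reg In_offset) 1,
      Op Add (base_reg Edge_symbol) (base_reg Edge_source) (reg One),
      Op Add 1 (reg One) (reg One), Op Add (base_reg Edge_target) (base_reg Edge_symbol) 1,
      Op Mul 1 0 (reg Num_edges), Op Add (base_reg In_edge) (base_reg Edge_source) 1,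
      Op Add (base_reg Degree) (base_reg In_edge) (reg Num_edges),
      Op Add 1 (reg Num_edges) (reg One), Op Add 1 1 1,
      Op Add (base_reg Path_count) (base_reg Degree) 1,
      Op Add (base_reg Queue) (base_reg Path_count) 1,
      Op Add (base_reg Node_symbol) (base_reg Queue) 1,
      Op Add (base_reg In_position) (base_reg Node_symbol) 1,
      Op Add (base_reg Stack) (base_reg In_position) 1,
      Op Add (base_reg Output) (base_reg Stack) 1]"

definition epilogue :: "instr list" where
  "epilogue = [Op Add 0 (base_reg Output) (reg Zero), Op Add 1 (reg Num_runs) (reg Zero)]"

definition rlbwt_program :: "instr list" where
  "rlbwt_program = prologue @ compile array_stride (length prologue) rlbwt_main @ epilogue @ [Halt]"

lemma code_at_rlbwt_program:
  "code_at rlbwt_program 0 prologue"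
  "code_at rlbwt_program (length prologue) (compile array_stride (length prologue) rlbwt_main)"
  "code_at rlbwt_program (length prologue + code_size rlbwt_main) (epilogue @ [Halt])"
proof -
  have "code_at rlbwt_program 0 rlbwt_program"
    by (simp add: code_at_def)
  then show "code_at rlbwt_program 0 prologue"
    "code_at rlbwt_program (length prologue) (compile array_stride (length prologue) rlbwt_main)"
    "code_at rlbwt_program (length prologue + code_size rlbwt_main) (epilogue @ [Halt])"
    by (auto simp: rlbwt_program_def)
qed

lemma UNIV_array:
  "UNIV = {Out_offset, In_offset, Edge_source, Edge_symbol, Edge_target, In_edge,
     Degree, Path_count, Queue, Node_symbol, In_position, Stack, Output}"
  using array.exhaust by blast

lemma prologue_correct:
  assumes memory: "20 + 3 * N + 19 * E \<le> 2 ^ w" "4 \<le> length M"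
    and header: "M ! 0 = N" "M ! 1 = E" "M ! 2 = rt" "M ! 3 = sk"
  obtains R where "straight_line w prologue (\<lambda>_. 0) M R"
    "R (reg Num_nodes) = N" "R (reg Num_edges) = E" "R (reg Root) = rt" "R (reg Sink) = sk"
    "R (reg Zero) = 0" "R (reg One) = 1" "\<And>a. R (base_reg a) = array_base N E a"
proof -
  have bounds: "x < 2 ^ w" if "x < 20 + 3 * N + 19 * E" for x
    using memory(1) that by simp
  have M: "M \<noteq> []" "M ! Suc 0 = E" "M ! Suc (Suc 0) = rt" "M ! Suc (Suc (Suc 0)) = sk"
    using memory(2) header by (auto simp: eval_nat_numeral)
  have "\<exists>R. straight_line w prologue (\<lambda>_. 0) M R \<and>
      R (reg Num_nodes) = N \<and> R (reg Num_edges) = E \<and> R (reg Root) = rt \<and> R (reg Sink) = sk \<and>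
      R (reg Zero) = 0 \<and> R (reg One) = 1 \<and> (\<forall>a \<in> UNIV. R (base_reg a) = array_base N E a)"
    unfolding prologue_def UNIV_array using header M memory(2) by (simp add: bounds)
  then show ?thesis
    using that by auto
qed


section \<open>Running the program on a self-index\<close>

lemma nth_append_middle: "length xs = n \<Longrightarrow> i < length ys \<Longrightarrow> (xs @ ys @ zs) ! (n + i) = ys ! i"
  by (auto simp: nth_append)

lemma nth_concat_blocks:
  assumes "\<And>x. length (g x) = d" "f < length xs" "j < d"
  shows "concat (map g xs) ! (d * f + j) = g (xs ! f) ! j"
  using assms(2)
proof (induction xs arbitrary: f)
  case (Cons x xs)
  then show ?case
    using assms by (cases f) (auto simp: nth_append)
qed simp

lemma length_concat_blocks: "(\<And>x. length (g x) = d) \<Longrightarrow> length (concat (map g xs)) = d * length xs"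
  by (induction xs) auto

lemma take_drop_eq_map_nth: "b + k \<le> length xs \<Longrightarrow> take k (drop b xs) = map (\<lambda>i. xs ! (b + i)) [0..<k]"
  by (rule nth_equalityI) auto

definition edge_record :: "nat \<times> str \<times> nat \<Rightarrow> nat list" where
  "edge_record = (\<lambda>(i, l, j). [i, hd l, length l, j])"

lemma length_edge_record: "length (edge_record e) = 4"
  by (simp add: edge_record_def case_prod_unfold)

locale self_index_memory = self_index +
  fixes sl work :: "nat list" and w :: nat
  assumes length_sl: "length sl = N"
begin

definition input :: "nat list" where
  "input = [N, E, rt, sk] @ sl @ map out_off [0..<Suc N] @ map in_off [0..<Suc N] @
     concat (map edge_record es) @ ins"

definition memory :: "nat list" where
  "memory = input @ work"

definition initial_arrays :: "array arrays" where
  "initial_arrays a i = memory ! (array_base N E a + array_stride a * i)"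

lemma memory_header: "memory ! 0 = N" "memory ! 1 = E" "memory ! 2 = rt"
  "memory ! 3 = sk" "4 \<le> length memory"
  by (simp_all add: memory_def input_def)

lemma length_input: "length input = 6 + 3 * N + 5 * E"
  by (simp add: input_def length_sl length_ins length_concat_blocks[OF length_edge_record])

lemma memory_out_off:
  assumes "k \<le> N"
  shows "memory ! (4 + N + k) = out_off k"
proof -
  have "memory = ([N, E, rt, sk] @ sl) @ map out_off [0..<Suc N] @
      map in_off [0..<Suc N] @ concat (map edge_record es) @ ins @ work"
    by (simp add: memory_def input_def)
  then have "memory ! (4 + N + k) = map out_off [0..<Suc N] ! k"
    using assms length_sl by (simp only:) (rule nth_append_middle; simp)
  then show ?thesis
    using assms by (simp del: upt_Suc)
qed

lemma memory_in_off:
  assumes "k \<le> N"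
  shows "memory ! (5 + 2 * N + k) = in_off k"
proof -
  have "memory = ([N, E, rt, sk] @ sl @ map out_off [0..<Suc N]) @ map in_off [0..<Suc N] @
      concat (map edge_record es) @ ins @ work"
    by (simp add: memory_def input_def)
  then have "memory ! (5 + 2 * N + k) = map in_off [0..<Suc N] ! k"
    using assms length_sl by (simp only:) (rule nth_append_middle; simp)
  then show ?thesis
    using assms by (simp del: upt_Suc)
qed

lemma memory_edge_record:
  assumes "f < E" "j < 4" "i = 6 + 3 * N + (4 * f + j)"
  shows "memory ! i = [src f, hd (lab f), length (lab f), tgt f] ! j"
proof -
  have "memory = ([N, E, rt, sk] @ sl @ map out_off [0..<Suc N] @ map in_off [0..<Suc N]) @
      concat (map edge_record es) @ ins @ work"
    by (simp add: memory_def input_def)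
  then have "memory ! i = concat (map edge_record es) ! (4 * f + j)"
    using assms length_sl
    by (simp only:) (rule nth_append_middle; simp add: length_concat_blocks[OF length_edge_record])
  also have "\<dots> = edge_record (es ! f) ! j"
    by (rule nth_concat_blocks[OF length_edge_record assms(1,2)])
  finally show ?thesis
    by (simp add: es_nth edge_record_def)
qed

lemma memory_ins:
  assumes "p < E"
  shows "memory ! (6 + 3 * N + 4 * E + p) = ins ! p"
proof -
  have "memory = ([N, E, rt, sk] @ sl @ map out_off [0..<Suc N] @ map in_off [0..<Suc N] @
      concat (map edge_record es)) @ ins @ work"
    by (simp add: memory_def input_def)
  then show ?thesis
    using assms length_sl length_ins
    by (simp only:) (rule nth_append_middle; simp add: length_concat_blocks[OF length_edge_record])
qed

lemma initial_arrays_offsets: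
  assumes "k \<le> N"
  shows "initial_arrays Out_offset k = out_off k" "initial_arrays In_offset k = in_off k"
  using memory_out_off[OF assms] memory_in_off[OF assms]
  by (simp_all add: initial_arrays_def array_stride_def)

lemma initial_arrays_edges:
  assumes "f < E"
  shows "initial_arrays Edge_source f = src f" "initial_arrays Edge_symbol f = hd (lab f)"
    "initial_arrays Edge_target f = tgt f" "initial_arrays In_edge f = ins ! f"
proof -
  note entry = memory_edge_record[OF assms]
  show "initial_arrays Edge_source f = src f"
    unfolding initial_arrays_def by (simp add: array_stride_def entry[of 0])
  show "initial_arrays Edge_symbol f = hd (lab f)"
    unfolding initial_arrays_def by (simp add: array_stride_def entry[of 1])
  show "initial_arrays Edge_target f = tgt f"
    unfolding initial_arrays_def by (simp add: array_stride_def entry[of 3])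
  show "initial_arrays In_edge f = ins ! f"
    unfolding initial_arrays_def by (simp add: array_stride_def memory_ins[OF assms])
qed

end

locale rlbwt_run = self_index_memory +
  assumes length_work: "length work = 1000 * cdawg_size T"
    and word_size: "word_size_ok w T input (1000 * cdawg_size T)"
begin

lemma memory_bounds: "20 + 3 * N + 19 * E < length memory" "length memory \<le> 2 ^ w"
  and time_bound: "180 + 130 * N + 260 * E \<le> 1000 * cdawg_size T"
proof -
  have sizes: "N \<le> Suc E" "0 < E" "E \<le> cdawg_size T"
    by (rule graph.num_nodes_le, rule graph.num_edges_pos, rule num_edges_le_cdawg_size)
  have length_memory: "length memory = 6 + 3 * N + 5 * E + 1000 * cdawg_size T"
    by (simp add: memory_def length_input length_work)
  show "20 + 3 * N + 19 * E < length memory" "180 + 130 * N + 260 * E \<le> 1000 * cdawg_size T"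
    using sizes unfolding length_memory by linarith+
  show "length memory \<le> 2 ^ w"
    using word_size by (simp add: length_memory length_input word_size_ok_def)
qed

sublocale layout: memory_layout w "array_len N E" "length memory" work_arrays
  "array_base N E" array_stride
  using memory_bounds by (intro array_memory_layout) simp_all

sublocale alg: rlbwt_algorithm N E rt sk src tgt out_off in_off "\<lambda>p. ins ! p"
  "\<lambda>k. node_length (ns ! k)" num_paths
  "length T" "\<lambda>f. hd (lab f)" "\<lambda>f. hd (entry_string f)" "\<lambda>k. hd (shortest (ns ! k))" edge_bwt "2 ^ w"
  using memory_bounds word_size by unfold_locales (simp_all add: word_size_ok_def)

lemma rlbwt_main_run:
  assumes "alg.input_loaded R initial_arrays"
  obtains t R' A' where "layout.exec rlbwt_main R initial_arrays t R' A'" "t \<le> 90 + 130 * N + 260 * E"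
    "R' Zero = 0" "alg.runs_loaded (rlbwt T) R' A'"
  using alg.rlbwt_main_correct[OF assms, of 0] alg.input_loadedD(5)
  by (auto simp: layout.wp_def rlbwt_def root_bwt_eq_bwt)

lemma initial_state:
  obtains R' where "steps w rlbwt_program (length prologue) (0, \<lambda>_. 0, memory) =
    Some (length prologue, R', memory)"
    "alg.input_loaded (\<lambda>r :: register. R' (reg r)) initial_arrays"
    "layout.represents R' memory (\<lambda>r :: register. R' (reg r)) initial_arrays"
proof -
  have "20 + 3 * N + 19 * E \<le> 2 ^ w"
    using memory_bounds by simp
  then obtain R' where R': "straight_line w prologue (\<lambda>_. 0) memory R'"
    "R' (reg Num_nodes) = N" "R' (reg Num_edges) = E" "R' (reg Root) = rt" "R' (reg Sink) = sk"
    "R' (reg Zero) = 0" "R' (reg One) = 1" "\<And>a. R' (base_reg a) = array_base N E a"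
    using prologue_correct[OF _ memory_header(5,1-4)] by metis
  show ?thesis
  proof (rule that)
    show "steps w rlbwt_program (length prologue) (0, \<lambda>_. 0, memory) = Some (length prologue, R', memory)"
      using steps_straight_line[OF R'(1) code_at_rlbwt_program(1)] by simp
    show "alg.input_loaded (\<lambda>r :: register. R' (reg r)) initial_arrays"
      using R'(2-7) by (simp add: alg.input_loaded_def initial_arrays_offsets initial_arrays_edges)
    show "layout.represents R' memory (\<lambda>r :: register. R' (reg r)) initial_arrays"
      by (simp add: layout.represents_def R'(8) initial_arrays_def)
  qed
qed

lemma outputs_stored_runs:
  assumes rep: "layout.represents R' M R A" and runs: "alg.runs_loaded ps R A" and "length ps \<le> E"
    and R'': "R'' 0 = array_base N E Output" "R'' 1 = length ps"
  shows "outputs_pairs R'' M ps"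
proof -
  let ?b = "array_base N E Output"
  have "take (2 * length ps) (drop ?b M) = map (\<lambda>i. M ! (?b + i)) [0..<2 * length ps]"
    using memory_bounds assms(3) layout.representsD(3)[OF rep] by (intro take_drop_eq_map_nth) simp
  also have "\<dots> = map (A Output) [0..<2 * length ps]"
    using layout.representsD(4)[OF rep, of _ Output] assms(3) by (simp add: array_stride_def)
  also have "\<dots> = flat_runs ps"
    using runs by (intro nth_equalityI) (auto simp: alg.runs_loaded_def stores_nth)
  finally show ?thesis
    using R'' by (simp add: outputs_pairs_def flat_runs_def)
qed

lemma program_run:
  "\<exists>t \<le> 1000 * cdawg_size T. \<exists>R M. halts_in w rlbwt_program t memory R M \<and> outputs_pairs R M (rlbwt T)"
proof -
  let ?pc = "length prologue + code_size rlbwt_main"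
  obtain R0 where start: "steps w rlbwt_program (length prologue) (0, \<lambda>_. 0, memory) =
    Some (length prologue, R0, memory)"
    and loaded: "alg.input_loaded (\<lambda>r :: register. R0 (reg r)) initial_arrays"
    and represents: "layout.represents R0 memory (\<lambda>r :: register. R0 (reg r)) initial_arrays"
    by (rule initial_state)
  obtain t R A where exec: "layout.exec rlbwt_main (\<lambda>r :: register. R0 (reg r)) initial_arrays t R A"
    and t: "t \<le> 90 + 130 * N + 260 * E" and R: "R Zero = 0" "alg.runs_loaded (rlbwt T) R A"
    using rlbwt_main_run[OF loaded] .
  obtain R' M where main: "steps w rlbwt_program t (length prologue, R0, memory) = Some (?pc, R', M)"
    and rep: "layout.represents R' M R A"
    using layout.compile_correct[OF exec writes_rlbwt_main represents code_at_rlbwt_program(2)]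
    by (auto simp: layout.reaches_def)
  define R'' where "R'' = R'(0 := array_base N E Output, 1 := length (rlbwt T))"
  have "straight_line w epilogue R' M R''"
    using layout.representsD(1,2)[OF rep] R memory_bounds rlbwt_length_le
    by (simp add: epilogue_def R''_def alg.runs_loaded_def)
  then have finish:
    "steps w rlbwt_program (length epilogue) (?pc, R', M) = Some (?pc + length epilogue, R'', M)"
    using code_at_rlbwt_program(3) by (intro steps_straight_line) simp_all
  have "steps w rlbwt_program (length prologue + t + length epilogue) (0, \<lambda>_. 0, memory) =
      Some (?pc + length epilogue, R'', M)"
    by (rule steps_trans[OF steps_trans[OF start main] finish])
  moreover have "?pc + length epilogue < length rlbwt_program"
    "rlbwt_program ! (?pc + length epilogue) = Halt"
    using code_at_rlbwt_program(3) by simp_all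
  ultimately have "halts_in w rlbwt_program (length prologue + t + length epilogue) memory R'' M"
    by (auto simp: halts_in_def)
  moreover have "length prologue + t + length epilogue \<le> 1000 * cdawg_size T"
    using t time_bound by (simp add: prologue_def epilogue_def)
  moreover have "outputs_pairs R'' M (rlbwt T)"
    by (rule outputs_stored_runs[OF rep R(2) rlbwt_length_le]) (simp_all add: R''_def)
  ultimately show ?thesis
    by blast
qed

end

lemma cdawg_self_index_cases:
  assumes "terminated T" "cdawg_self_index T xs"
  obtains ns rt sk es ins sl where "self_index_memory T ns rt sk es ins sl"
    "xs = self_index_memory.input ns rt sk es ins sl"
  using assms(2) unfolding cdawg_self_index_def
proof (elim exE conjE, goal_cases)
  case prems: (1 ns rt sk sl es ins)
  interpret self_index_memory T ns rt sk es ins sl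
    by unfold_locales (fact assms(1) prems)+
  have "xs = input"
    unfolding prems(16) input_def out_off_def[abs_def] in_off_def[abs_def] edge_record_def by (rule refl)
  then show ?case
    using prems(1) self_index_memory_axioms by blast
qed

lemma rlbwt_program_correct:
  assumes "terminated T" "cdawg_self_index T xs" and w: "word_size_ok w T xs (1000 * cdawg_size T)"
  shows "ram_computes w rlbwt_program xs (rlbwt T) (1000 * cdawg_size T) (1000 * cdawg_size T)"
  unfolding ram_computes_def
proof (intro allI impI, elim conjE)
  fix work :: "nat list" assume work: "length work = 1000 * cdawg_size T"
  obtain ns rt sk es ins sl where "self_index_memory T ns rt sk es ins sl"
    and xs: "xs = self_index_memory.input ns rt sk es ins sl"
    using cdawg_self_index_cases[OF assms(1,2)] .
  then interpret self_index_memory T ns rt sk es ins sl work w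
    by simp
  interpret rlbwt_run T ns rt sk es ins sl work w
    using work w by unfold_locales (simp_all add: xs)
  show "\<exists>t \<le> 1000 * cdawg_size T. \<exists>R' M'. halts_in w rlbwt_program t (xs @ work) R' M' \<and>
      outputs_pairs R' M' (rlbwt T)"
    using program_run by (simp add: memory_def xs)
qed

theorem theorem1:
  shows "(\<forall>T. terminated T \<longrightarrow> bwt_runs T \<le> cdawg_size T) \<and>
    (\<exists>P C. \<forall>T xs w. terminated T \<longrightarrow> cdawg_self_index T xs \<longrightarrow>
       word_size_ok w T xs (C * cdawg_size T) \<longrightarrow>
       ram_computes w P xs (rlbwt T) (C * cdawg_size T) (C * cdawg_size T))"
  using bwt_runs_le_cdawg_size rlbwt_program_correct by blast

end
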